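(* Suppose $v$ satisfies Assumptions A1 and A2 (stated in the context) with constants $s_0,c_0$. Let $s\ge s^*$ be such that $\mathcal U(s)\subset\Theta$, and suppose $\epsilon_3,\epsilon_4(s)\lesssim1$. Let $$L_{\mathrm{TV}}=\frac12\int|S|\,d\hat\gamma=\frac1{12}\mathbb E\big|\langle\nabla^3V(\hat x),(H_V^{-1/2}Z)^{\otimes3}\rangle\big|,\quad Z\sim\mathcal N(0,I_d),\qquad R_{\mathrm{TV}}:=\mathrm{TV}(\pi,\hat\gamma)-L_{\mathrm{TV}}.$$ Then $$|R_{\mathrm{TV}}|\le\mathrm{TV}(\pi,\hat\gamma_S)\lesssim E_s\big(\epsilon_3^2+\epsilon_4(s)^2\big)+\tau_s .$$ Moreover $0\le L_{\mathrm{TV}}\le\bar\epsilon_3/2$, and hence $\mathrm{TV}(\pi,\hat\gamma)\le\bar\epsilon_3/2+|R_{\mathrm{TV}}|$. Furthermore, if $A$ is a Borel set in $\mathbb R^d$ which is symmetric about $\hat x$, then $$|\pi(A)-\hat\gamma(A)|\le\mathrm{TV}(\pi,\hat\gamma_S).$$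
   Context: Setting: $d\ge1$ is an integer, $n>0$, $\Theta\subseteq\mathbb R^d$ is open, $v:\Theta\to\mathbb R$, $V=nv$, and $\pi$ is the probability measure with density proportional to $e^{-V}$ on $\Theta$ (and zero outside $\Theta$). Notation: $\langle T,S\rangle$ is the entrywise inner product of tensors of the same order. For a symmetric positive definite matrix $H$, $\|x\|_H=\sqrt{x^\top Hx}$ for vectors and $\|T\|_H=\sup_{\|u\|_H=1}|\langle T,u^{\otimes k}\rangle|$ for symmetric tensors of order $k\ge2$. $\|T\|_F$ is the Frobenius norm. For a symmetric order-3 tensor $T$ and symmetric matrix $A$, $\langle T,A\rangle\in\mathbb R^d$ has coordinates $\langle T,A\rangle_i=\sum_{j,k}T_{ijk}A_{jk}$. For finite signed measures $\mu,\nu$ of total mass one, $\mathrm{TV}(\mu,\nu)=\sup_A|\mu(A)-\nu(A)|$, the supremum over Borel sets $A\subseteq\mathbb R^d$. A set $A$ is symmetric about $\hat x$ if $\hat x+y\in A\iff\hat x-y\in A$. Assumption A1: $v\in C^4(\Theta)$ has a unique global minimizer $\hat x\in\Theta$, and $H_v:=\nabla^2v(\hat x)\succ0$. Local region: $\mathcal U(s)=\{x\in\mathbb R^d:\|x-\hat x\|_{H_v}\le s\sqrt{d/n}\}$. Assumption A2: there exist $s_0>0$ and $c_0$ with $1\ge c_0>C/\sqrt d$ for some absolute constant $C>0$ such that $v(x)-v(\hat x)\ge c_0\sqrt{d/n}\,\|x-\hat x\|_{H_v}$ for all $x\in\Theta\setminus\mathcal U(s_0)$. Laplace approximation and correction: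 $H_V=\nabla^2V(\hat x)=nH_v$, $\hat\gamma=\mathcal N(\hat x,H_V^{-1})$, $S(x)=-\frac16\langle\nabla^3V(\hat x),(x-\hat x)^{\otimes3}\rangle$, and $\hat\gamma_S$ is the signed measure $d\hat\gamma_S=(1+S)\,d\hat\gamma$. Small quantities: with $W(x)=V(\hat x+H_V^{-1/2}x)$, $\bar\epsilon_3\ge0$ is defined by $\bar\epsilon_3^2=\frac16\|\nabla^3W(0)\|_F^2+\frac14\|\langle\nabla^3W(0),I_d\rangle\|^2$. Further, $\epsilon_3=d\,\|\nabla^3V(\hat x)\|_{H_V}$ and $\epsilon_4(s)=d\sup_{x\in\mathcal U(s)}\|\nabla^4V(x)\|_{H_V}^{1/2}$. Also $E_s=\exp\big((\epsilon_3^2+\epsilon_4(s)^2)s^4\big)$, $\tau_s=d\,e^{-c_0sd/8}$, $s^*=\max\big(s_0,\frac{8}{c_0}\log\frac{2e}{c_0}\big)$. Convention: $a\lesssim b$ means $a\le Cb$ for an absolute constant $C>0$; the hypothesis "$\epsilon_3,\epsilon_4(s)\lesssim1$" means both are bounded by some absolute constant, and the constant in the conclusion may depend on that bound and on the absolute constant in A2, but on nothing else. *)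

theory Defs
  imports "HOL-Probability.Probability"
begin

section \<open>The space \<open>\<real>\<^sup>d\<close>\<close>

text \<open>
  The constants hidden in the estimates must not depend on the dimension, so \<open>d\<close> has to be
  an ordinary variable that can be quantified inside a formula. Hence \<open>\<real>\<^sup>d\<close> is the carrier set of
  extensional functions on \<open>{..<d}\<close>. Its topology is the subspace topology of the product topology
  on functions, i.e. the Euclidean one; the sets of \<open>leb d\<close> are the Borel sets of \<open>\<real>\<^sup>d\<close> and
  \<open>leb d\<close> is Lebesgue measure on them.
\<close>

definition Rd :: "nat \<Rightarrow> (nat \<Rightarrow> real) set" where
  "Rd d = {..<d} \<rightarrow>\<^sub>E UNIV"

definition leb :: "nat \<Rightarrow> (nat \<Rightarrow> real) measure" where
  "leb d = PiM {..<d} (\<lambda>_. lborel)"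

definition vzero :: "nat \<Rightarrow> nat \<Rightarrow> real" where
  "vzero d = (\<lambda>i\<in>{..<d}. 0)"

definition vadd :: "nat \<Rightarrow> (nat \<Rightarrow> real) \<Rightarrow> (nat \<Rightarrow> real) \<Rightarrow> nat \<Rightarrow> real" where
  "vadd d x y = (\<lambda>i\<in>{..<d}. x i + y i)"

definition vsub :: "nat \<Rightarrow> (nat \<Rightarrow> real) \<Rightarrow> (nat \<Rightarrow> real) \<Rightarrow> nat \<Rightarrow> real" where
  "vsub d x y = (\<lambda>i\<in>{..<d}. x i - y i)"

definition symmetric_about :: "nat \<Rightarrow> (nat \<Rightarrow> real) \<Rightarrow> (nat \<Rightarrow> real) set \<Rightarrow> bool" where
  "symmetric_about d c A \<longleftrightarrow> (\<forall>y\<in>Rd d. vadd d c y \<in> A \<longleftrightarrow> vsub d c y \<in> A)"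


section \<open>Matrices and tensors\<close>

text \<open>
  A \<open>d \<times> d\<close> matrix is a function of two indices, of which only the entries with both indices below
  \<open>d\<close> matter. A tensor of order \<open>k\<close> is a function of the list of its \<open>k\<close> indices.
\<close>

type_synonym mtrx = "nat \<Rightarrow> nat \<Rightarrow> real"
type_synonym tensor = "nat list \<Rightarrow> real"

definition ident :: mtrx where
  "ident i j = (if i = j then 1 else 0)"

definition matvec :: "nat \<Rightarrow> mtrx \<Rightarrow> (nat \<Rightarrow> real) \<Rightarrow> nat \<Rightarrow> real" where
  "matvec d M x = (\<lambda>i\<in>{..<d}. \<Sum>j<d. M i j * x j)"

definition quad_form :: "nat \<Rightarrow> mtrx \<Rightarrow> (nat \<Rightarrow> real) \<Rightarrow> real" where
  "quad_form d H x = (\<Sum>i<d. \<Sum>j<d. x i * H i j * x j)"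

definition pos_def :: "nat \<Rightarrow> mtrx \<Rightarrow> bool" where
  "pos_def d H \<longleftrightarrow> (\<forall>i<d. \<forall>j<d. H i j = H j i) \<and> (\<forall>u\<in>Rd d. u \<noteq> vzero d \<longrightarrow> quad_form d H u > 0)"

text \<open>
  \<open>H\<^sup>-\<^sup>1\<^sup>/\<^sup>2\<close> is the symmetric positive definite \<open>R\<close> with \<open>R R H = I\<close>. The entries outside the
  \<open>d \<times> d\<close> block are set to \<open>0\<close> so that this determines \<open>R\<close> as a function.
\<close>

definition inv_sqrt :: "nat \<Rightarrow> mtrx \<Rightarrow> mtrx" where
  "inv_sqrt d H = (THE R. pos_def d R
     \<and> (\<forall>i<d. \<forall>j<d. (\<Sum>k<d. \<Sum>l<d. R i k * R k l * H l j) = ident i j)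
     \<and> (\<forall>i j. \<not> (i < d \<and> j < d) \<longrightarrow> R i j = 0))"

definition wnorm :: "nat \<Rightarrow> mtrx \<Rightarrow> (nat \<Rightarrow> real) \<Rightarrow> real" where
  "wnorm d H x = sqrt (quad_form d H x)"

definition multi_idx :: "nat \<Rightarrow> nat \<Rightarrow> nat list set" where
  "multi_idx d k = {is. length is = k \<and> set is \<subseteq> {..<d}}"

definition tinner :: "nat \<Rightarrow> nat \<Rightarrow> tensor \<Rightarrow> tensor \<Rightarrow> real" where
  "tinner d k T S = (\<Sum>is\<in>multi_idx d k. T is * S is)"

definition tpow :: "(nat \<Rightarrow> real) \<Rightarrow> tensor" where
  "tpow u is = prod_list (map u is)"

definition frob_norm :: "nat \<Rightarrow> nat \<Rightarrow> tensor \<Rightarrow> real" where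
  "frob_norm d k T = sqrt (tinner d k T T)"

definition tnorm :: "nat \<Rightarrow> mtrx \<Rightarrow> nat \<Rightarrow> tensor \<Rightarrow> real" where
  "tnorm d H k T = (SUP u\<in>{u \<in> Rd d. wnorm d H u = 1}. \<bar>tinner d k T (tpow u)\<bar>)"

definition contract :: "nat \<Rightarrow> tensor \<Rightarrow> mtrx \<Rightarrow> nat \<Rightarrow> real" where
  "contract d T A = (\<lambda>i\<in>{..<d}. \<Sum>j<d. \<Sum>k<d. T [i, j, k] * A j k)"


section \<open>Derivatives\<close>

definition partial :: "nat \<Rightarrow> ((nat \<Rightarrow> real) \<Rightarrow> real) \<Rightarrow> (nat \<Rightarrow> real) \<Rightarrow> real" where
  "partial i f x = deriv (\<lambda>t. f (x(i := t))) (x i)"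

fun partials :: "nat list \<Rightarrow> ((nat \<Rightarrow> real) \<Rightarrow> real) \<Rightarrow> (nat \<Rightarrow> real) \<Rightarrow> real" where
  "partials [] f = f"
| "partials (i # is) f = partial i (partials is f)"

definition Ck_on :: "nat \<Rightarrow> nat \<Rightarrow> (nat \<Rightarrow> real) set \<Rightarrow> ((nat \<Rightarrow> real) \<Rightarrow> real) \<Rightarrow> bool" where
  "Ck_on d k \<Theta> f \<longleftrightarrow>
     (\<forall>m<k. \<forall>is\<in>multi_idx d m. \<forall>i<d. \<forall>x\<in>\<Theta>.
        (\<lambda>t. partials is f (x(i := t))) differentiable at (x i)) \<and>
     (\<forall>m\<le>k. \<forall>is\<in>multi_idx d m. continuous_on \<Theta> (partials is f))"

text \<open>\<open>\<nabla>\<^sup>k f(x)\<close> is \<open>dtensor f x\<close>, evaluated at index lists of length \<open>k\<close>.\<close>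

definition dtensor :: "((nat \<Rightarrow> real) \<Rightarrow> real) \<Rightarrow> (nat \<Rightarrow> real) \<Rightarrow> tensor" where
  "dtensor f x = (\<lambda>is. partials is f x)"

definition hessian :: "((nat \<Rightarrow> real) \<Rightarrow> real) \<Rightarrow> (nat \<Rightarrow> real) \<Rightarrow> mtrx" where
  "hessian f x = (\<lambda>i j. partials [i, j] f x)"


section \<open>Measures and total variation\<close>

definition gibbs :: "nat \<Rightarrow> (nat \<Rightarrow> real) set \<Rightarrow> ((nat \<Rightarrow> real) \<Rightarrow> real) \<Rightarrow> (nat \<Rightarrow> real) measure" where
  "gibbs d \<Theta> V = density (leb d)
     (\<lambda>x. ennreal (indicator \<Theta> x * exp (- V x) / (\<integral>y. indicator \<Theta> y * exp (- V y) \<partial>leb d)))"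

text \<open>
  The normal distribution \<open>\<N>(m, P\<^sup>-\<^sup>1)\<close>, parametrised by its precision (inverse covariance)
  matrix \<open>P\<close>: the probability measure with density proportional to
  \<open>exp (- (x - m)\<^sup>T P (x - m) / 2)\<close>.
\<close>

definition gaussian :: "nat \<Rightarrow> (nat \<Rightarrow> real) \<Rightarrow> mtrx \<Rightarrow> (nat \<Rightarrow> real) measure" where
  "gaussian d m P = gibbs d (Rd d) (\<lambda>x. quad_form d P (vsub d x m) / 2)"

text \<open>
  Total variation distance of finite signed measures on \<open>\<real>\<^sup>d\<close>, which are given as set functions.
\<close>

definition TV :: "nat \<Rightarrow> ((nat \<Rightarrow> real) set \<Rightarrow> real) \<Rightarrow> ((nat \<Rightarrow> real) set \<Rightarrow> real) \<Rightarrow> real" where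
  "TV d \<mu> \<nu> = (SUP A\<in>sets (leb d). \<bar>\<mu> A - \<nu> A\<bar>)"


section \<open>Assumptions on the potential\<close>

definition assumption_A1 :: "nat \<Rightarrow> (nat \<Rightarrow> real) set \<Rightarrow> ((nat \<Rightarrow> real) \<Rightarrow> real) \<Rightarrow> (nat \<Rightarrow> real) \<Rightarrow> bool"
  where "assumption_A1 d \<Theta> v xh \<longleftrightarrow>
     Ck_on d 4 \<Theta> v \<and> xh \<in> \<Theta> \<and> (\<forall>x\<in>\<Theta>. x \<noteq> xh \<longrightarrow> v xh < v x) \<and> pos_def d (hessian v xh)"

definition loc_region ::
  "nat \<Rightarrow> real \<Rightarrow> ((nat \<Rightarrow> real) \<Rightarrow> real) \<Rightarrow> (nat \<Rightarrow> real) \<Rightarrow> real \<Rightarrow> (nat \<Rightarrow> real) set" where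
  "loc_region d n v xh s = {x \<in> Rd d. wnorm d (hessian v xh) (vsub d x xh) \<le> s * sqrt (real d / n)}"

text \<open>\<open>C\<close> is the absolute constant in the lower bound on \<open>c0\<close>.\<close>

definition assumption_A2 ::
  "real \<Rightarrow> nat \<Rightarrow> real \<Rightarrow> (nat \<Rightarrow> real) set \<Rightarrow> ((nat \<Rightarrow> real) \<Rightarrow> real) \<Rightarrow> (nat \<Rightarrow> real)
    \<Rightarrow> real \<Rightarrow> real \<Rightarrow> bool" where
  "assumption_A2 C d n \<Theta> v xh s0 c0 \<longleftrightarrow>
     s0 > 0 \<and> c0 \<le> 1 \<and> c0 > C / sqrt (real d) \<and>
     (\<forall>x \<in> \<Theta> - loc_region d n v xh s0.
        v x - v xh \<ge> c0 * sqrt (real d / n) * wnorm d (hessian v xh) (vsub d x xh))"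


section \<open>Laplace approximation and skew correction\<close>

definition pot :: "real \<Rightarrow> ((nat \<Rightarrow> real) \<Rightarrow> real) \<Rightarrow> (nat \<Rightarrow> real) \<Rightarrow> real" where
  "pot n v x = n * v x"

definition target :: "nat \<Rightarrow> real \<Rightarrow> (nat \<Rightarrow> real) set \<Rightarrow> ((nat \<Rightarrow> real) \<Rightarrow> real) \<Rightarrow> (nat \<Rightarrow> real) measure"
  where "target d n \<Theta> v = gibbs d \<Theta> (pot n v)"

definition HV :: "real \<Rightarrow> ((nat \<Rightarrow> real) \<Rightarrow> real) \<Rightarrow> (nat \<Rightarrow> real) \<Rightarrow> mtrx" where
  "HV n v xh = hessian (pot n v) xh"

definition laplace :: "nat \<Rightarrow> real \<Rightarrow> ((nat \<Rightarrow> real) \<Rightarrow> real) \<Rightarrow> (nat \<Rightarrow> real) \<Rightarrow> (nat \<Rightarrow> real) measure"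
  where "laplace d n v xh = gaussian d xh (HV n v xh)"

definition skew ::
  "nat \<Rightarrow> real \<Rightarrow> ((nat \<Rightarrow> real) \<Rightarrow> real) \<Rightarrow> (nat \<Rightarrow> real) \<Rightarrow> (nat \<Rightarrow> real) \<Rightarrow> real" where
  "skew d n v xh x = - (1 / 6) * tinner d 3 (dtensor (pot n v) xh) (tpow (vsub d x xh))"

definition laplace_skew ::
  "nat \<Rightarrow> real \<Rightarrow> ((nat \<Rightarrow> real) \<Rightarrow> real) \<Rightarrow> (nat \<Rightarrow> real) \<Rightarrow> (nat \<Rightarrow> real) set \<Rightarrow> real" where
  "laplace_skew d n v xh A = (LINT x:A|laplace d n v xh. 1 + skew d n v xh x)"

definition LTV :: "nat \<Rightarrow> real \<Rightarrow> ((nat \<Rightarrow> real) \<Rightarrow> real) \<Rightarrow> (nat \<Rightarrow> real) \<Rightarrow> real" where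
  "LTV d n v xh = 1 / 2 * (\<integral>x. \<bar>skew d n v xh x\<bar> \<partial>laplace d n v xh)"

definition RTV ::
  "nat \<Rightarrow> real \<Rightarrow> (nat \<Rightarrow> real) set \<Rightarrow> ((nat \<Rightarrow> real) \<Rightarrow> real) \<Rightarrow> (nat \<Rightarrow> real) \<Rightarrow> real" where
  "RTV d n \<Theta> v xh =
     TV d (measure (target d n \<Theta> v)) (measure (laplace d n v xh)) - LTV d n v xh"


section \<open>Small quantities\<close>

definition whitened ::
  "nat \<Rightarrow> real \<Rightarrow> ((nat \<Rightarrow> real) \<Rightarrow> real) \<Rightarrow> (nat \<Rightarrow> real) \<Rightarrow> (nat \<Rightarrow> real) \<Rightarrow> real" where
  "whitened d n v xh x = pot n v (vadd d xh (matvec d (inv_sqrt d (HV n v xh)) x))"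

definition eps3_bar :: "nat \<Rightarrow> real \<Rightarrow> ((nat \<Rightarrow> real) \<Rightarrow> real) \<Rightarrow> (nat \<Rightarrow> real) \<Rightarrow> real" where
  "eps3_bar d n v xh =
     (let T = dtensor (whitened d n v xh) (vzero d)
      in sqrt (1 / 6 * (frob_norm d 3 T)\<^sup>2 + 1 / 4 * (\<Sum>i<d. (contract d T ident i)\<^sup>2)))"

definition eps3 :: "nat \<Rightarrow> real \<Rightarrow> ((nat \<Rightarrow> real) \<Rightarrow> real) \<Rightarrow> (nat \<Rightarrow> real) \<Rightarrow> real" where
  "eps3 d n v xh = real d * tnorm d (HV n v xh) 3 (dtensor (pot n v) xh)"

definition eps4 :: "nat \<Rightarrow> real \<Rightarrow> ((nat \<Rightarrow> real) \<Rightarrow> real) \<Rightarrow> (nat \<Rightarrow> real) \<Rightarrow> real \<Rightarrow> real" where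
  "eps4 d n v xh s =
     real d * (SUP x\<in>loc_region d n v xh s. sqrt (tnorm d (HV n v xh) 4 (dtensor (pot n v) x)))"

definition E_fac :: "nat \<Rightarrow> real \<Rightarrow> ((nat \<Rightarrow> real) \<Rightarrow> real) \<Rightarrow> (nat \<Rightarrow> real) \<Rightarrow> real \<Rightarrow> real" where
  "E_fac d n v xh s = exp (((eps3 d n v xh)\<^sup>2 + (eps4 d n v xh s)\<^sup>2) * s ^ 4)"

definition tau :: "nat \<Rightarrow> real \<Rightarrow> real \<Rightarrow> real" where
  "tau d c0 s = real d * exp (- (c0 * s * real d / 8))"

definition s_star :: "real \<Rightarrow> real \<Rightarrow> real" where
  "s_star s0 c0 = max s0 (8 / c0 * ln (2 * exp 1 / c0))"

end

theory Submission
  imports Defs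
begin

text \<open>
  Whitening \<open>x = xh + H\<^sub>V\<^sup>-\<^sup>1\<^sup>/\<^sup>2 z\<close> turns the Laplace approximation into the standard Gaussian \<open>\<gamma>\<close> and the target
  into the measure with density proportional to \<open>q\<close> with respect to it, where \<open>q = exp (S - r)\<close> on the ball \<open>\<bar>z\<bar> \<le> s \<surd>d\<close> and
  \<open>\<bar>r\<bar> \<le> \<epsilon>\<^sub>4\<^sup>2 \<bar>z\<bar>\<^sup>4 / (24 d\<^sup>2)\<close>. Because \<open>1 + S\<close> integrates to \<open>1\<close>, the total variation distance is at most
  \<open>2 \<integral>\<bar>q - 1 - S\<bar>\<close>. Outside the ball all contributions are exponentially small. Inside, the integrand is
  at most \<open>S\<^sup>2 exp \<bar>S\<bar> / 2 + \<bar>r\<bar> exp (S + \<bar>r\<bar>)\<close>, so a dimension-free bound for exponential moments of \<open>S\<close>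
  on the ball is needed. It comes from Maurey's property \<open>(\<tau>)\<close>: if \<open>u x * v y \<le> exp (\<bar>x - y\<bar>\<^sup>2 / 4)\<close> for all
  \<open>x, y\<close>, then \<open>\<integral>u \<partial>\<gamma> * \<integral>v \<partial>\<gamma> \<le> 1\<close>. With \<open>u = exp (f - L\<^sup>2)\<close> and \<open>v = exp (-f)\<close> on the ball, for \<open>f\<close> odd and
  \<open>L\<close>-Lipschitz there, this gives \<open>\<integral>exp f \<le> exp (L\<^sup>2 / 2)\<close>; the cubic form \<open>S\<close> is Lipschitz on the ball with
  constant of order \<open>\<epsilon>\<^sub>3 s\<^sup>2\<close>. The same inequality on the ball of radius \<open>2 \<surd>d\<close> bounds \<open>\<integral>S\<^sup>4\<close> by a multiple of
  \<open>\<epsilon>\<^sub>3\<^sup>4\<close>. The bound on \<open>L\<^sub>T\<^sub>V\<close> is \<open>\<integral>\<bar>S\<bar> \<le> (\<integral>S\<^sup>2)\<^sup>1\<^sup>/\<^sup>2\<close>, with \<open>\<integral>S\<^sup>2\<close> computed by Wick's formula.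
\<close>

section \<open>A transport inequality for the Gaussian measure\<close>

text \<open>The obstacle is the dimension. On the typical sphere \<open>nrm d z = sqrt d\<close> the
  operator norm bounds |S| only by a multiple of eps3 * sqrt d, whereas its standard deviation is of
  order eps3, so pointwise bounds inside the exponential lose powers of d. The Lipschitz constant of
  S on a ball of radius rho is of order eps3 * rho^2 / d, free of d when rho is a multiple of sqrt
  d; hence concentration takes the place of pointwise bounds. As S is Lipschitz only locally,
  concentration is used in a form with two functions: both may vanish off a ball, and the inequality
  passes to products coordinate by coordinate.

  The logarithm in \<open>s_star\<close> comes from the region outside the ball. There the target
  has Lebesgue density at most exp (- c0 * sqrt d * |z|) up to normalisation, and integrating part
  of this exponential costs a factor of order (4 / c0)^d, which exp (c0 * s * d / 8) has to
  dominate.\<close>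

abbreviation gauss1 :: "real measure" where
  "gauss1 \<equiv> density lborel std_normal_density"

definition stdg :: "nat \<Rightarrow> (nat \<Rightarrow> real) measure" where
  "stdg d = PiM {..<d} (\<lambda>_. gauss1)"

section \<open>One-dimensional Prekopa-Leindler inequality for a Gaussian majorant\<close>

lemma two_sets_between:
  fixes A B :: "real set" and m :: real
  assumes A: "A \<in> sets borel" "a \<in> A" and B: "B \<in> sets borel" "b \<in> B"
    and m: "\<And>x y. x \<in> A \<Longrightarrow> y \<in> B \<Longrightarrow> \<bar>x + y\<bar> \<le> m"
  shows "emeasure lborel A + emeasure lborel B \<le> ennreal (2 * m)"
proof -
  have bdA: "bdd_above A" "bdd_below A"
    using m[OF _ B(2)] by (auto intro!: bdd_aboveI[of _ "m - b"] bdd_belowI[of _ "-m - b"] simp: abs_le_iff; smt (verit))+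
  have bdB: "bdd_above B" "bdd_below B"
    using m[OF A(2)] by (auto intro!: bdd_aboveI[of _ "m - a"] bdd_belowI[of _ "-m - a"] simp: abs_le_iff; smt (verit))+
  \<comment> \<open>Only end points matter: \<open>Sup A + Sup B\<close> is at most \<open>m\<close>
    and \<open>Inf A + Inf B\<close> at least \<open>-m\<close>, so the two enclosing intervals have
    total length at most \<open>2 * m\<close>.\<close>
  have "A \<subseteq> {Inf A..Sup A}" using bdA by (auto intro: cInf_lower cSup_upper)
  hence 1: "emeasure lborel A \<le> ennreal (Sup A - Inf A)"
    using emeasure_mono[of A "{Inf A..Sup A}" lborel] A cInf_lower[OF A(2) bdA(2)] cSup_upper[OF A(2) bdA(1)]
    by simp
  have "B \<subseteq> {Inf B..Sup B}" using bdB by (auto intro: cInf_lower cSup_upper)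
  hence 2: "emeasure lborel B \<le> ennreal (Sup B - Inf B)"
    using emeasure_mono[of B "{Inf B..Sup B}" lborel] B cInf_lower[OF B(2) bdB(2)] cSup_upper[OF B(2) bdB(1)]
    by simp
  have "x + Sup B \<le> m" if "x \<in> A" for x
  proof -
    have "Sup B \<le> m - x" by (rule cSup_least) (use B m[OF that] in \<open>auto, smt (verit)\<close>)
    thus ?thesis by simp
  qed
  hence "Sup A \<le> m - Sup B" by (intro cSup_least) (use A in \<open>auto, smt (verit)\<close>)
  moreover have "x + Inf B \<ge> - m" if "x \<in> A" for x
  proof -
    have "Inf B \<ge> - m - x" by (rule cInf_greatest) (use B m[OF that] in \<open>auto, smt (verit)\<close>)
    thus ?thesis by simp
  qed
  hence "Inf A \<ge> - m - Inf B" by (intro cInf_greatest) (use A in \<open>auto, smt (verit)\<close>)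
  ultimately have "Sup A - Inf A + (Sup B - Inf B) \<le> 2 * m" by simp
  moreover have "Inf A \<le> Sup A" "Inf B \<le> Sup B"
    using cInf_lower[OF A(2) bdA(2)] cSup_upper[OF A(2) bdA(1)] cInf_lower[OF B(2) bdB(2)] cSup_upper[OF B(2) bdB(1)] by auto
  ultimately show ?thesis using add_mono[OF 1 2]
    by (smt (verit) ennreal_leI ennreal_plus order_trans)
qed

text \<open>Levels stop at 1 because \<open>F\<close> does. For two functions with supremum 1 the
  superlevel sets at these levels are both nonempty, without which their lengths could not be
  added.\<close>

lemma nn_integral_layer_cake:
  fixes F :: "real \<Rightarrow> real"
  assumes [measurable]: "F \<in> borel_measurable borel" and F: "\<And>x. 0 \<le> F x" "\<And>x. F x \<le> 1"
  shows "(\<integral>\<^sup>+x. ennreal (F x) \<partial>lborel) =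
    (\<integral>\<^sup>+t. indicator {0<..<1} t * emeasure lborel {x. t < F x} \<partial>lborel)"
proof -
  have "ennreal (F x) = (\<integral>\<^sup>+t. indicator {t. 0 < t \<and> t < 1 \<and> t < F x} t \<partial>lborel)" for x
  proof -
    have "{t. 0 < t \<and> t < 1 \<and> t < F x} = {0<..<F x}" using F[of x] by auto
    thus ?thesis using F[of x] by simp
  qed
  hence "(\<integral>\<^sup>+x. ennreal (F x) \<partial>lborel) =
     (\<integral>\<^sup>+x. \<integral>\<^sup>+t. indicator {t. 0 < t \<and> t < 1 \<and> t < F x} t \<partial>lborel \<partial>lborel)" by simp
  also have "\<dots> = (\<integral>\<^sup>+t. \<integral>\<^sup>+x. indicator {t. 0 < t \<and> t < 1 \<and> t < F x} t \<partial>lborel \<partial>lborel)"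
    by (rule lborel_pair.Fubini') measurable
  also have "\<dots> = (\<integral>\<^sup>+t. indicator {0<..<1} t * emeasure lborel {x. t < F x} \<partial>lborel)"
  proof (rule nn_integral_cong)
    fix t :: real
    have "(\<integral>\<^sup>+x. indicator {t. 0 < t \<and> t < 1 \<and> t < F x} t \<partial>lborel) =
      (\<integral>\<^sup>+x. indicator {0<..<1} t * indicator {x. t < F x} x \<partial>lborel)"
      by (intro nn_integral_cong) (auto simp: indicator_def)
    also have "\<dots> = indicator {0<..<1} t * emeasure lborel {x. t < F x}"
      by (subst nn_integral_cmult) auto
    finally show "(\<integral>\<^sup>+x. indicator {t. 0 < t \<and> t < 1 \<and> t < F x} t \<partial>lborel) =
      indicator {0<..<1} t * emeasure lborel {x. t < F x}" .
  qed
  finally show ?thesis .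
qed

lemma nn_integral_gaussian_sqrt:
  fixes k :: real assumes "k > 0"
  shows "(\<integral>\<^sup>+w. ennreal (sqrt k * exp (- w\<^sup>2 / 8)) \<partial>lborel) = ennreal (sqrt (8 * pi * k))"
proof -
  have "sqrt k * exp (- w\<^sup>2 / 8) = sqrt (8 * pi * k) * normal_density 0 2 w" for w
    using \<open>k > 0\<close> by (simp add: normal_density_def real_sqrt_mult field_simps)
  moreover have "(\<integral>\<^sup>+w. ennreal (normal_density 0 2 w) \<partial>lborel) = 1"
    using prob_space.emeasure_space_1[OF prob_space_normal_density[of 2 0]]
    by (simp add: emeasure_density)
  ultimately show ?thesis using \<open>k > 0\<close>
    by (simp add: ennreal_mult nn_integral_cmult)
qed

text \<open>The Prekopa-Leindler inequality for a Gaussian right-hand side, after rescaling both functions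
  to have supremum 1. The superlevel sets of the Gaussian are intervals, so only the trivial case of
  the Brunn-Minkowski inequality is needed.\<close>

lemma prekopa_leindler_normalised:
  fixes F G :: "real \<Rightarrow> real" and k :: real
  assumes [measurable]: "F \<in> borel_measurable borel" "G \<in> borel_measurable borel"
    and F: "\<And>x. 0 \<le> F x" "\<And>x. F x \<le> 1" "\<And>t. t < 1 \<Longrightarrow> \<exists>x. t < F x"
    and G: "\<And>x. 0 \<le> G x" "\<And>x. G x \<le> 1" "\<And>t. t < 1 \<Longrightarrow> \<exists>x. t < G x"
    and le: "\<And>x y. F x * G y \<le> k * exp (- (x + y)\<^sup>2 / 4)" and "k > 0"
  shows "(\<integral>\<^sup>+x. ennreal (F x) \<partial>lborel) + (\<integral>\<^sup>+x. ennreal (G x) \<partial>lborel) \<le> ennreal (sqrt (8 * pi * k))"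
proof -
  \<comment> \<open>If both \<open>F x\<close> and \<open>G y\<close> exceed \<open>t\<close>, the
    majorant at \<open>x + y\<close> exceeds \<open>t^2\<close>; hence the superlevel sets of its
    square root.\<close>
  define W where "W t = {w::real. t < sqrt k * exp (- w\<^sup>2 / 8)}" for t
  have W_meas[measurable]: "W t \<in> sets borel" for t unfolding W_def by measurable
  have sq: "(sqrt k * exp (- w\<^sup>2 / 8))\<^sup>2 = k * exp (- w\<^sup>2 / 4)" for w
    using \<open>k > 0\<close> by (simp add: power_mult_distrib flip: exp_double)
  \<comment> \<open>This makes the logarithm in \<open>m\<close> nonnegative, so that
    \<open>W t\<close> is an interval of half-length \<open>m\<close>.\<close>
  have k1: "k \<ge> t\<^sup>2" if t: "0 < t" "t < 1" for t
  proof -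
    obtain x y where "t < F x" "t < G y" using F(3)[OF t(2)] G(3)[OF t(2)] by blast
    hence "t * t \<le> F x * G y" using t by (intro mult_mono) auto
    also have "\<dots> \<le> k * exp (- (x + y)\<^sup>2 / 4)" by (rule le)
    also have "\<dots> \<le> k * 1" using \<open>k > 0\<close> by (intro mult_left_mono) auto
    finally show ?thesis by (simp add: power2_eq_square)
  qed
  have key: "emeasure lborel {x. t < F x} + emeasure lborel {x. t < G x} \<le> emeasure lborel (W t)"
    if t: "0 < t" "t < 1" for t
  proof -
    define m where "m = sqrt (8 * ln (sqrt k / t))"
    have "t \<le> sqrt k" using real_sqrt_le_mono[OF k1[OF t]] t by simp
    hence ln0: "ln (sqrt k / t) \<ge> 0" using t by simp
    have iff: "t < sqrt k * exp (- w\<^sup>2 / 8) \<longleftrightarrow> \<bar>w\<bar> < m" for w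
    proof -
      have "t < sqrt k * exp (- w\<^sup>2 / 8) \<longleftrightarrow> exp (w\<^sup>2 / 8) < sqrt k / t"
        using t by (simp add: exp_minus field_simps)
      also have "\<dots> \<longleftrightarrow> w\<^sup>2 / 8 < ln (sqrt k / t)"
        using t \<open>k > 0\<close> by (metis divide_pos_pos exp_less_cancel_iff exp_ln real_sqrt_gt_0_iff)
      also have "\<dots> \<longleftrightarrow> w\<^sup>2 < m\<^sup>2" using ln0 by (auto simp: m_def)
      also have "\<dots> \<longleftrightarrow> \<bar>w\<bar> < \<bar>m\<bar>" by (metis abs_le_square_iff not_le)
      also have "\<bar>m\<bar> = m" using ln0 by (simp add: m_def)
      finally show ?thesis .
    qed
    have Wt: "W t = {-m<..<m}" unfolding W_def iff by auto
    obtain x0 y0 where xy: "t < F x0" "t < G y0" using F(3)[OF t(2)] G(3)[OF t(2)] by blast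
    have "emeasure lborel {x. t < F x} + emeasure lborel {x. t < G x} \<le> ennreal (2 * m)"
    proof (rule two_sets_between[where a=x0 and b=y0])
      fix x y assume "x \<in> {x. t < F x}" "y \<in> {x. t < G x}"
      hence "t * t < F x * G y" using t by (intro mult_strict_mono) auto
      also have "\<dots> \<le> (sqrt k * exp (- (x + y)\<^sup>2 / 8))\<^sup>2" using le[of x y] by (simp only: sq)
      finally have "t\<^sup>2 < (sqrt k * exp (- (x + y)\<^sup>2 / 8))\<^sup>2" by (simp add: power2_eq_square)
      hence "t < sqrt k * exp (- (x + y)\<^sup>2 / 8)" using t \<open>k > 0\<close>
        by (meson exp_ge_zero less_imp_le mult_nonneg_nonneg power_less_imp_less_base real_sqrt_ge_zero)
      thus "\<bar>x + y\<bar> \<le> m" unfolding iff by simp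
    qed (use xy in auto)
    also have "\<dots> = emeasure lborel (W t)" unfolding Wt using ln0 by (simp add: m_def)
    finally show ?thesis .
  qed
  have "(\<integral>\<^sup>+x. ennreal (F x) \<partial>lborel) + (\<integral>\<^sup>+x. ennreal (G x) \<partial>lborel) =
    (\<integral>\<^sup>+t. indicator {0<..<1} t * emeasure lborel {x. t < F x}
         + indicator {0<..<1} t * emeasure lborel {x. t < G x} \<partial>lborel)"
    using F G by (simp add: nn_integral_layer_cake nn_integral_add)
  also have "\<dots> \<le> (\<integral>\<^sup>+t. \<integral>\<^sup>+w. indicator {t. 0 < t \<and> t < sqrt k * exp (- w\<^sup>2 / 8)} t \<partial>lborel \<partial>lborel)"
  proof (rule nn_integral_mono)
    fix t :: real
    show "indicator {0<..<1} t * emeasure lborel {x. t < F x} + indicator {0<..<1} t * emeasure lborel {x. t < G x}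
       \<le> (\<integral>\<^sup>+w. indicator {t. 0 < t \<and> t < sqrt k * exp (- w\<^sup>2 / 8)} t \<partial>lborel)"
    proof (cases "0 < t \<and> t < 1")
      case True
      have "(\<integral>\<^sup>+w. indicator {t. 0 < t \<and> t < sqrt k * exp (- w\<^sup>2 / 8)} t \<partial>lborel) = (\<integral>\<^sup>+w. indicator (W t) w \<partial>lborel)"
        using True by (intro nn_integral_cong) (auto simp: W_def indicator_def)
      thus ?thesis using key True by simp
    qed auto
  qed
  also have "\<dots> = (\<integral>\<^sup>+w. \<integral>\<^sup>+t. indicator {t. 0 < t \<and> t < sqrt k * exp (- w\<^sup>2 / 8)} t \<partial>lborel \<partial>lborel)"
    by (rule lborel_pair.Fubini') measurable
  also have "\<dots> = (\<integral>\<^sup>+w. ennreal (sqrt k * exp (- w\<^sup>2 / 8)) \<partial>lborel)"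
  proof (rule nn_integral_cong)
    fix w :: real
    have "{t. 0 < t \<and> t < sqrt k * exp (- w\<^sup>2 / 8)} = {0<..<sqrt k * exp (- w\<^sup>2 / 8)}" by auto
    thus "(\<integral>\<^sup>+t. indicator {t. 0 < t \<and> t < sqrt k * exp (- w\<^sup>2 / 8)} t \<partial>lborel) = ennreal (sqrt k * exp (- w\<^sup>2 / 8))"
      using \<open>k > 0\<close> by simp
  qed
  also have "\<dots> = ennreal (sqrt (8 * pi * k))" by (rule nn_integral_gaussian_sqrt) fact
  finally show ?thesis .
qed

text \<open>AM-GM, which turns the additive bound for normalised functions into the multiplicative
  one.\<close>

lemma ennreal_mult_le_of_add_le:
  assumes "a + b \<le> ennreal c" "c \<ge> 0" shows "a * b \<le> ennreal (c\<^sup>2 / 4)"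
proof -
  have "a \<noteq> \<infinity>" "b \<noteq> \<infinity>" using assms(1) by (auto simp: top_unique)
  then obtain x y where xy: "a = ennreal x" "b = ennreal y" "x \<ge> 0" "y \<ge> 0"
    by (metis ennreal_cases infinity_ennreal_def)
  hence "x + y \<le> c" using assms by (simp flip: ennreal_plus)
  hence "(x + y)\<^sup>2 \<le> c\<^sup>2" using xy by (intro power_mono) auto
  moreover have "(x+y)\<^sup>2 - 4 * (x * y) = (x-y)\<^sup>2" by (simp add: power2_eq_square algebra_simps)
  ultimately have "x * y \<le> c\<^sup>2 / 4" using zero_le_power2[of "x-y"] by linarith
  thus ?thesis using xy by (simp flip: ennreal_mult add: ennreal_leI)
qed

text \<open>Dividing by the suprema \<open>a\<close> and \<open>b\<close> gives the normalised case
  with \<open>k = 1 / (2 * pi * a * b)\<close>. AM-GM bounds the product of the normalised integrals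
  by \<open>2 * pi * k = 1 / (a * b)\<close>, and scaling back gives 1.\<close>

lemma prekopa_leindler_gaussian:
  fixes f g :: "real \<Rightarrow> real"
  assumes [measurable]: "f \<in> borel_measurable borel" "g \<in> borel_measurable borel"
    and f: "\<And>x. 0 \<le> f x" and g: "\<And>x. 0 \<le> g x"
    and le: "\<And>x y. f x * g y \<le> exp (- (x + y)\<^sup>2 / 4) / (2 * pi)"
  shows "(\<integral>\<^sup>+x. ennreal (f x) \<partial>lborel) * (\<integral>\<^sup>+x. ennreal (g x) \<partial>lborel) \<le> 1"
proof (cases "(\<forall>x. f x = 0) \<or> (\<forall>x. g x = 0)")
  case True
  thus ?thesis by auto
next
  case False
  then obtain x0 y0 where "f x0 \<noteq> 0" "g y0 \<noteq> 0" by blast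
  hence xy0: "f x0 > 0" "g y0 > 0" using f[of x0] g[of y0] by auto
  have le1: "f x * g y \<le> 1 / (2 * pi)" for x y
  proof -
    have "exp (- (x + y)\<^sup>2 / 4) / (2 * pi) \<le> 1 / (2 * pi)" by (intro divide_right_mono) auto
    thus ?thesis using le[of x y] by linarith
  qed
  \<comment> \<open>A positive value of one function bounds the other through
    \<open>le1\<close>.\<close>
  have bf: "bdd_above (range f)" using le1[of _ y0] xy0
    by (intro bdd_aboveI[of _ "1 / (2 * pi) / g y0"]) (auto simp: field_simps)
  have bg: "bdd_above (range g)" using le1[of x0] xy0
    by (intro bdd_aboveI[of _ "1 / (2 * pi) / f x0"]) (auto simp: field_simps)
  define a where "a = Sup (range f)"
  define b where "b = Sup (range g)"
  have fa: "f x \<le> a" for x unfolding a_def using bf by (auto intro: cSup_upper)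
  have gb: "g x \<le> b" for x unfolding b_def using bg by (auto intro: cSup_upper)
  have ab: "a > 0" "b > 0" using fa[of x0] gb[of y0] xy0 by auto
  define F where "F x = f x / a" for x
  define G where "G x = g x / b" for x
  define k where "k = 1 / (2 * pi * a * b)"
  have [measurable]: "F \<in> borel_measurable borel" "G \<in> borel_measurable borel"
    unfolding F_def G_def by measurable
  have k: "k > 0" using ab by (simp add: k_def)
  have "(\<integral>\<^sup>+x. ennreal (F x) \<partial>lborel) + (\<integral>\<^sup>+x. ennreal (G x) \<partial>lborel) \<le> ennreal (sqrt (8 * pi * k))"
  proof (rule prekopa_leindler_normalised)
    show "\<exists>x. t < F x" if "t < 1" for t
    proof -
      have "t * a < a" using that ab by simp
      then obtain x where "t * a < f x" unfolding a_def using less_cSup_iff[of "range f"] bf by auto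
      thus ?thesis using ab by (auto simp: F_def field_simps)
    qed
    show "\<exists>x. t < G x" if "t < 1" for t
    proof -
      have "t * b < b" using that ab by simp
      then obtain x where "t * b < g x" unfolding b_def using less_cSup_iff[of "range g"] bg by auto
      thus ?thesis using ab by (auto simp: G_def field_simps)
    qed
    show "F x * G y \<le> k * exp (- (x + y)\<^sup>2 / 4)" for x y
      using divide_right_mono[OF le[of x y], of "a * b"] ab by (simp add: F_def G_def k_def field_simps)
  qed (use ab f g fa gb k in \<open>auto simp: F_def G_def\<close>)
  from ennreal_mult_le_of_add_le[OF this]
  have "(\<integral>\<^sup>+x. ennreal (F x) \<partial>lborel) * (\<integral>\<^sup>+x. ennreal (G x) \<partial>lborel) \<le> ennreal (1 / (a * b))"
    using k ab by (simp add: k_def field_simps)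
  moreover have "(\<integral>\<^sup>+x. ennreal (f x) \<partial>lborel) = ennreal a * (\<integral>\<^sup>+x. ennreal (F x) \<partial>lborel)"
    using ab f by (subst nn_integral_cmult[symmetric]) (auto simp: F_def simp flip: ennreal_mult)
  moreover have "(\<integral>\<^sup>+x. ennreal (g x) \<partial>lborel) = ennreal b * (\<integral>\<^sup>+x. ennreal (G x) \<partial>lborel)"
    using ab g by (subst nn_integral_cmult[symmetric]) (auto simp: G_def simp flip: ennreal_mult)
  ultimately have "(\<integral>\<^sup>+x. ennreal (f x) \<partial>lborel) * (\<integral>\<^sup>+x. ennreal (g x) \<partial>lborel) \<le> ennreal (a * b) * ennreal (1 / (a * b))"
    using ab by (simp add: ennreal_mult mult_left_mono mult.assoc mult.left_commute)
  also have "\<dots> = 1" using ab by (simp flip: ennreal_mult)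
  finally show ?thesis .
qed

text \<open>The Gaussian densities absorb the cost: (x - y)^2 / 4 - (x^2 + y^2) / 2 = - (x + y)^2 /
  4. This reduces the claim to Lebesgue measure.\<close>

lemma gauss1_transport:
  fixes u v :: "real \<Rightarrow> ennreal"
  assumes [measurable]: "u \<in> borel_measurable borel" "v \<in> borel_measurable borel"
    and le: "\<And>x y. u x * v y \<le> ennreal (exp ((x - y)\<^sup>2 / 4))"
  shows "(\<integral>\<^sup>+x. u x \<partial>gauss1) * (\<integral>\<^sup>+x. v x \<partial>gauss1) \<le> 1"
proof (cases "(\<forall>x. u x = 0) \<or> (\<forall>y. v y = 0)")
  case True
  thus ?thesis by auto
next
  case False
  then obtain x0 y0 where xy: "u x0 \<noteq> 0" "v y0 \<noteq> 0" by blast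
  \<comment> \<open>One nonzero value of \<open>v\<close> forces \<open>u\<close> to be finite
    everywhere, and conversely, so both can be treated as real functions.\<close>
  have ufin: "u x \<noteq> \<infinity>" for x
    using le[of x y0] xy by (auto simp: ennreal_top_mult top_unique)
  have vfin: "v x \<noteq> \<infinity>" for x
    using le[of x0 x] xy by (auto simp: ennreal_mult_top top_unique)
  define f where "f x = enn2real (u x) * std_normal_density x" for x
  define g where "g x = enn2real (v x) * std_normal_density x" for x
  have [measurable]: "f \<in> borel_measurable borel" "g \<in> borel_measurable borel"
    unfolding f_def g_def by measurable
  have uf: "(\<integral>\<^sup>+x. u x \<partial>gauss1) = (\<integral>\<^sup>+x. ennreal (f x) \<partial>lborel)"
    unfolding f_def using ufin
    by (subst nn_integral_density) (auto intro!: nn_integral_cong simp: ennreal_mult mult.commute less_top)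
  have vg: "(\<integral>\<^sup>+x. v x \<partial>gauss1) = (\<integral>\<^sup>+x. ennreal (g x) \<partial>lborel)"
    unfolding g_def using vfin
    by (subst nn_integral_density) (auto intro!: nn_integral_cong simp: ennreal_mult mult.commute less_top)
  show ?thesis unfolding uf vg
  proof (rule prekopa_leindler_gaussian)
    fix x y
    have "enn2real (u x) * enn2real (v y) \<le> exp ((x - y)\<^sup>2 / 4)"
      using enn2real_mono[OF le[of x y]] by (simp add: enn2real_mult)
    hence "f x * g y \<le> exp ((x - y)\<^sup>2 / 4) * (std_normal_density x * std_normal_density y)"
      unfolding f_def g_def
      using mult_right_mono[of "enn2real (u x) * enn2real (v y)" "exp ((x - y)\<^sup>2 / 4)" "std_normal_density x * std_normal_density y"]
      by (simp add: mult_ac)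
    also have "std_normal_density x * std_normal_density y = (exp (- x\<^sup>2 / 2) * exp (- y\<^sup>2 / 2)) / (sqrt (2 * pi) * sqrt (2 * pi))"
      by (simp add: std_normal_density_def)
    also have "sqrt (2 * pi) * sqrt (2 * pi) = 2 * pi" by simp
    also have "exp (- x\<^sup>2 / 2) * exp (- y\<^sup>2 / 2) = exp (- (x\<^sup>2 + y\<^sup>2) / 2)"
      by (simp only: exp_add[symmetric]) (simp add: add_divide_distrib diff_divide_distrib)
    also have "exp ((x - y)\<^sup>2 / 4) * (exp (- (x\<^sup>2 + y\<^sup>2) / 2) / (2 * pi)) = exp ((x - y)\<^sup>2 / 4 + - (x\<^sup>2 + y\<^sup>2) / 2) / (2 * pi)"
      by (simp only: exp_add times_divide_eq_right)
    also have "(x - y)\<^sup>2 / 4 + - (x\<^sup>2 + y\<^sup>2) / 2 = - (x + y)\<^sup>2 / 4"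
      by (simp add: power2_eq_square field_simps)
    finally show "f x * g y \<le> exp (- (x + y)\<^sup>2 / 4) / (2 * pi)" .
  qed (auto simp: f_def g_def)
qed

section \<open>Tensorisation of the transport inequality\<close>

lemma prob_space_gauss1: "prob_space gauss1"
  using prob_space_normal_density[of 1 0] by simp

interpretation gauss1: product_sigma_finite "\<lambda>_::nat. gauss1"
  by (intro product_sigma_finite.intro prob_space_imp_sigma_finite prob_space_gauss1)

lemma space_stdg: "space (stdg d) = Rd d" by (simp add: stdg_def space_PiM Rd_def)
lemma sets_stdg: "sets (stdg d) = sets (leb d)"
  unfolding stdg_def leb_def by (intro sets_PiM_cong) auto

text \<open>The cost is a sum over coordinates. With the new coordinates frozen at \<open>a\<close>
  and \<open>b\<close>, the induction hypothesis bounds \<open>U a * W b\<close> by the cost of the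
  pair \<open>a, b\<close>, which is the hypothesis of the one-dimensional inequality for
  \<open>U\<close> and \<open>W\<close>.\<close>

theorem PiM_gauss1_transport:
  fixes u v :: "(nat \<Rightarrow> real) \<Rightarrow> ennreal"
  assumes "finite I" "u \<in> borel_measurable (PiM I (\<lambda>_. gauss1))" "v \<in> borel_measurable (PiM I (\<lambda>_. gauss1))"
    and "\<And>x y. x \<in> I \<rightarrow>\<^sub>E UNIV \<Longrightarrow> y \<in> I \<rightarrow>\<^sub>E UNIV \<Longrightarrow> u x * v y \<le> ennreal (exp ((\<Sum>i\<in>I. (x i - y i)\<^sup>2) / 4))"
  shows "(\<integral>\<^sup>+x. u x \<partial>PiM I (\<lambda>_. gauss1)) * (\<integral>\<^sup>+x. v x \<partial>PiM I (\<lambda>_. gauss1)) \<le> 1"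
  using assms
proof (induction I arbitrary: u v rule: finite_induct)
  case empty
  show ?case using empty(3)[of "\<lambda>_. undefined" "\<lambda>_. undefined"]
    by (simp add: PiM_empty nn_integral_count_space_finite)
next
  case (insert i I)
  note [measurable] = insert.prems(1,2)
  have [simp]: "space (PiM I (\<lambda>_. gauss1)) = I \<rightarrow>\<^sub>E UNIV" by (simp add: space_PiM)
  define U where "U a = (\<integral>\<^sup>+x. u (x(i := a)) \<partial>PiM I (\<lambda>_. gauss1))" for a
  define W where "W a = (\<integral>\<^sup>+x. v (x(i := a)) \<partial>PiM I (\<lambda>_. gauss1))" for a
  have upd: "(\<lambda>(a, x). x(i := a)) \<in> measurable (gauss1 \<Otimes>\<^sub>M PiM I (\<lambda>_. gauss1)) (PiM (insert i I) (\<lambda>_. gauss1))"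
    by measurable
  interpret PI: sigma_finite_measure "PiM I (\<lambda>_. gauss1)" by (rule gauss1.sigma_finite) fact
  have [measurable]: "U \<in> borel_measurable borel"
    unfolding U_def using PI.borel_measurable_nn_integral_fst[OF measurable_compose[OF upd insert.prems(1)]]
    by (simp add: split_beta)
  have [measurable]: "W \<in> borel_measurable borel"
    unfolding W_def using PI.borel_measurable_nn_integral_fst[OF measurable_compose[OF upd insert.prems(2)]]
    by (simp add: split_beta)
  have UW: "U a * W b \<le> ennreal (exp ((a - b)\<^sup>2 / 4))" for a b
  proof -
    define e where "e = ennreal (exp (- ((a - b)\<^sup>2 / 4)))"
    have e: "e * ennreal (exp ((a - b)\<^sup>2 / 4)) = 1" by (simp add: e_def flip: ennreal_mult exp_add)
    have mu: "(\<lambda>x. u (x(i := a))) \<in> borel_measurable (PiM I (\<lambda>_. gauss1))"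
      using measurable_compose[OF measurable_Pair1'[of a] measurable_compose[OF upd insert.prems(1)]]
      by simp
    have mv: "(\<lambda>x. v (x(i := b))) \<in> borel_measurable (PiM I (\<lambda>_. gauss1))"
      using measurable_compose[OF measurable_Pair1'[of b] measurable_compose[OF upd insert.prems(2)]]
      by simp
    have "(\<integral>\<^sup>+x. e * u (x(i := a)) \<partial>PiM I (\<lambda>_. gauss1)) * (\<integral>\<^sup>+x. v (x(i := b)) \<partial>PiM I (\<lambda>_. gauss1)) \<le> 1"
    proof (rule insert.IH)
      fix x y :: "nat \<Rightarrow> real" assume xy: "x \<in> I \<rightarrow>\<^sub>E UNIV" "y \<in> I \<rightarrow>\<^sub>E UNIV"
      have "u (x(i := a)) * v (y(i := b)) \<le> ennreal (exp ((\<Sum>j\<in>insert i I. ((x(i := a)) j - (y(i := b)) j)\<^sup>2) / 4))"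
        by (rule insert.prems(3)) (use xy in \<open>auto simp: PiE_iff extensional_def\<close>)
      also have "(\<Sum>j\<in>insert i I. ((x(i := a)) j - (y(i := b)) j)\<^sup>2) = (a - b)\<^sup>2 + (\<Sum>j\<in>I. (x j - y j)\<^sup>2)"
        using insert.hyps by (subst sum.insert) (auto intro!: sum.cong arg_cong2[where f="(+)"])
      finally have "u (x(i := a)) * v (y(i := b)) \<le> ennreal (exp ((a - b)\<^sup>2 / 4)) * ennreal (exp ((\<Sum>j\<in>I. (x j - y j)\<^sup>2) / 4))"
        by (simp add: add_divide_distrib exp_add ennreal_mult fun_upd_def)
      from mult_left_mono[OF this, of e] show "e * u (x(i := a)) * v (y(i := b)) \<le> ennreal (exp ((\<Sum>i\<in>I. (x i - y i)\<^sup>2) / 4))"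
        using e by (simp add: mult.assoc[symmetric])
    qed (intro borel_measurable_times_ennreal borel_measurable_const mu mv)+
    hence "e * (U a * W b) \<le> 1" unfolding U_def W_def using mu by (simp add: nn_integral_cmult mult.assoc)
    from mult_left_mono[OF this, of "ennreal (exp ((a - b)\<^sup>2 / 4))"]
    have "(e * ennreal (exp ((a - b)\<^sup>2 / 4))) * (U a * W b) \<le> ennreal (exp ((a - b)\<^sup>2 / 4))"
      by (simp add: mult_ac)
    thus ?thesis unfolding e by simp
  qed
  have "(\<integral>\<^sup>+x. u x \<partial>PiM (insert i I) (\<lambda>_. gauss1)) = (\<integral>\<^sup>+a. U a \<partial>gauss1)"
    unfolding U_def by (rule gauss1.product_nn_integral_insert_rev) (use insert in auto)
  moreover have "(\<integral>\<^sup>+x. v x \<partial>PiM (insert i I) (\<lambda>_. gauss1)) = (\<integral>\<^sup>+a. W a \<partial>gauss1)"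
    unfolding W_def by (rule gauss1.product_nn_integral_insert_rev) (use insert in auto)
  ultimately show ?case using gauss1_transport[of U W] UW by simp
qed

section \<open>Symmetric positive definite matrices\<close>

definition ip :: "nat \<Rightarrow> (nat \<Rightarrow> real) \<Rightarrow> (nat \<Rightarrow> real) \<Rightarrow> real" where
  "ip d x y = (\<Sum>i<d. x i * y i)"

lemma ip_commute: "ip d x y = ip d y x"
  by (simp add: ip_def mult.commute)

lemma ip_self_nonneg: "0 \<le> ip d x x"
  by (auto simp: ip_def intro: sum_nonneg)

lemma ip_self_eq_0: "ip d x x = 0 \<longleftrightarrow> (\<forall>i<d. x i = 0)"
  by (simp add: ip_def sum_nonneg_eq_0_iff Ball_def)

lemma ip_add_left: "ip d (\<lambda>i. x i + y i) z = ip d x z + ip d y z"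
  by (simp add: ip_def sum.distrib algebra_simps)

lemma ip_diff_left: "ip d (\<lambda>i. x i - y i) z = ip d x z - ip d y z"
  by (simp add: ip_def sum_subtractf algebra_simps)

lemma ip_scale_left: "ip d (\<lambda>i. c * x i) z = c * ip d x z"
  by (simp add: ip_def sum_distrib_left algebra_simps)

lemma ip_sum_left: "ip d (\<lambda>i. \<Sum>m\<in>M. f m i) z = (\<Sum>m\<in>M. ip d (f m) z)"
  unfolding ip_def by (subst sum.swap) (simp add: sum_distrib_right)

lemma ip_cong: "(\<And>i. i < d \<Longrightarrow> x i = x' i) \<Longrightarrow> (\<And>i. i < d \<Longrightarrow> y i = y' i) \<Longrightarrow> ip d x y = ip d x' y'"
  by (simp add: ip_def)

lemma quad_form_ip: "quad_form d H x = ip d x (\<lambda>i. \<Sum>j<d. H i j * x j)"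
  by (simp add: quad_form_def ip_def sum_distrib_left mult.assoc)

text \<open>Tychonoff over all indices: the factors are intervals below \<open>d\<close> and the
  single point \<open>undefined\<close> from \<open>d\<close> on.\<close>

lemma compact_subset_Rd:
  assumes "closed S" "S \<subseteq> Rd d" "\<And>x i. x \<in> S \<Longrightarrow> i < d \<Longrightarrow> \<bar>x i\<bar> \<le> M"
  shows "compact S"
proof -
  define F where "F i = (if i < d then {-M..M} else {undefined :: real})" for i
  have "compactin (product_topology (\<lambda>_. euclidean) UNIV) (PiE UNIV F)"
    by (subst compactin_PiE) (auto simp: F_def)
  hence "compact (PiE UNIV F)" by (simp add: euclidean_product_topology)
  moreover have "S \<subseteq> PiE UNIV F"
    using assms(2,3) by (fastforce simp: F_def Rd_def PiE_iff extensional_def abs_le_iff)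
  ultimately show ?thesis using assms(1) by (metis compact_Int_closed inf.absorb_iff2)
qed

lemma closed_Rd: "closed (Rd d)"
proof -
  have "Rd d = (\<Inter>i\<in>{d..}. {x. x i = undefined})"
    unfolding set_eq_iff INT_iff mem_Collect_eq by (simp add: Rd_def PiE_iff extensional_def not_less Ball_def)
  thus ?thesis by (auto intro!: closed_INT closed_Collect_eq continuous_on_product_coordinates)
qed

lemma continuous_on_ip_left: "continuous_on UNIV (\<lambda>x. ip d x y)"
  unfolding ip_def by (intro continuous_intros continuous_on_product_coordinates)

lemma continuous_on_ip_self: "continuous_on UNIV (\<lambda>x. ip d x x)"
  unfolding ip_def by (intro continuous_intros continuous_on_product_coordinates)

lemma continuous_on_quad_form: "continuous_on UNIV (quad_form d H)"
  unfolding quad_form_def by (intro continuous_intros continuous_on_product_coordinates)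

lemma abs_coord_le_ip: "i < d \<Longrightarrow> (x i)\<^sup>2 \<le> ip d x x"
  unfolding ip_def power2_eq_square by (rule member_le_sum) auto

section \<open>Spectral theorem by successive maximisation of the quadratic form\<close>

lemma exists_unit_orthogonal:
  fixes v :: "nat \<Rightarrow> nat \<Rightarrow> real"
  assumes v: "\<And>i j. i < k \<Longrightarrow> j < k \<Longrightarrow> ip d (v i) (v j) = (if i = j then 1 else 0)" and "k < d"
  shows "\<exists>u\<in>Rd d. ip d u u = 1 \<and> (\<forall>i<k. ip d u (v i) = 0)"
proof -
  \<comment> \<open>A dimension count: the squared entries of the \<open>k\<close> orthonormal
    vectors add up to \<open>k < d\<close>, so for some coordinate \<open>j\<close> they add up to
    less than 1. Then the basis vector \<open>e\<close> of that coordinate is not in their span, and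
    its residual \<open>w\<close> has squared norm 1 minus that sum.\<close>
  have "(\<Sum>j<d. \<Sum>i<k. (v i j)\<^sup>2) = (\<Sum>i<k. ip d (v i) (v i))"
    unfolding ip_def power2_eq_square by (rule sum.swap)
  also have "\<dots> = real k" using v by simp
  also have "\<dots> < (\<Sum>j<d. 1)" using \<open>k < d\<close> by simp
  finally obtain j where j: "j < d" "(\<Sum>i<k. (v i j)\<^sup>2) < 1"
    by (meson lessThan_iff not_le sum_mono)
  define e where "e i = (if i = j then 1 else 0 :: real)" for i
  have ipe: "ip d e x = x j" for x using j by (simp add: ip_def e_def if_distrib[of "\<lambda>t. t * _"] cong: if_cong)
  define w where "w a = e a - (\<Sum>i<k. v i j * v i a)" for a
  have wl: "ip d w (v l) = 0" if "l < k" for l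
  proof -
    have "ip d w (v l) = v l j - (\<Sum>i<k. v i j * ip d (v i) (v l))"
      unfolding w_def ip_diff_left ip_sum_left ip_scale_left ipe ..
    also have "(\<Sum>i<k. v i j * ip d (v i) (v l)) = (\<Sum>i<k. if i = l then v i j else 0)"
      using v that by (intro sum.cong) auto
    finally show ?thesis using that by simp
  qed
  have wz: "ip d w z = z j - (\<Sum>i<k. v i j * ip d (v i) z)" for z
    unfolding w_def[abs_def] ip_diff_left ip_sum_left ip_scale_left ipe ..
  have "ip d w w = w j" using wl by (subst wz) (simp add: ip_commute)
  also have "\<dots> = 1 - (\<Sum>i<k. (v i j)\<^sup>2)" by (simp add: w_def e_def power2_eq_square)
  finally have ww: "ip d w w > 0" using j by simp
  define c where "c = 1 / sqrt (ip d w w)"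
  define u where "u = (\<lambda>i\<in>{..<d}. c * w i)"
  have 1: "ip d u z = c * ip d w z" for z
    using ip_cong[of d u "\<lambda>i. c * w i" z z] by (simp add: u_def ip_scale_left)
  have "ip d u u = c * (c * ip d w w)" by (subst 1, subst ip_commute, subst 1) simp
  also have "\<dots> = 1" using ww by (simp add: c_def)
  finally show ?thesis using wl 1 by (intro bexI[of _ u]) (auto simp: u_def Rd_def)
qed

lemma ip_matvec_sym:
  assumes "\<And>i j. i < d \<Longrightarrow> j < d \<Longrightarrow> H i j = H j i"
  shows "ip d x (\<lambda>i. \<Sum>j<d. H i j * y j) = ip d (\<lambda>i. \<Sum>j<d. H i j * x j) y"
proof -
  have "ip d x (\<lambda>i. \<Sum>j<d. H i j * y j) = (\<Sum>i<d. \<Sum>j<d. x i * H i j * y j)"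
    by (simp add: ip_def sum_distrib_left mult.assoc)
  also have "\<dots> = (\<Sum>j<d. \<Sum>i<d. x i * H i j * y j)" by (rule sum.swap)
  also have "\<dots> = (\<Sum>j<d. \<Sum>i<d. x i * H j i * y j)" using assms by (intro sum.cong) auto
  also have "\<dots> = ip d (\<lambda>i. \<Sum>j<d. H i j * x j) y"
    by (simp add: ip_def sum_distrib_left mult_ac)
  finally show ?thesis .
qed

text \<open>The first-order condition at a maximum in algebraic form, replacing differentiation of
  the quadratic form.\<close>

lemma linear_le_quadratic_imp_zero:
  fixes a b :: real assumes "\<And>t. t * a \<le> t\<^sup>2 * b" shows "a = 0"
proof (rule ccontr)
  assume "a \<noteq> 0"
  define c where "c = 1 + \<bar>b\<bar>"
  have c: "c > 0" "b < c" by (auto simp: c_def)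
  have "a / c * a \<le> (a / c)\<^sup>2 * b" by (rule assms)
  also have "\<dots> < (a / c)\<^sup>2 * c" using c \<open>a \<noteq> 0\<close> by (intro mult_strict_left_mono) auto
  also have "\<dots> = a / c * a" using c by (simp add: power2_eq_square)
  finally show False by simp
qed

text \<open>A maximiser of the quadratic form on the unit sphere of the orthogonal complement is an
  eigenvector: varying it in an admissible direction \<open>w\<close> shows that \<open>w\<close> is
  orthogonal to \<open>Hv u\<close>.\<close>

lemma exists_eigenvector_orthogonal:
  fixes v :: "nat \<Rightarrow> nat \<Rightarrow> real"
  assumes v: "\<And>i j. i < k \<Longrightarrow> j < k \<Longrightarrow> ip d (v i) (v j) = (if i = j then 1 else 0)" and "k < d"
    and sym: "\<And>i j. i < d \<Longrightarrow> j < d \<Longrightarrow> H i j = H j i"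
    and eig: "\<And>i a. i < k \<Longrightarrow> a < d \<Longrightarrow> (\<Sum>b<d. H a b * v i b) = l i * v i a"
  shows "\<exists>u \<mu>. ip d u u = 1 \<and> (\<forall>i<k. ip d u (v i) = 0) \<and> (\<forall>a<d. (\<Sum>b<d. H a b * u b) = \<mu> * u a)"
proof -
  define K where "K = Rd d \<inter> {u. ip d u u = 1} \<inter> (\<Inter>i\<in>{..<k}. {u. ip d u (v i) = 0})"
  have clK: "closed K" unfolding K_def
    by (intro closed_Int closed_Rd closed_INT ballI closed_Collect_eq continuous_on_ip_self continuous_on_ip_left) auto
  have bdK: "\<bar>x i\<bar> \<le> 1" if "x \<in> K" "i < d" for x i
    using abs_coord_le_ip[OF that(2), of x] that(1) by (simp add: K_def abs_square_le_1)
  have "compact K" using bdK by (intro compact_subset_Rd[OF clK, of d 1]) (auto simp: K_def)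
  moreover have "K \<noteq> {}" using exists_unit_orthogonal[OF v \<open>k < d\<close>] by (auto simp: K_def)
  ultimately obtain u where u: "u \<in> K" "\<And>y. y \<in> K \<Longrightarrow> quad_form d H y \<le> quad_form d H u"
    using continuous_attains_sup[of K "quad_form d H"] continuous_on_subset[OF continuous_on_quad_form] by blast
  define \<mu> where "\<mu> = quad_form d H u"
  define Hv where "Hv x a = (\<Sum>b<d. H a b * x b)" for x a
  have qf: "quad_form d H x = ip d x (Hv x)" for x by (simp add: quad_form_ip Hv_def[abs_def])
  have symH: "ip d x (Hv y) = ip d (Hv x) y" for x y
    unfolding Hv_def by (rule ip_matvec_sym[OF sym])
  have uu: "ip d u u = 1" "\<And>i. i < k \<Longrightarrow> ip d u (v i) = 0" "u \<in> Rd d" using u(1) by (auto simp: K_def)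
  have max: "quad_form d H y \<le> \<mu> * ip d y y" if y: "\<And>i. i < k \<Longrightarrow> ip d y (v i) = 0" for y
  proof (cases "ip d y y = 0")
    case True
    hence "quad_form d H y = 0" by (simp add: ip_self_eq_0 quad_form_def)
    thus ?thesis using True by simp
  next
    case False
    hence pos: "ip d y y > 0" using ip_self_nonneg[of d y] by simp
    define c where "c = 1 / sqrt (ip d y y)"
    define y' where "y' = (\<lambda>i\<in>{..<d}. c * y i)"
    have 1: "ip d y' z = c * ip d y z" for z
      using ip_cong[of d y' "\<lambda>i. c * y i" z z] by (simp add: y'_def ip_scale_left)
    have "ip d y' y' = c * (c * ip d y y)" by (subst 1, subst ip_commute, subst 1) simp
    also have "\<dots> = 1" using pos by (simp add: c_def)
    finally have "y' \<in> K" using y 1 by (auto simp: K_def y'_def Rd_def)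
    hence "quad_form d H y' \<le> \<mu>" unfolding \<mu>_def by (rule u(2))
    moreover have "quad_form d H y' = c\<^sup>2 * quad_form d H y"
      by (simp add: quad_form_def y'_def sum_distrib_left power2_eq_square mult_ac)
    moreover have "c\<^sup>2 = 1 / ip d y y" using pos by (simp add: c_def power_divide)
    ultimately show ?thesis using pos by (simp add: field_simps)
  qed
  have orth: "ip d w (Hv u) = 0" if w: "ip d w u = 0" "\<And>i. i < k \<Longrightarrow> ip d w (v i) = 0" for w
  proof (rule linear_le_quadratic_imp_zero)
    fix t :: real
    define s where "s = t / 2"
    define y where "y i = u i + s * w i" for i
    have yz: "ip d y z = ip d u z + s * ip d w z" for z
      unfolding y_def[abs_def] ip_add_left ip_scale_left ..
    have zy: "ip d z y = ip d z u + s * ip d z w" for z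
      by (simp only: ip_commute[of d z] yz)
    have "quad_form d H y \<le> \<mu> * ip d y y"
      by (rule max) (use uu w in \<open>auto simp: yz\<close>)
    moreover have "ip d y y = 1 + s\<^sup>2 * ip d w w"
      using uu w by (simp add: yz zy ip_commute[of d u w] power2_eq_square)
    moreover have "quad_form d H y = \<mu> + t * ip d w (Hv u) + s\<^sup>2 * quad_form d H w"
    proof -
      have "quad_form d H y = ip d (Hv y) y" by (simp add: qf ip_commute)
      also have "\<dots> = ip d u (Hv y) + s * ip d w (Hv y)"
        by (subst zy) (simp add: ip_commute)
      also have "ip d u (Hv y) = \<mu> + s * ip d w (Hv u)"
        unfolding symH[of u y] zy \<mu>_def qf symH[of u u] by (simp only: ip_commute[of d w])
      also have "ip d w (Hv y) = ip d w (Hv u) + s * quad_form d H w"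
        unfolding symH[of w y] zy by (simp only: symH[symmetric] qf)
      finally show ?thesis by (simp add: power2_eq_square algebra_simps s_def)
    qed
    ultimately show "t * ip d w (Hv u) \<le> t\<^sup>2 * ((\<mu> * ip d w w - quad_form d H w) / 4)"
      by (simp add: s_def power_divide field_simps)
  qed
  \<comment> \<open>The residual is itself an admissible direction, since symmetry of
    \<open>H\<close> and the eigenvalue equations keep \<open>Hv u\<close> orthogonal to every
    \<open>v i\<close>. So it is orthogonal to itself.\<close>
  define w where "w a = Hv u a - \<mu> * u a" for a
  have wu: "ip d w u = 0" using uu by (simp add: w_def[abs_def] ip_diff_left ip_scale_left \<mu>_def qf ip_commute)
  have wv: "ip d w (v i) = 0" if i: "i < k" for i
  proof -
    have "ip d (Hv u) (v i) = ip d u (Hv (v i))" by (simp add: symH)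
    also have "\<dots> = ip d u (\<lambda>a. l i * v i a)" using eig[OF i] by (intro ip_cong) (auto simp: Hv_def)
    also have "\<dots> = 0" using uu(2)[OF i] by (subst ip_commute) (simp add: ip_scale_left ip_commute)
    finally show ?thesis using uu(2)[OF i] by (simp add: w_def[abs_def] ip_diff_left ip_scale_left)
  qed
  have "ip d w w = ip d w (Hv u) - \<mu> * ip d w u"
    by (subst ip_commute, subst (1) w_def[abs_def]) (simp add: ip_diff_left ip_scale_left ip_commute)
  also have "\<dots> = 0" using orth[OF wu wv] wu by simp
  finally have "\<forall>a<d. w a = 0" by (simp add: ip_self_eq_0)
  thus ?thesis using uu by (intro exI[of _ u] exI[of _ \<mu>]) (auto simp: w_def Hv_def)
qed

lemma exists_orthonormal_eigenvectors:
  assumes sym: "\<And>i j. i < d \<Longrightarrow> j < d \<Longrightarrow> H i j = H j i" and "k \<le> d"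
  shows "\<exists>v l. (\<forall>i<k. \<forall>j<k. ip d (v i) (v j) = (if i = j then 1 else 0)) \<and>
     (\<forall>i<k. \<forall>a<d. (\<Sum>b<d. H a b * v i b) = l i * v i a)"
  using \<open>k \<le> d\<close>
proof (induction k)
  case (Suc k)
  then obtain v l where v: "\<forall>i<k. \<forall>j<k. ip d (v i) (v j) = (if i = j then 1 else 0)"
     and l: "\<forall>i<k. \<forall>a<d. (\<Sum>b<d. H a b * v i b) = l i * v i a" by auto
  obtain u \<mu> where u: "ip d u u = 1" "\<forall>i<k. ip d u (v i) = 0" "\<forall>a<d. (\<Sum>b<d. H a b * u b) = \<mu> * u a"
    using exists_eigenvector_orthogonal[of k d v H l] v l sym Suc.prems by auto
  show ?case
    by (rule exI[of _ "v(k := u)"], rule exI[of _ "l(k := \<mu>)"])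
       (use u v l in \<open>auto simp: less_Suc_eq ip_commute\<close>)
qed auto

text \<open>\<open>P\<close> is the orthogonal projection onto the span, and the squared distance of
  row \<open>a\<close> of \<open>P\<close> from the basis vector is \<open>1 - P a a\<close>. These
  nonnegative numbers sum to \<open>d\<close> minus the trace, which is 0 as there are
  \<open>d\<close> vectors; so each of them vanishes.\<close>

lemma orthonormal_complete:
  assumes v: "\<And>i j. i < d \<Longrightarrow> j < d \<Longrightarrow> ip d (v i) (v j) = (if i = j then 1 else 0)"
    and "a < d" "b < d"
  shows "(\<Sum>i<d. v i a * v i b) = (if a = b then 1 else 0)"
proof -
  define P where "P a b = (\<Sum>i<d. v i a * v i b)" for a b
  have PP: "ip d (P a) (P b) = P a b" for a b
  proof -
    have P: "P a = (\<lambda>c. \<Sum>i<d. v i a * v i c)" for a by (auto simp: P_def)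
    have "ip d (P a) (P b) = (\<Sum>i<d. v i a * (\<Sum>j<d. v j b * ip d (v j) (v i)))"
      by (subst P, subst ip_sum_left, subst ip_scale_left, subst ip_commute, subst P, subst ip_sum_left, subst ip_scale_left, rule refl)
    also have "\<dots> = (\<Sum>i<d. v i a * (\<Sum>j<d. if j = i then v j b else 0))"
      using v by (intro sum.cong arg_cong2[where f="(*)"]) auto
    also have "\<dots> = P a b" by (simp add: P_def)
    finally show ?thesis .
  qed
  have res: "(\<Sum>c<d. ((if a = c then 1 else 0) - P a c)\<^sup>2) = 1 - P a a" if "a < d" for a
  proof -
    have "(\<Sum>c<d. ((if a = c then 1 else 0) - P a c)\<^sup>2)
      = (\<Sum>c<d. (if a = c then 1 - 2 * P a c else 0) + P a c * P a c)"
      by (intro sum.cong) (auto simp: power2_eq_square algebra_simps)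
    also have "\<dots> = 1 - 2 * P a a + ip d (P a) (P a)"
      using that by (simp add: sum.distrib ip_def)
    finally show ?thesis by (simp add: PP)
  qed
  have "(\<Sum>a<d. 1 - P a a) = real d - (\<Sum>i<d. ip d (v i) (v i))"
    unfolding sum_subtractf P_def ip_def by (subst sum.swap) simp
  also have "\<dots> = 0" using v by simp
  finally have tr: "(\<Sum>a<d. 1 - P a a) = 0" .
  have "0 \<le> 1 - P a a" if "a < d" for a unfolding res[OF that, symmetric] by (intro sum_nonneg) auto
  hence "\<forall>a\<in>{..<d}. 1 - P a a = 0"
    using tr by (subst (asm) sum_nonneg_eq_0_iff) auto
  hence "(\<Sum>c<d. ((if a = c then 1 else 0) - P a c)\<^sup>2) = 0" using res[OF \<open>a < d\<close>] \<open>a < d\<close> by simp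
  hence "\<forall>c<d. P a c = (if a = c then 1 else 0)" by (subst (asm) sum_nonneg_eq_0_iff) auto
  thus ?thesis using \<open>b < d\<close> by (simp add: P_def)
qed

section \<open>Existence and uniqueness of inverse square roots\<close>

lemma pos_def_sym: "pos_def d H \<Longrightarrow> i < d \<Longrightarrow> j < d \<Longrightarrow> H i j = H j i"
  by (auto simp: pos_def_def)

lemma pos_def_quad_form:
  assumes "pos_def d H"
  shows "0 \<le> quad_form d H u" and "quad_form d H u = 0 \<longleftrightarrow> (\<forall>i<d. u i = 0)"
proof -
  let ?u = "\<lambda>i\<in>{..<d}. u i"
  have eq: "quad_form d H ?u = quad_form d H u" by (simp add: quad_form_def)
  have "quad_form d H ?u > 0" if "\<not> (\<forall>i<d. u i = 0)"
  proof -
    have "?u \<noteq> vzero d" using that by (auto simp: vzero_def fun_eq_iff restrict_def)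
    thus ?thesis using assms by (auto simp: pos_def_def Rd_def)
  qed
  moreover have "quad_form d H u = 0" if "\<forall>i<d. u i = 0" using that by (simp add: quad_form_def)
  ultimately show "0 \<le> quad_form d H u" "quad_form d H u = 0 \<longleftrightarrow> (\<forall>i<d. u i = 0)"
    unfolding eq by force+
qed

definition mm :: "nat \<Rightarrow> mtrx \<Rightarrow> mtrx \<Rightarrow> mtrx" where
  "mm d A B i j = (\<Sum>k<d. A i k * B k j)"

lemma mm_assoc: "mm d (mm d A B) C = mm d A (mm d B C)"
proof (intro ext)
  fix i j
  have "mm d (mm d A B) C i j = (\<Sum>k<d. \<Sum>l<d. A i l * (B l k * C k j))"
    by (simp add: mm_def sum_distrib_right mult.assoc)
  also have "\<dots> = mm d A (mm d B C) i j"
    by (subst sum.swap) (simp add: mm_def sum_distrib_left)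
  finally show "mm d (mm d A B) C i j = mm d A (mm d B C) i j" .
qed

text \<open>Entries outside the block are arbitrary, so most matrix identities hold only up to this
  relation.\<close>

definition meq :: "nat \<Rightarrow> mtrx \<Rightarrow> mtrx \<Rightarrow> bool" where
  "meq d A B \<longleftrightarrow> (\<forall>i<d. \<forall>j<d. A i j = B i j)"

lemma meq_refl: "meq d A A" by (simp add: meq_def)
lemma meq_sym: "meq d A B \<Longrightarrow> meq d B A" by (simp add: meq_def)
lemma meq_trans [trans]: "meq d A B \<Longrightarrow> meq d B C \<Longrightarrow> meq d A C" by (simp add: meq_def)

lemma mm_cong: "meq d A A' \<Longrightarrow> meq d B B' \<Longrightarrow> meq d (mm d A B) (mm d A' B')"
  by (simp add: meq_def mm_def)

lemma mm_ident: "meq d (mm d ident A) A" "meq d (mm d A ident) A"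
  by (auto simp: meq_def mm_def ident_def if_distrib[of "\<lambda>t. t * _"] if_distrib[of "\<lambda>t. _ * t"] cong: if_cong)

lemma mm_sym_ident:
  assumes "\<And>i j. i < d \<Longrightarrow> j < d \<Longrightarrow> A i j = A j i" "\<And>i j. i < d \<Longrightarrow> j < d \<Longrightarrow> B i j = B j i"
    and "meq d (mm d A B) ident"
  shows "meq d (mm d B A) ident"
  using assms by (auto simp: meq_def mm_def ident_def mult.commute)

definition is_inv_sqrt :: "nat \<Rightarrow> mtrx \<Rightarrow> mtrx \<Rightarrow> bool" where
  "is_inv_sqrt d H R \<longleftrightarrow> pos_def d R \<and> meq d (mm d R (mm d R H)) ident"

lemma mm_mm_unfold: "(\<Sum>k<d. \<Sum>l<d. R i k * R k l * H l j) = mm d R (mm d R H) i j"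
  by (simp add: mm_def sum_distrib_left mult.assoc)

text \<open>In an orthonormal eigenbasis \<open>v\<close> with eigenvalues \<open>l\<close>, which
  are positive, \<open>R\<close> is the sum of v v^T / sqrt l. Then R H is the sum of sqrt l * v
  v^T, and multiplying by R once more leaves the sum of v v^T, the identity by completeness.\<close>

lemma exists_inv_sqrt:
  assumes H: "pos_def d H"
  shows "\<exists>R. is_inv_sqrt d H R"
proof -
  obtain v l where v: "\<And>i j. i < d \<Longrightarrow> j < d \<Longrightarrow> ip d (v i) (v j) = (if i = j then 1 else 0)"
    and l: "\<And>i a. i < d \<Longrightarrow> a < d \<Longrightarrow> (\<Sum>b<d. H a b * v i b) = l i * v i a"
    using exists_orthonormal_eigenvectors[of d H d, OF pos_def_sym[OF H] order_refl] by blast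
  have lpos: "l i > 0" if i: "i < d" for i
  proof -
    have "quad_form d H (v i) = ip d (v i) (\<lambda>a. l i * v i a)"
      unfolding quad_form_ip using l[OF i] by (intro ip_cong) auto
    also have "\<dots> = l i" using v[OF i i] by (subst ip_commute) (simp add: ip_scale_left)
    finally have q: "quad_form d H (v i) = l i" .
    have "quad_form d H (v i) \<noteq> 0" using pos_def_quad_form(2)[OF H, of "v i"] v[OF i i] by (auto simp: ip_def)
    thus ?thesis using pos_def_quad_form(1)[OF H, of "v i"] q by simp
  qed
  define R where "R a b = (\<Sum>m<d. v m a * v m b / sqrt (l m))" for a b
  have sym: "R a b = R b a" for a b by (simp add: R_def mult.commute)
  have RH: "mm d R H k j = (\<Sum>m<d. sqrt (l m) * v m k * v m j)" if j: "j < d" for k j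
  proof -
    have "mm d R H k j = (\<Sum>m<d. v m k / sqrt (l m) * (\<Sum>q<d. H q j * v m q))"
      unfolding mm_def R_def sum_distrib_right sum_distrib_left by (subst sum.swap) (simp add: mult_ac)
    also have "\<dots> = (\<Sum>m<d. sqrt (l m) * v m k * v m j)"
    proof (intro sum.cong refl)
      fix m assume m: "m \<in> {..<d}"
      have "(\<Sum>q<d. H q j * v m q) = (\<Sum>q<d. H j q * v m q)"
        using pos_def_sym[OF H] j by (intro sum.cong) auto
      also have "\<dots> = l m * v m j" using l m j by auto
      finally show "v m k / sqrt (l m) * (\<Sum>q<d. H q j * v m q) = sqrt (l m) * v m k * v m j"
        using lpos[of m] m by (simp add: field_simps)
    qed
    finally show ?thesis .
  qed
  have "mm d R (mm d R H) i j = ident i j" if ij: "i < d" "j < d" for i j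
  proof -
    have "mm d R (mm d R H) i j = (\<Sum>k<d. \<Sum>m<d. \<Sum>m'<d. v m i / sqrt (l m) * sqrt (l m') * v m' j * (v m k * v m' k))"
      unfolding mm_def[of d R "mm d R H"] RH[OF ij(2)] unfolding R_def sum_distrib_right sum_distrib_left
      by (rule sum.cong[OF refl], subst sum.swap) (simp add: mult_ac)
    also have "\<dots> = (\<Sum>m<d. \<Sum>k<d. \<Sum>m'<d. v m i / sqrt (l m) * sqrt (l m') * v m' j * (v m k * v m' k))"
      by (rule sum.swap)
    also have "\<dots> = (\<Sum>m<d. \<Sum>m'<d. \<Sum>k<d. v m i / sqrt (l m) * sqrt (l m') * v m' j * (v m k * v m' k))"
      by (intro sum.cong refl sum.swap)
    also have "\<dots> = (\<Sum>m<d. \<Sum>m'<d. v m i / sqrt (l m) * sqrt (l m') * v m' j * ip d (v m) (v m'))"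
      by (simp add: ip_def sum_distrib_left)
    also have "\<dots> = (\<Sum>m<d. \<Sum>m'<d. if m = m' then v m i * v m' j else 0)"
      using v lpos by (intro sum.cong refl) (auto simp: less_imp_neq[symmetric])
    also have "\<dots> = (\<Sum>m<d. v m i * v m j)" by (simp)
    also have "\<dots> = ident i j" using orthonormal_complete[OF v ij] by (simp add: ident_def)
    finally show ?thesis .
  qed
  moreover have "pos_def d R"
    unfolding pos_def_def
  proof (intro conjI allI impI ballI sym)
    fix u assume u: "u \<in> Rd d" "u \<noteq> vzero d"
    have q: "quad_form d R u = (\<Sum>m<d. (ip d (v m) u)\<^sup>2 / sqrt (l m))"
    proof -
      have "quad_form d R u = (\<Sum>i<d. \<Sum>j<d. \<Sum>m<d. (v m i * u i) * (v m j * u j) / sqrt (l m))"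
        unfolding quad_form_def R_def sum_distrib_right sum_distrib_left by (simp add: mult_ac)
      also have "\<dots> = (\<Sum>i<d. \<Sum>m<d. \<Sum>j<d. (v m i * u i) * (v m j * u j) / sqrt (l m))"
        by (intro sum.cong refl sum.swap)
      also have "\<dots> = (\<Sum>m<d. \<Sum>i<d. \<Sum>j<d. (v m i * u i) * (v m j * u j) / sqrt (l m))"
        by (rule sum.swap)
      also have "\<dots> = (\<Sum>m<d. (ip d (v m) u)\<^sup>2 / sqrt (l m))"
        by (simp add: ip_def power2_eq_square sum_product sum_divide_distrib)
      finally show ?thesis .
    qed
    have nn: "(ip d (v m) u)\<^sup>2 / sqrt (l m) \<ge> 0" if "m < d" for m using lpos[OF that] by simp
    show "quad_form d R u > 0"
    proof (rule ccontr)
      assume "\<not> quad_form d R u > 0"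
      moreover have "quad_form d R u \<ge> 0" unfolding q using nn by (intro sum_nonneg) auto
      ultimately have "\<forall>m<d. (ip d (v m) u)\<^sup>2 / sqrt (l m) = 0"
        using q nn by (subst (asm) q) (metis (no_types, lifting) finite_lessThan lessThan_iff linorder_not_less order_antisym sum_nonneg_eq_0_iff)
      hence z: "\<And>m. m < d \<Longrightarrow> ip d (v m) u = 0" using lpos by force
      have "u a = 0" if a: "a < d" for a
      proof -
        have "u a = (\<Sum>b<d. (if a = b then 1 else 0) * u b)" using a by (simp add: if_distrib[of "\<lambda>t. t * _"] cong: if_cong)
        also have "\<dots> = (\<Sum>b<d. (\<Sum>i<d. v i a * v i b) * u b)"
          using orthonormal_complete[OF v a] by (intro sum.cong) auto
        also have "\<dots> = (\<Sum>i<d. v i a * ip d (v i) u)"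
          unfolding ip_def sum_distrib_right sum_distrib_left by (subst sum.swap) (simp add: mult_ac)
        finally show ?thesis using z by simp
      qed
      hence "u = vzero d" using u(1) by (auto simp: vzero_def Rd_def fun_eq_iff PiE_iff extensional_def)
      thus False using u by simp
    qed
  qed
  ultimately show ?thesis by (auto simp: is_inv_sqrt_def meq_def)
qed

text \<open>Both squares are left inverses of \<open>H\<close>. Symmetry makes the second a right
  inverse as well, and a left and a right inverse coincide.\<close>

lemma inv_sqrt_square_unique:
  assumes H: "pos_def d H" and R: "is_inv_sqrt d H R" and R': "is_inv_sqrt d H R'"
  shows "meq d (mm d R R) (mm d R' R')"
proof -
  have s: "mm d A A i j = mm d A A j i" if "pos_def d A" "i < d" "j < d" for A i j
    using pos_def_sym[OF that(1)] that unfolding mm_def by (intro sum.cong) auto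
  have 1: "meq d (mm d (mm d R R) H) ident" "meq d (mm d (mm d R' R') H) ident"
    using R R' by (simp_all add: is_inv_sqrt_def mm_assoc)
  have 2: "meq d (mm d H (mm d R' R')) ident"
    by (rule mm_sym_ident[OF s pos_def_sym[OF H] 1(2)]) (use R' in \<open>auto simp: is_inv_sqrt_def\<close>)
  have "meq d (mm d R R) (mm d (mm d R R) (mm d H (mm d R' R')))"
    using mm_cong[OF meq_refl[of d "mm d R R"] 2] mm_ident(2)[of d "mm d R R"] meq_sym meq_trans by blast
  also have "mm d (mm d R R) (mm d H (mm d R' R')) = mm d (mm d (mm d R R) H) (mm d R' R')"
    by (simp add: mm_assoc)
  also have "meq d \<dots> (mm d R' R')"
    using mm_cong[OF 1(1) meq_refl[of d "mm d R' R'"]] mm_ident(1)[of d "mm d R' R'"] meq_trans by blast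
  finally show ?thesis .
qed

text \<open>With \<open>D = R - R'\<close> one has \<open>R D + D R' = R\<^sup>2 - R'\<^sup>2\<close>; if this vanishes, then so does the trace of
  \<open>D R D + D R' D\<close>, a sum of values of the two positive definite forms.\<close>

lemma pos_def_square_inj:
  assumes R: "pos_def d R" and R': "pos_def d R'" and eq: "meq d (mm d R R) (mm d R' R')"
  shows "meq d R R'"
proof -
  define D where "D i j = R i j - R' i j" for i j
  have symD: "D i j = D j i" if "i < d" "j < d" for i j
    using pos_def_sym[OF R that] pos_def_sym[OF R' that] by (simp add: D_def)
  have 0: "mm d R D i j + mm d D R' i j = 0" if "i < d" "j < d" for i j
  proof -
    have "mm d R D i j + mm d D R' i j = mm d R R i j - mm d R' R' i j"
      by (simp add: mm_def D_def algebra_simps sum_subtractf sum.distrib)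
    thus ?thesis using eq that by (simp add: meq_def)
  qed
  have "0 = (\<Sum>i<d. \<Sum>j<d. D i j * (mm d R D i j + mm d D R' i j))" using 0 by simp
  also have "\<dots> = (\<Sum>i<d. \<Sum>j<d. D i j * mm d R D i j) + (\<Sum>i<d. \<Sum>j<d. D i j * mm d D R' i j)"
    by (simp add: algebra_simps sum.distrib)
  also have "(\<Sum>i<d. \<Sum>j<d. D i j * mm d R D i j) = (\<Sum>j<d. quad_form d R (\<lambda>i. D i j))"
    by (subst sum.swap) (simp add: quad_form_def mm_def sum_distrib_left mult_ac)
  also have "(\<Sum>i<d. \<Sum>j<d. D i j * mm d D R' i j) = (\<Sum>i<d. quad_form d R' (D i))"
    unfolding quad_form_def mm_def sum_distrib_left
    by (rule sum.cong[OF refl], subst sum.swap) (simp add: mult_ac)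
  finally have "(\<Sum>j<d. quad_form d R (\<lambda>i. D i j)) + (\<Sum>i<d. quad_form d R' (D i)) = 0" by simp
  moreover have "(\<Sum>j<d. quad_form d R (\<lambda>i. D i j)) \<ge> 0" "(\<Sum>i<d. quad_form d R' (D i)) \<ge> 0"
    using pos_def_quad_form(1)[OF R] pos_def_quad_form(1)[OF R'] by (auto intro: sum_nonneg)
  ultimately have "(\<Sum>j<d. quad_form d R (\<lambda>i. D i j)) = 0" by linarith
  hence "\<forall>j<d. quad_form d R (\<lambda>i. D i j) = 0"
    using pos_def_quad_form(1)[OF R] by (subst (asm) sum_nonneg_eq_0_iff) auto
  thus ?thesis using pos_def_quad_form(2)[OF R] by (auto simp: meq_def D_def)
qed

lemma is_inv_sqrt_inv_sqrt:
  assumes H: "pos_def d H" shows "is_inv_sqrt d H (inv_sqrt d H)"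
proof -
  let ?P = "\<lambda>R. pos_def d R
     \<and> (\<forall>i<d. \<forall>j<d. (\<Sum>k<d. \<Sum>l<d. R i k * R k l * H l j) = ident i j)
     \<and> (\<forall>i j. \<not> (i < d \<and> j < d) \<longrightarrow> R i j = 0)"
  have P: "?P R \<longleftrightarrow> is_inv_sqrt d H R \<and> (\<forall>i j. \<not> (i < d \<and> j < d) \<longrightarrow> R i j = 0)" for R
    by (simp add: mm_mm_unfold is_inv_sqrt_def meq_def)
  obtain R0 where R0: "is_inv_sqrt d H R0" using exists_inv_sqrt[OF H] by blast
  \<comment> \<open>Zero outside the block is the convention of \<open>inv_sqrt\<close>; with it,
    uniqueness on the block becomes equality of functions.\<close>
  define R where "R i j = (if i < d \<and> j < d then R0 i j else 0)" for i j
  have "meq d (mm d R (mm d R H)) (mm d R0 (mm d R0 H))"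
    by (intro mm_cong) (auto simp: meq_def R_def)
  moreover have "quad_form d R u = quad_form d R0 u" for u by (simp add: quad_form_def R_def)
  hence "pos_def d R" using R0 by (auto simp: is_inv_sqrt_def pos_def_def R_def)
  ultimately have "is_inv_sqrt d H R" using R0 meq_trans by (auto simp: is_inv_sqrt_def)
  hence PR: "?P R" unfolding P by (auto simp: R_def)
  have "?P (THE R. ?P R)"
  proof (rule theI[of ?P, OF PR])
    fix R' assume "?P R'"
    hence R': "is_inv_sqrt d H R'" "\<forall>i j. \<not> (i < d \<and> j < d) \<longrightarrow> R' i j = 0" unfolding P by auto
    have "meq d R' R"
      using pos_def_square_inj inv_sqrt_square_unique[OF H R'(1) \<open>is_inv_sqrt d H R\<close>] R'(1) \<open>is_inv_sqrt d H R\<close>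
      by (auto simp: is_inv_sqrt_def)
    thus "R' = R" using R'(2) PR by (intro ext) (metis meq_def)
  qed
  thus ?thesis unfolding P inv_sqrt_def by blast
qed

text \<open>The form of the identity that whitens a quadratic form. The matrix X = R H R satisfies X
  R = R, because R R is also a right inverse of \<open>H\<close>; multiplying by
  \<open>mm d R H\<close>, a right inverse of \<open>R\<close>, gives the claim.\<close>

lemma is_inv_sqrt_conj:
  assumes "pos_def d H" and R: "is_inv_sqrt d H R"
  shows "meq d (mm d R (mm d H R)) ident"
proof -
  have a: "meq d (mm d R (mm d R H)) ident" and pR: "pos_def d R" using R by (auto simp: is_inv_sqrt_def)
  have s: "mm d R R i j = mm d R R j i" if "i < d" "j < d" for i j
    using pos_def_sym[OF pR] that unfolding mm_def by (intro sum.cong) auto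
  have b: "meq d (mm d H (mm d R R)) ident"
    by (rule mm_sym_ident[OF s pos_def_sym[OF assms(1)]]) (use a in \<open>auto simp: mm_assoc\<close>)
  let ?X = "mm d R (mm d H R)"
  have "mm d ?X R = mm d R (mm d H (mm d R R))" by (simp add: mm_assoc)
  hence XR: "meq d (mm d ?X R) R"
    using mm_cong[OF meq_refl b, of R] mm_ident(2)[of d R] meq_trans by metis
  have "meq d ?X (mm d ?X (mm d R (mm d R H)))"
    using mm_cong[OF meq_refl a, of ?X] mm_ident(2)[of d ?X] meq_sym meq_trans by blast
  also have "mm d ?X (mm d R (mm d R H)) = mm d (mm d ?X R) (mm d R H)" by (simp add: mm_assoc)
  also have "meq d \<dots> (mm d R (mm d R H))" by (rule mm_cong[OF XR meq_refl])
  also note a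
  finally show ?thesis .
qed

section \<open>Gaussian elimination in a positive definite matrix\<close>

lemma pos_def_eliminate:
  assumes R: "pos_def d R" and "k < d"
    and h: "\<forall>i\<ge>k. h i = 0" "\<forall>j<k. (\<Sum>i<d. h i * R i j) = R k j"
  defines "w \<equiv> \<lambda>i. (if i = k then 1 else 0) - h i"
  shows "w k = 1" "\<forall>i>k. w i = 0" "\<forall>j<k. (\<Sum>i<d. w i * R i j) = 0" "(\<Sum>i<d. w i * R i k) \<noteq> 0"
proof -
  have wR: "(\<Sum>i<d. w i * R i j) = R k j - (\<Sum>i<d. h i * R i j)" for j
    using \<open>k < d\<close> by (simp add: w_def algebra_simps sum_subtractf if_distrib[of "\<lambda>t. _ * t"] cong: if_cong)
  show w1: "w k = 1" and w2: "\<forall>i>k. w i = 0" using h(1) by (simp_all add: w_def)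
  show w0: "\<forall>j<k. (\<Sum>i<d. w i * R i j) = 0" using wR h(2) by simp
  \<comment> \<open>The row vector w^T R vanishes before \<open>k\<close> and \<open>w\<close>
    vanishes after \<open>k\<close>, so the pivot equals the quadratic form at \<open>w\<close>,
    which is nonzero as \<open>w k = 1\<close>.\<close>
  have "quad_form d R w = (\<Sum>j<d. (\<Sum>i<d. w i * R i j) * w j)"
    unfolding quad_form_def sum_distrib_right by (subst sum.swap) simp
  also have "\<dots> = (\<Sum>j<d. if j = k then (\<Sum>i<d. w i * R i k) else 0)"
  proof (intro sum.cong refl)
    fix j show "(\<Sum>i<d. w i * R i j) * w j = (if j = k then (\<Sum>i<d. w i * R i k) else 0)"
      using w0 w1 w2 by (cases j k rule: linorder_cases) auto
  qed
  also have "\<dots> = (\<Sum>i<d. w i * R i k)" using \<open>k < d\<close> by simp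
  finally show "(\<Sum>i<d. w i * R i k) \<noteq> 0"
    using pos_def_quad_form(2)[OF R, of w] \<open>k < d\<close> w1 by auto
qed

text \<open>Nonsingularity of the leading blocks, stated as solvability. Adding a multiple of the
  elimination vector \<open>w\<close> leaves the earlier equations intact and corrects equation
  \<open>k\<close>, because the pivot is nonzero.\<close>

lemma pos_def_leading_solve:
  assumes R: "pos_def d R" and "k \<le> d"
  shows "\<exists>g. (\<forall>i\<ge>k. g i = 0) \<and> (\<forall>j<k. (\<Sum>i<d. g i * R i j) = b j)"
  using \<open>k \<le> d\<close>
proof (induction k arbitrary: b)
  case 0
  show ?case by (rule exI[of _ "\<lambda>_. 0"]) auto
next
  case (Suc k)
  obtain h where h: "\<forall>i\<ge>k. h i = 0" "\<forall>j<k. (\<Sum>i<d. h i * R i j) = R k j"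
    using Suc.IH[of "R k"] Suc.prems by auto
  obtain g where g: "\<forall>i\<ge>k. g i = 0" "\<forall>j<k. (\<Sum>i<d. g i * R i j) = b j"
    using Suc.IH[of b] Suc.prems by auto
  define w where "w = (\<lambda>i. (if i = k then 1 else 0) - h i)"
  have w: "\<forall>i>k. w i = 0" "\<forall>j<k. (\<Sum>i<d. w i * R i j) = 0" "(\<Sum>i<d. w i * R i k) \<noteq> 0"
    unfolding w_def by (rule pos_def_eliminate[OF R Suc_le_lessD[OF Suc.prems] h])+
  define c where "c = (b k - (\<Sum>i<d. g i * R i k)) / (\<Sum>i<d. w i * R i k)"
  have gw: "(\<Sum>i<d. (g i + c * w i) * R i j) = (\<Sum>i<d. g i * R i j) + c * (\<Sum>i<d. w i * R i j)" for j
    by (simp add: algebra_simps sum.distrib sum_distrib_left)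
  show ?case
  proof (rule exI[of _ "\<lambda>i. g i + c * w i"], intro conjI allI impI)
    fix i assume "i \<ge> Suc k" thus "g i + c * w i = 0" using g w by simp
  next
    fix j assume "j < Suc k"
    thus "(\<Sum>i<d. (g i + c * w i) * R i j) = b j" unfolding gw
      using w g by (cases "j = k") (auto simp: c_def)
  qed
qed

text \<open>The vector that makes it possible to overwrite x by R x in place: combining row
  \<open>k\<close> with earlier rows cancels the coordinates of x below \<open>k\<close>, which are
  already lost when coordinate \<open>k\<close> is updated.\<close>

lemma pos_def_elimination:
  assumes R: "pos_def d R" and "k < d"
  shows "\<exists>w. w k = 1 \<and> (\<forall>i>k. w i = 0) \<and> (\<forall>j<k. (\<Sum>i<d. w i * R i j) = 0) \<and> (\<Sum>i<d. w i * R i k) \<noteq> 0"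
proof -
  obtain h where "\<forall>i\<ge>k. h i = 0" "\<forall>j<k. (\<Sum>i<d. h i * R i j) = R k j"
    using pos_def_leading_solve[OF R less_imp_le[OF \<open>k < d\<close>], of "R k"] by blast
  from pos_def_eliminate[OF R \<open>k < d\<close> this] show ?thesis
    by (intro exI[of _ "\<lambda>i. (if i = k then 1 else 0) - h i"] conjI) assumption+
qed

section \<open>Lebesgue measure and Gaussian measures on \<open>\<real>\<^sup>d\<close>\<close>

lemma space_leb: "space (leb d) = Rd d" by (simp add: leb_def space_PiM Rd_def)

lemma measurable_coord [measurable]: "(\<lambda>x. x i) \<in> borel_measurable (leb d)"
proof (cases "i < d")
  case True
  thus ?thesis unfolding leb_def by (intro measurable_compose[OF measurable_component_singleton]) auto
next
  case False
  hence "(\<lambda>x. x i) \<in> borel_measurable (leb d) \<longleftrightarrow> (\<lambda>x. undefined :: real) \<in> borel_measurable (leb d)"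
    by (intro measurable_cong) (auto simp: space_leb Rd_def PiE_iff extensional_def)
  thus ?thesis by simp
qed

lemma measurable_ident_borel: "(\<lambda>x. x) \<in> borel_measurable (leb d)"
  by (rule measurable_coordinatewise_then_product) measurable

lemma open_Rd_sets:
  assumes "openin (top_of_set (Rd d)) \<Theta>"
  shows "\<Theta> \<in> sets borel" "\<Theta> \<in> sets (leb d)"
proof -
  obtain U where U: "open U" "\<Theta> = Rd d \<inter> U" using assms by (auto simp: openin_open)
  thus "\<Theta> \<in> sets borel" using closed_Rd by auto
  have "(\<lambda>x. x) -` U \<inter> space (leb d) \<in> sets (leb d)"
    using measurable_sets[OF measurable_ident_borel] U by auto
  thus "\<Theta> \<in> sets (leb d)" using U by (simp add: space_leb Int_commute)
qed

lemma measurable_continuous_on_open: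
  fixes f :: "_ \<Rightarrow> real"
  assumes "openin (top_of_set (Rd d)) \<Theta>" "continuous_on \<Theta> f"
  shows "(\<lambda>x. indicator \<Theta> x * f x) \<in> borel_measurable (leb d)"
  using measurable_compose[OF measurable_ident_borel
      borel_measurable_continuous_on_indicator[OF open_Rd_sets(1)[OF assms(1)] assms(2)]]
  by simp

lemma measurable_into_leb:
  assumes "\<And>i. i < d \<Longrightarrow> (\<lambda>x. F x i) \<in> borel_measurable M" "\<And>x. x \<in> space M \<Longrightarrow> F x \<in> Rd d"
  shows "F \<in> measurable M (leb d)"
proof -
  have "(\<lambda>x. \<lambda>i\<in>{..<d}. F x i) \<in> measurable M (leb d)"
    unfolding leb_def by (rule measurable_restrict) (use assms(1) in auto)
  moreover have "(\<lambda>i\<in>{..<d}. F x i) = F x" if "x \<in> space M" for x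
    using assms(2)[OF that] unfolding Rd_def by (rule PiE_restrict)
  ultimately show ?thesis using measurable_cong[of M "\<lambda>x. \<lambda>i\<in>{..<d}. F x i" F] by blast
qed

text \<open>The change of variables formula, with \<open>c\<close> in the role of the reciprocal
  Jacobian determinant. Later results only assert that some positive \<open>c\<close> exists, as it
  cancels when a density is normalised.\<close>

definition leb_scaling :: "nat \<Rightarrow> ((nat \<Rightarrow> real) \<Rightarrow> nat \<Rightarrow> real) \<Rightarrow> real \<Rightarrow> bool" where
  "leb_scaling d F c \<longleftrightarrow> F \<in> measurable (leb d) (leb d) \<and>
     (\<forall>f\<in>borel_measurable (leb d). (\<integral>\<^sup>+x. f (F x) \<partial>leb d) = ennreal c * (\<integral>\<^sup>+x. f x \<partial>leb d))"

lemma leb_scalingD: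
  "leb_scaling d F c \<Longrightarrow> F \<in> measurable (leb d) (leb d)"
  "leb_scaling d F c \<Longrightarrow> f \<in> borel_measurable (leb d) \<Longrightarrow>
     (\<integral>\<^sup>+x. f (F x) \<partial>leb d) = ennreal c * (\<integral>\<^sup>+x. f x \<partial>leb d)"
  by (auto simp: leb_scaling_def)

lemma leb_scaling_cong:
  assumes "leb_scaling d F c" "\<And>x. x \<in> Rd d \<Longrightarrow> F x = G x"
  shows "leb_scaling d G c"
proof -
  have "G \<in> measurable (leb d) (leb d)"
    using assms measurable_cong[of "leb d" F G "leb d"] by (auto simp: leb_scaling_def space_leb)
  moreover have "(\<integral>\<^sup>+x. f (G x) \<partial>leb d) = (\<integral>\<^sup>+x. f (F x) \<partial>leb d)" for f :: "_ \<Rightarrow> ennreal"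
    using assms by (intro nn_integral_cong) (auto simp: space_leb)
  ultimately show ?thesis using assms(1) by (auto simp: leb_scaling_def)
qed

lemma leb_scaling_compose:
  assumes F: "leb_scaling d F c" and G: "leb_scaling d G c'" and "c > 0" "c' > 0"
  shows "leb_scaling d (\<lambda>x. F (G x)) (c * c')"
  unfolding leb_scaling_def
proof (intro conjI ballI)
  show "(\<lambda>x. F (G x)) \<in> measurable (leb d) (leb d)"
    using F G by (auto simp: leb_scaling_def intro: measurable_compose)
  fix f :: "_ \<Rightarrow> ennreal" assume f: "f \<in> borel_measurable (leb d)"
  have "(\<lambda>x. f (F x)) \<in> borel_measurable (leb d)"
    using F f by (auto simp: leb_scaling_def intro: measurable_compose)
  from leb_scalingD(2)[OF G this] leb_scalingD(2)[OF F f]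
  show "(\<integral>\<^sup>+x. f (F (G x)) \<partial>leb d) = ennreal (c * c') * (\<integral>\<^sup>+x. f x \<partial>leb d)"
    using assms(3,4) by (simp add: ennreal_mult mult_ac)
qed

section \<open>Affine changes of variables, one coordinate at a time\<close>

interpretation lborel_prod: product_sigma_finite "\<lambda>_::nat. lborel :: real measure"
  by (intro product_sigma_finite.intro sigma_finite_lborel)

text \<open>By Fubini only coordinate \<open>k\<close> is integrated first, and for it
  \<open>g x\<close> is a constant, so the one-dimensional affine substitution applies.\<close>

lemma leb_scaling_coordinate:
  assumes "k < d" "a \<noteq> 0" and g: "g \<in> borel_measurable (leb d)" "\<And>x t. g (x(k := t)) = g x"
  shows "leb_scaling d (\<lambda>x. x(k := a * x k + g x)) (1 / \<bar>a\<bar>)"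
  unfolding leb_scaling_def
proof (intro conjI ballI)
  show meas: "(\<lambda>x. x(k := a * x k + g x)) \<in> measurable (leb d) (leb d)"
  proof (rule measurable_into_leb)
    fix i show "(\<lambda>x. (x(k := a * x k + g x)) i) \<in> borel_measurable (leb d)"
      using g(1) by (cases "i = k") simp_all
  qed (use assms(1) in \<open>auto simp: space_leb Rd_def PiE_iff extensional_def\<close>)
  fix f :: "_ \<Rightarrow> ennreal" assume f: "f \<in> borel_measurable (leb d)"
  define I where "I = {..<d} - {k}"
  have I: "finite I" "k \<notin> I" "{..<d} = insert k I" using assms(1) by (auto simp: I_def)
  have lI: "leb d = PiM (insert k I) (\<lambda>_. lborel)" by (simp add: leb_def I(3))
  have mf: "(\<lambda>y. f (x(k := y))) \<in> borel_measurable borel" if "x \<in> space (PiM I (\<lambda>_. lborel))" for x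
    using measurable_compose[OF measurable_component_update[OF that I(2)] f[unfolded lI]]
    by simp
  have "(\<integral>\<^sup>+x. f (x(k := a * x k + g x)) \<partial>leb d) =
     (\<integral>\<^sup>+x. (\<integral>\<^sup>+y. f (x(k := g x + a * y)) \<partial>lborel) \<partial>PiM I (\<lambda>_. lborel))"
    unfolding lI using measurable_compose[OF meas f, unfolded lI]
    by (subst lborel_prod.product_nn_integral_insert[OF I(1,2)]) (auto simp: g(2) add.commute)
  also have "\<dots> = (\<integral>\<^sup>+x. ennreal (1 / \<bar>a\<bar>) * (\<integral>\<^sup>+y. f (x(k := y)) \<partial>lborel) \<partial>PiM I (\<lambda>_. lborel))"
  proof (rule nn_integral_cong)
    fix x assume x: "x \<in> space (PiM I (\<lambda>_. lborel :: real measure))"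
    have "(\<integral>\<^sup>+y. f (x(k := y)) \<partial>lborel) = ennreal \<bar>a\<bar> * (\<integral>\<^sup>+y. f (x(k := g x + a * y)) \<partial>lborel)"
      by (rule nn_integral_real_affine[OF mf[OF x] assms(2)])
    thus "(\<integral>\<^sup>+y. f (x(k := g x + a * y)) \<partial>lborel) = ennreal (1 / \<bar>a\<bar>) * (\<integral>\<^sup>+y. f (x(k := y)) \<partial>lborel)"
      using assms(2) by (simp add: mult.assoc[symmetric] flip: ennreal_mult)
  qed
  also have "\<dots> = ennreal (1 / \<bar>a\<bar>) * (\<integral>\<^sup>+x. f x \<partial>leb d)"
    unfolding lI using f[unfolded lI]
    by (subst lborel_prod.product_nn_integral_insert[OF I(1,2)], simp)
       (intro nn_integral_cmult lborel_pair.borel_measurable_nn_integral, simp_all)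
  finally show "(\<integral>\<^sup>+x. f (x(k := a * x k + g x)) \<partial>leb d) = ennreal (1 / \<bar>a\<bar>) * (\<integral>\<^sup>+x. f x \<partial>leb d)" .
qed

lemma leb_scaling_ident: "leb_scaling d (\<lambda>x. x) 1"
  by (simp add: leb_scaling_def)

lemma leb_scaling_diagonal:
  assumes a: "\<And>i. i < d \<Longrightarrow> a i \<noteq> 0"
  shows "\<exists>c>0. leb_scaling d (\<lambda>x. \<lambda>i\<in>{..<d}. a i * x i + b i) c"
proof -
  define M where "M k x = (\<lambda>i\<in>{..<d}. if i < k then a i * x i + b i else x i)" for k :: nat and x :: "nat \<Rightarrow> real"
  have "\<exists>c>0. leb_scaling d (M k) c" if "k \<le> d" for k
    using that
  proof (induction k)
    case 0
    show ?case
      by (rule exI[of _ 1], rule conjI[OF zero_less_one], rule leb_scaling_cong[OF leb_scaling_ident])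
         (simp add: M_def Rd_def PiE_restrict)
  next
    case (Suc k)
    then obtain c where c: "c > 0" "leb_scaling d (M k) c" by auto
    have s: "leb_scaling d (\<lambda>x. x(k := a k * x k + b k)) (1 / \<bar>a k\<bar>)"
      by (rule leb_scaling_coordinate) (use Suc.prems a in auto)
    have "a k \<noteq> 0" using a Suc.prems by auto
    show ?case
      by (rule exI[of _ "1 / \<bar>a k\<bar> * c"], rule conjI, use c \<open>a k \<noteq> 0\<close> in simp,
          rule leb_scaling_cong[OF leb_scaling_compose[OF s c(2)]])
         (use c Suc.prems \<open>a k \<noteq> 0\<close> in \<open>auto simp: M_def fun_eq_iff less_Suc_eq\<close>)
  qed
  from this[of d] obtain c where "c > 0" "leb_scaling d (M d) c" by auto
  moreover have "M d = (\<lambda>x. \<lambda>i\<in>{..<d}. a i * x i + b i)" by (auto simp: M_def fun_eq_iff)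
  ultimately show ?thesis by auto
qed

text \<open>The coordinates are replaced one after the other, in place.\<close>

lemma leb_scaling_matvec:
  assumes R: "pos_def d R"
  shows "\<exists>c>0. leb_scaling d (matvec d R) c"
proof -
  define M where "M k x = (\<lambda>i\<in>{..<d}. if i < k then \<Sum>j<d. R i j * x j else x i)" for k :: nat and x :: "nat \<Rightarrow> real"
  have "\<exists>c>0. leb_scaling d (M k) c" if "k \<le> d" for k
    using that
  proof (induction k)
    case 0
    show ?case
      by (rule exI[of _ 1], rule conjI[OF zero_less_one], rule leb_scaling_cong[OF leb_scaling_ident])
         (simp add: M_def Rd_def PiE_restrict)
  next
    case (Suc k)
    then obtain c where c: "c > 0" "leb_scaling d (M k) c" by auto
    have k: "k < d" using Suc.prems by simp
    obtain w where w: "w k = 1" "\<forall>i>k. w i = 0" "\<forall>j<k. (\<Sum>i<d. w i * R i j) = 0" "(\<Sum>i<d. w i * R i k) \<noteq> 0"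
      using pos_def_elimination[OF R k] by blast
    define a where "a = (\<Sum>i<d. w i * R i k)"
    \<comment> \<open>Coordinates below \<open>k\<close> already hold entries of R x, those above
      \<open>k\<close> still hold x. Solving w^T R x = a x_k + (terms in later x_j) for (R x)_k
      gives this shear.\<close>
    define g where "g y = (\<Sum>j\<in>{k<..<d}. (\<Sum>i<d. w i * R i j) * y j) - (\<Sum>i<k. w i * y i)" for y :: "nat \<Rightarrow> real"
    have a: "a \<noteq> 0" using w by (simp add: a_def)
    have s: "leb_scaling d (\<lambda>x. x(k := a * x k + g x)) (1 / \<bar>a\<bar>)"
    proof (rule leb_scaling_coordinate[OF k a])
      show "g \<in> borel_measurable (leb d)" unfolding g_def by measurable
    qed (auto simp: g_def)
    have eq: "(M k x)(k := a * M k x k + g (M k x)) = M (Suc k) x" for x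
    proof -
      have split: "(\<Sum>i<d. f i) = (\<Sum>i<k. f i) + f k + (\<Sum>i\<in>{k<..<d}. f i)" for f :: "nat \<Rightarrow> real"
      proof -
        have "{..<d} = insert k ({..<k} \<union> {k<..<d})" using k by auto
        hence "(\<Sum>i<d. f i) = f k + (\<Sum>i\<in>{..<k} \<union> {k<..<d}. f i)" by simp
        also have "(\<Sum>i\<in>{..<k} \<union> {k<..<d}. f i) = (\<Sum>i<k. f i) + (\<Sum>i\<in>{k<..<d}. f i)"
          by (rule sum.union_disjoint) auto
        finally show ?thesis by simp
      qed
      have "(\<Sum>i<d. w i * (\<Sum>j<d. R i j * x j)) = (\<Sum>j<d. (\<Sum>i<d. w i * R i j) * x j)"
        unfolding sum_distrib_right sum_distrib_left by (subst sum.swap) (simp add: mult.assoc)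
      also have "\<dots> = a * x k + (\<Sum>j\<in>{k<..<d}. (\<Sum>i<d. w i * R i j) * x j)"
        using w(3) by (subst split) (simp add: a_def)
      finally have "(\<Sum>i<k. w i * (\<Sum>j<d. R i j * x j)) + (\<Sum>j<d. R k j * x j)
         = a * x k + (\<Sum>j\<in>{k<..<d}. (\<Sum>i<d. w i * R i j) * x j)"
        using w(1,2) by (subst (asm) split) simp
      moreover have "(\<Sum>i<k. w i * M k x i) = (\<Sum>i<k. w i * (\<Sum>j<d. R i j * x j))"
        using k by (intro sum.cong) (auto simp: M_def)
      moreover have "(\<Sum>j\<in>{k<..<d}. (\<Sum>i<d. w i * R i j) * M k x j) = (\<Sum>j\<in>{k<..<d}. (\<Sum>i<d. w i * R i j) * x j)"
        by (intro sum.cong) (auto simp: M_def)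
      ultimately have "a * M k x k + g (M k x) = (\<Sum>j<d. R k j * x j)"
        using k by (simp add: g_def) (simp add: M_def)
      thus ?thesis using k by (auto simp: M_def fun_eq_iff less_Suc_eq)
    qed
    show ?case
      by (rule exI[of _ "1 / \<bar>a\<bar> * c"], rule conjI, use c a in simp,
          rule leb_scaling_cong[OF leb_scaling_compose[OF s c(2)]]) (use c a eq in auto)
  qed
  from this[of d] obtain c where "c > 0" "leb_scaling d (M d) c" by auto
  moreover have "M d = matvec d R" by (auto simp: M_def matvec_def fun_eq_iff)
  ultimately show ?thesis by auto
qed

lemma leb_scaling_affine:
  assumes R: "pos_def d R"
  shows "\<exists>c>0. leb_scaling d (\<lambda>z. vadd d m (matvec d R z)) c"
proof -
  obtain c where c: "c > 0" "leb_scaling d (matvec d R) c" using leb_scaling_matvec[OF R] by auto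
  obtain c' where c': "c' > 0" "leb_scaling d (\<lambda>x. \<lambda>i\<in>{..<d}. 1 * x i + m i) c'"
    using leb_scaling_diagonal[of d "\<lambda>_. 1" m] by auto
  show ?thesis
    by (rule exI[of _ "c' * c"], rule conjI, use c c' in simp, rule leb_scaling_cong[OF leb_scaling_compose[OF c'(2) c(2)]])
       (use c c' in \<open>auto simp: vadd_def\<close>)
qed

section \<open>Gibbs and Gaussian measures as images of the standard Gaussian\<close>

lemma prob_space_stdg: "prob_space (stdg d)"
  unfolding stdg_def by (rule prob_space_PiM) (rule prob_space_gauss1)

lemma stdg_density:
  "stdg d = density (leb d) (\<lambda>x. ennreal ((1 / sqrt (2 * pi)) ^ d * exp (- ip d x x / 2)))"
proof -
  have dens: "(1 / sqrt (2 * pi)) ^ d * exp (- ip d x x / 2) = (\<Prod>i<d. std_normal_density (x i))" for x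
  proof -
    have "exp (- ip d x x / 2) = (\<Prod>i<d. exp (- (x i)\<^sup>2 / 2))"
      by (simp add: ip_def power2_eq_square sum_negf sum_divide_distrib flip: exp_sum)
    thus ?thesis by (simp add: std_normal_density_def prod_dividef power_one_over field_simps)
  qed
  show ?thesis unfolding stdg_def dens
  proof (rule gauss1.PiM_eqI[symmetric])
    show "sets (density (leb d) (\<lambda>x. ennreal (\<Prod>i<d. std_normal_density (x i)))) = sets (PiM {..<d} (\<lambda>_. gauss1))"
      using sets_stdg[of d] by (simp add: stdg_def)
    fix A :: "nat \<Rightarrow> real set" assume A: "\<And>i. i \<in> {..<d} \<Longrightarrow> A i \<in> sets gauss1"
    have "Pi\<^sub>E {..<d} A \<in> sets (leb d)" unfolding leb_def using A by (intro sets_PiM_I_finite) auto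
    hence "emeasure (density (leb d) (\<lambda>x. ennreal (\<Prod>i<d. std_normal_density (x i)))) (Pi\<^sub>E {..<d} A) =
      (\<integral>\<^sup>+x. ennreal (\<Prod>i<d. std_normal_density (x i)) * indicator (Pi\<^sub>E {..<d} A) x \<partial>leb d)"
      by (intro emeasure_density) auto
    also have "\<dots> = (\<integral>\<^sup>+x. (\<Prod>i<d. ennreal (std_normal_density (x i)) * indicator (A i) (x i)) \<partial>leb d)"
    proof (rule nn_integral_cong)
      fix x assume x: "x \<in> space (leb d)"
      have "indicator (Pi\<^sub>E {..<d} A) x = (\<Prod>i<d. indicator (A i) (x i) :: ennreal)"
      proof (cases "x \<in> Pi\<^sub>E {..<d} A")
        case False
        then obtain i where "i < d" "x i \<notin> A i" using x by (auto simp: space_leb Rd_def PiE_iff)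
        thus ?thesis using False by (auto simp: indicator_def intro!: prod_zero[symmetric])
      qed (auto simp: PiE_iff)
      thus "ennreal (\<Prod>i<d. std_normal_density (x i)) * indicator (Pi\<^sub>E {..<d} A) x
         = (\<Prod>i<d. ennreal (std_normal_density (x i)) * indicator (A i) (x i))"
        by (simp add: prod.distrib prod_ennreal)
    qed
    also have "\<dots> = (\<Prod>i<d. \<integral>\<^sup>+y. ennreal (std_normal_density y) * indicator (A i) y \<partial>lborel)"
      unfolding leb_def using A
      by (intro lborel_prod.product_nn_integral_prod) auto
    also have "\<dots> = (\<Prod>i<d. emeasure gauss1 (A i))"
      using A by (intro prod.cong refl) (simp add: emeasure_density)
    finally show "emeasure (density (leb d) (\<lambda>x. ennreal (\<Prod>i<d. std_normal_density (x i)))) (Pi\<^sub>E {..<d} A)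
      = (\<Prod>i<d. emeasure gauss1 (A i))" .
  qed (auto intro!: gauss1.sigma_finite)
qed

lemma measurable_ip [measurable]: "(\<lambda>x. ip d x x) \<in> borel_measurable (leb d)"
  unfolding ip_def by measurable

lemma measurable_stdg_eq: "measurable (stdg d) N = measurable (leb d) N"
  by (rule measurable_cong_sets) (auto simp: sets_stdg)

lemma nn_integral_stdg:
  assumes "f \<in> borel_measurable (leb d)"
  shows "(\<integral>\<^sup>+x. f x \<partial>stdg d) = ennreal ((1 / sqrt (2 * pi)) ^ d) * (\<integral>\<^sup>+x. ennreal (exp (- ip d x x / 2)) * f x \<partial>leb d)"
  unfolding stdg_density using assms
  by (subst nn_integral_density) (auto simp: ennreal_mult mult.assoc nn_integral_cmult)

text \<open>Pulled back along \<open>T\<close>, the unnormalised density is a multiple of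
  \<open>q\<close> times the Gaussian exponential. All constants collect in \<beta>, which occurs in
  the integral of \<open>F\<close> and in the normalising integral and therefore cancels.\<close>

lemma gibbs_pushforward:
  assumes T: "leb_scaling d T c" "c > 0"
    and D: "(\<lambda>x. indicator \<Theta> x * exp (- V x)) \<in> borel_measurable (leb d)"
    and q: "integrable (stdg d) q" "\<And>z. z \<in> Rd d \<Longrightarrow> 0 \<le> q z" "0 < (\<integral>z. q z \<partial>stdg d)"
    and eq: "\<And>z. z \<in> Rd d \<Longrightarrow> indicator \<Theta> (T z) * exp (- V (T z)) = b * (q z * exp (- ip d z z / 2))" and "b > 0"
    and F: "F \<in> borel_measurable (leb d)"
  shows "(\<integral>\<^sup>+x. F x \<partial>gibbs d \<Theta> V) = (\<integral>\<^sup>+z. F (T z) * ennreal (q z) \<partial>stdg d) / ennreal (\<integral>z. q z \<partial>stdg d)"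
proof -
  define D where "D x = indicator \<Theta> x * exp (- V x)" for x
  have [measurable]: "D \<in> borel_measurable (leb d)" using D by (simp add: D_def[abs_def])
  have [measurable]: "q \<in> borel_measurable (leb d)" using q(1) measurable_stdg_eq[of d borel] by auto
  define \<kappa> where "\<kappa> = (1 / sqrt (2 * pi)) ^ d"
  have \<kappa>: "\<kappa> > 0" by (simp add: \<kappa>_def)
  define \<beta> where "\<beta> = b / (c * \<kappa>)"
  have \<beta>: "\<beta> > 0" using assms \<kappa> by (simp add: \<beta>_def)
  have D0: "D x \<ge> 0" for x by (simp add: D_def)
  have *: "(\<integral>\<^sup>+x. G x * ennreal (D x) \<partial>leb d) = ennreal \<beta> * (\<integral>\<^sup>+z. G (T z) * ennreal (q z) \<partial>stdg d)"
    if G[measurable]: "G \<in> borel_measurable (leb d)" for G :: "_ \<Rightarrow> ennreal"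
  proof -
    have [measurable]: "T \<in> measurable (leb d) (leb d)" using T by (simp add: leb_scaling_def)
    have "ennreal c * (\<integral>\<^sup>+x. G x * ennreal (D x) \<partial>leb d) = (\<integral>\<^sup>+z. G (T z) * ennreal (D (T z)) \<partial>leb d)"
      by (rule leb_scalingD(2)[OF T(1), symmetric]) measurable
    also have "\<dots> = (\<integral>\<^sup>+z. ennreal b * (ennreal (exp (- ip d z z / 2)) * (G (T z) * ennreal (q z))) \<partial>leb d)"
      by (intro nn_integral_cong)
         (use eq q(2) \<open>b > 0\<close> in \<open>simp add: D_def space_leb ennreal_mult mult_ac\<close>)
    also have "\<dots> = ennreal b * (\<integral>\<^sup>+z. ennreal (exp (- ip d z z / 2)) * (G (T z) * ennreal (q z)) \<partial>leb d)"
      by (rule nn_integral_cmult) measurable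
    also have "\<dots> = ennreal (b / \<kappa>) * (ennreal \<kappa> * (\<integral>\<^sup>+z. ennreal (exp (- ip d z z / 2)) * (G (T z) * ennreal (q z)) \<partial>leb d))"
      using \<kappa> \<open>b > 0\<close> by (simp add: mult.assoc[symmetric] flip: ennreal_mult)
    also have "\<dots> = ennreal (b / \<kappa>) * (\<integral>\<^sup>+z. G (T z) * ennreal (q z) \<partial>stdg d)"
      unfolding \<kappa>_def by (subst nn_integral_stdg) auto
    finally have "ennreal (1 / c) * (ennreal c * (\<integral>\<^sup>+x. G x * ennreal (D x) \<partial>leb d))
      = ennreal (1 / c) * (ennreal (b / \<kappa>) * (\<integral>\<^sup>+z. G (T z) * ennreal (q z) \<partial>stdg d))" by simp
    thus ?thesis using \<open>c > 0\<close> \<open>b > 0\<close> \<kappa> by (simp add: mult.assoc[symmetric] \<beta>_def flip: ennreal_mult)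
  qed
  define Q where "Q = (\<integral>z. q z \<partial>stdg d)"
  have Qn: "(\<integral>\<^sup>+z. ennreal (q z) \<partial>stdg d) = ennreal Q"
    unfolding Q_def using q(1,2) by (intro nn_integral_eq_integral) (auto simp: space_stdg)
  have "(\<integral>\<^sup>+x. ennreal (D x) \<partial>leb d) = ennreal (\<beta> * Q)"
    using *[of "\<lambda>_. 1"] Qn \<beta> q(3) by (simp add: ennreal_mult Q_def)
  hence Z: "(\<integral>x. D x \<partial>leb d) = \<beta> * Q"
    using \<beta> q(3) D0 by (subst integral_eq_nn_integral) (auto simp: Q_def)
  have "(\<integral>\<^sup>+x. F x \<partial>gibbs d \<Theta> V) = (\<integral>\<^sup>+x. ennreal (1 / (\<beta> * Q)) * (F x * ennreal (D x)) \<partial>leb d)"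
    unfolding gibbs_def D_def[symmetric] Z using F \<beta> q(3) D0
    by (subst nn_integral_density) (auto simp: Q_def mult_ac field_simps simp flip: ennreal_mult intro!: nn_integral_cong)
  also have "\<dots> = ennreal (1 / (\<beta> * Q)) * (ennreal \<beta> * (\<integral>\<^sup>+z. F (T z) * ennreal (q z) \<partial>stdg d))"
    using F by (subst nn_integral_cmult) (auto simp: *)
  also have "\<dots> = (\<integral>\<^sup>+z. F (T z) * ennreal (q z) \<partial>stdg d) / ennreal Q"
    using \<beta> q(3) by (simp add: mult.assoc[symmetric] Q_def divide_ennreal_def inverse_ennreal mult.commute inverse_eq_divide flip: ennreal_mult)
  finally show ?thesis unfolding Q_def .
qed

lemma gibbs_measure_eq:
  assumes T: "leb_scaling d T c" "c > 0"
    and D: "(\<lambda>x. indicator \<Theta> x * exp (- V x)) \<in> borel_measurable (leb d)"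
    and q: "integrable (stdg d) q" "\<And>z. z \<in> Rd d \<Longrightarrow> 0 \<le> q z" "0 < (\<integral>z. q z \<partial>stdg d)"
    and eq: "\<And>z. z \<in> Rd d \<Longrightarrow> indicator \<Theta> (T z) * exp (- V (T z)) = b * (q z * exp (- ip d z z / 2))" and "b > 0"
    and A: "A \<in> sets (leb d)"
  shows "measure (gibbs d \<Theta> V) A = (\<integral>z. indicator A (T z) * q z \<partial>stdg d) / (\<integral>z. q z \<partial>stdg d)"
proof -
  have sg: "sets (gibbs d \<Theta> V) = sets (leb d)" by (simp add: gibbs_def)
  have [measurable]: "T \<in> measurable (stdg d) (leb d)" using T by (simp add: leb_scaling_def measurable_stdg_eq)
  have nn: "0 \<le> (\<integral>z. indicator A (T z) * q z \<partial>stdg d)"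
    using q(2) by (intro Bochner_Integration.integral_nonneg) (auto simp: space_stdg)
  have "emeasure (gibbs d \<Theta> V) A = (\<integral>\<^sup>+z. indicator A (T z) * ennreal (q z) \<partial>stdg d) / ennreal (\<integral>z. q z \<partial>stdg d)"
    using gibbs_pushforward[OF T D q eq \<open>b > 0\<close>, of "indicator A"] A sg by simp
  also have "(\<integral>\<^sup>+z. indicator A (T z) * ennreal (q z) \<partial>stdg d) = ennreal (\<integral>z. indicator A (T z) * q z \<partial>stdg d)"
  proof (subst nn_integral_eq_integral[symmetric])
    show "integrable (stdg d) (\<lambda>z. indicator A (T z) * q z)"
    proof (rule Bochner_Integration.integrable_bound[OF q(1)])
      have [measurable]: "q \<in> borel_measurable (stdg d)" using q(1) by simp
      show "(\<lambda>z. indicator A (T z) * q z) \<in> borel_measurable (stdg d)" using A by measurable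
    qed (auto simp: indicator_def)
  qed (use q(2) in \<open>auto simp: space_stdg indicator_def intro!: nn_integral_cong\<close>)
  finally show ?thesis unfolding measure_def
    using q(3) nn by (simp add: divide_ennreal)
qed

lemma quad_form_matvec_inv_sqrt:
  assumes "pos_def d H" "is_inv_sqrt d H R"
  shows "quad_form d H (matvec d R z) = ip d z z"
proof -
  have pR: "pos_def d R" using assms by (simp add: is_inv_sqrt_def)
  have "quad_form d H (matvec d R z) = ip d (\<lambda>i. \<Sum>j<d. R i j * z j) (\<lambda>i. \<Sum>j<d. H i j * (\<Sum>k<d. R j k * z k))"
    unfolding quad_form_ip by (rule ip_cong) (auto simp: matvec_def)
  also have "\<dots> = ip d z (\<lambda>i. \<Sum>j<d. R i j * (\<Sum>k<d. H j k * (\<Sum>l<d. R k l * z l)))"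
    by (rule ip_matvec_sym[symmetric]) (rule pos_def_sym[OF pR])
  also have "\<dots> = ip d z (\<lambda>i. \<Sum>l<d. mm d R (mm d H R) i l * z l)"
  proof (rule ip_cong)
    fix i
    have "(\<Sum>j<d. R i j * (\<Sum>k<d. H j k * (\<Sum>l<d. R k l * z l))) = (\<Sum>j<d. \<Sum>k<d. \<Sum>l<d. R i j * H j k * R k l * z l)"
      by (simp add: sum_distrib_left mult.assoc)
    also have "\<dots> = (\<Sum>j<d. \<Sum>l<d. \<Sum>k<d. R i j * H j k * R k l * z l)"
      by (intro sum.cong refl sum.swap)
    also have "\<dots> = (\<Sum>l<d. \<Sum>j<d. \<Sum>k<d. R i j * H j k * R k l * z l)" by (rule sum.swap)
    finally show "(\<Sum>j<d. R i j * (\<Sum>k<d. H j k * (\<Sum>l<d. R k l * z l))) = (\<Sum>l<d. mm d R (mm d H R) i l * z l)"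
      by (simp add: mm_def sum_distrib_left sum_distrib_right mult.assoc)
  qed simp
  also have "\<dots> = ip d z z"
    using is_inv_sqrt_conj[OF assms]
    by (intro ip_cong) (auto simp: meq_def ident_def if_distrib[of "\<lambda>t. t * _"] cong: if_cong)
  finally show ?thesis .
qed

lemma measurable_vsub [measurable]: "(\<lambda>x. vsub d x m) \<in> measurable (leb d) (leb d)"
  by (rule measurable_into_leb) (auto simp: vsub_def Rd_def)

lemma measurable_quad_form [measurable]: "quad_form d H \<in> borel_measurable (leb d)"
  unfolding quad_form_def[abs_def] by measurable

text \<open>The pushforward formula with constant \<open>q\<close>: whitening turns the quadratic
  form into \<open>ip d z z\<close>.\<close>

lemma gaussian_eq_distr:
  assumes H: "pos_def d H" and R: "is_inv_sqrt d H R"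
  shows "gaussian d m H = distr (stdg d) (leb d) (\<lambda>z. vadd d m (matvec d R z))"
proof -
  let ?T = "\<lambda>z. vadd d m (matvec d R z)"
  have pR: "pos_def d R" using R by (simp add: is_inv_sqrt_def)
  obtain c where c: "c > 0" "leb_scaling d ?T c" using leb_scaling_affine[OF pR] by auto
  interpret prob_space "stdg d" by (rule prob_space_stdg)
  have mT: "?T \<in> measurable (stdg d) (leb d)" using c by (simp add: leb_scaling_def measurable_stdg_eq)
  have sub: "quad_form d H (vsub d (?T z) m) = ip d z z" if "z \<in> Rd d" for z
  proof -
    have "vsub d (?T z) m = matvec d R z" by (auto simp: vsub_def vadd_def matvec_def fun_eq_iff)
    thus ?thesis by (simp add: quad_form_matvec_inv_sqrt[OF H R])
  qed
  have TR: "?T z \<in> Rd d" for z by (auto simp: vadd_def Rd_def)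
  show ?thesis
  proof (rule measure_eqI)
    fix A assume "A \<in> sets (gaussian d m H)"
    hence A: "A \<in> sets (leb d)" by (simp add: gaussian_def gibbs_def)
    have "emeasure (gaussian d m H) A = (\<integral>\<^sup>+x. indicator A x \<partial>gibbs d (Rd d) (\<lambda>x. quad_form d H (vsub d x m) / 2))"
      using A by (simp add: gaussian_def gibbs_def)
    also have "\<dots> = (\<integral>\<^sup>+z. indicator A (?T z) * ennreal 1 \<partial>stdg d) / ennreal (\<integral>z. 1 \<partial>stdg d)"
    proof (rule gibbs_pushforward[OF c(2,1), where b = 1])
      have "(\<lambda>x. exp (- (quad_form d H (vsub d x m) / 2))) \<in> borel_measurable (leb d)"
        by measurable
      thus "(\<lambda>x. indicator (Rd d) x * exp (- (quad_form d H (vsub d x m) / 2))) \<in> borel_measurable (leb d)"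
        by (subst measurable_cong[of _ _ "\<lambda>x. exp (- (quad_form d H (vsub d x m) / 2))"]) (auto simp: space_leb)
    qed (use A TR sub in \<open>auto simp: prob_space\<close>)
    also have "\<dots> = emeasure (distr (stdg d) (leb d) ?T) A"
      using A mT by (simp add: prob_space divide_ennreal_def nn_integral_indicator[symmetric] nn_integral_distr del: nn_integral_indicator)
    finally show "emeasure (gaussian d m H) A = emeasure (distr (stdg d) (leb d) ?T) A" .
  qed (simp add: gaussian_def gibbs_def)
qed

lemma pos_def_ident: "pos_def d ident"
proof -
  have "quad_form d ident u = ip d u u" for u
    by (simp add: quad_form_ip ident_def if_distrib[of "\<lambda>t. t * _"] cong: if_cong) (simp add: ip_def)
  thus ?thesis unfolding pos_def_def
    using ip_self_nonneg[of d] ip_self_eq_0[of d]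
    by (auto simp: ident_def vzero_def Rd_def fun_eq_iff PiE_iff extensional_def less_le restrict_def)
qed

lemma gaussian_ident: "gaussian d (vzero d) ident = stdg d"
proof -
  have "is_inv_sqrt d ident ident"
    using mm_ident(1) mm_cong[OF meq_refl mm_ident(1)] meq_trans pos_def_ident
    unfolding is_inv_sqrt_def by blast
  hence "gaussian d (vzero d) ident = distr (stdg d) (leb d) (\<lambda>z. vadd d (vzero d) (matvec d ident z))"
    by (rule gaussian_eq_distr[OF pos_def_ident])
  also have "\<dots> = distr (stdg d) (stdg d) (\<lambda>z. z)"
  proof (rule distr_cong)
    fix z assume "z \<in> space (stdg d)"
    thus "vadd d (vzero d) (matvec d ident z) = z"
      by (auto simp: space_stdg vadd_def vzero_def matvec_def ident_def Rd_def fun_eq_iff PiE_iff extensional_def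
        if_distrib[of "\<lambda>t. t * _"] cong: if_cong)
  qed (auto simp: sets_stdg)
  finally show ?thesis by (simp add: distr_id2)
qed

lemma distr_stdg_neg: "distr (stdg d) (stdg d) (\<lambda>z. \<lambda>i\<in>{..<d}. - z i) = stdg d"
proof -
  let ?N = "\<lambda>z. \<lambda>i\<in>{..<d}. - z i :: real"
  obtain c where c: "c > 0" "leb_scaling d (\<lambda>x. \<lambda>i\<in>{..<d}. -1 * x i + 0) c"
    using leb_scaling_diagonal[of d "\<lambda>_. -1" "\<lambda>_. 0"] by auto
  hence N: "leb_scaling d ?N c" by simp
  interpret prob_space "stdg d" by (rule prob_space_stdg)
  have mN: "?N \<in> measurable (stdg d) (stdg d)"
    using N sets_stdg[of d] by (auto simp: leb_scaling_def measurable_stdg_eq cong: measurable_cong_sets)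
  have *: "(\<integral>\<^sup>+z. f (?N z) \<partial>stdg d) = ennreal c * (\<integral>\<^sup>+z. f z \<partial>stdg d)" if f: "f \<in> borel_measurable (leb d)" for f
  proof -
    have ipN: "ip d (?N z) (?N z) = ip d z z" for z by (simp add: ip_def)
    have m: "(\<lambda>z. f (?N z)) \<in> borel_measurable (leb d)"
      using N f by (auto simp: leb_scaling_def intro: measurable_compose)
    have "(\<integral>\<^sup>+x. ennreal (exp (- ip d (?N x) (?N x) / 2)) * f (?N x) \<partial>leb d) = ennreal c * (\<integral>\<^sup>+x. ennreal (exp (- ip d x x / 2)) * f x \<partial>leb d)"
    proof -
      have "(\<lambda>x. ennreal (exp (- ip d x x / 2)) * f x) \<in> borel_measurable (leb d)" using f by measurable
      from leb_scalingD(2)[OF N this] show ?thesis .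
    qed
    thus ?thesis unfolding nn_integral_stdg[OF m] nn_integral_stdg[OF f] by (simp add: ipN mult_ac)
  qed
  \<comment> \<open>The scaling constant of the reflection is found by testing with the constant 1,
    as \<open>stdg d\<close> has mass 1.\<close>
  have "ennreal c = 1" using *[of "\<lambda>_. 1"] by (simp add: emeasure_space_1)
  show ?thesis
  proof (rule measure_eqI)
    fix A assume "A \<in> sets (distr (stdg d) (stdg d) ?N)"
    hence A: "A \<in> sets (stdg d)" "A \<in> sets (leb d)" by (auto simp: sets_stdg)
    have "emeasure (distr (stdg d) (stdg d) ?N) A = (\<integral>\<^sup>+z. indicator A (?N z) \<partial>stdg d)"
      using A mN by (simp add: nn_integral_indicator[symmetric] nn_integral_distr del: nn_integral_indicator)
    also have "\<dots> = emeasure (stdg d) A" using *[of "indicator A"] A \<open>ennreal c = 1\<close> by simp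
    finally show "emeasure (distr (stdg d) (stdg d) ?N) A = emeasure (stdg d) A" .
  qed simp
qed

section \<open>Gaussian moments and tails\<close>

definition nrm :: "nat \<Rightarrow> (nat \<Rightarrow> real) \<Rightarrow> real" where
  "nrm d x = sqrt (ip d x x)"

lemma nrm_nonneg [simp]: "0 \<le> nrm d x" by (simp add: nrm_def ip_self_nonneg)
lemma nrm_sq: "(nrm d x)\<^sup>2 = ip d x x" by (simp add: nrm_def ip_self_nonneg)
lemma measurable_nrm [measurable]: "nrm d \<in> borel_measurable (leb d)"
  unfolding nrm_def[abs_def] by measurable

lemma nn_integral_Cauchy_Schwarz_le:
  fixes f g :: "'a \<Rightarrow> real"
  assumes [measurable]: "f \<in> borel_measurable M" "g \<in> borel_measurable M"
    and f: "(\<integral>\<^sup>+x. ennreal ((f x)\<^sup>2) \<partial>M) \<le> ennreal (a\<^sup>2)" and g: "(\<integral>\<^sup>+x. ennreal ((g x)\<^sup>2) \<partial>M) \<le> ennreal (b\<^sup>2)"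
    and "0 \<le> a" "0 \<le> b"
  shows "(\<integral>\<^sup>+x. ennreal (\<bar>f x * g x\<bar>) \<partial>M) \<le> ennreal (a * b)"
proof -
  define I where "I = (\<integral>\<^sup>+x. ennreal (\<bar>f x * g x\<bar>) \<partial>M)"
  have "I\<^sup>2 = (\<integral>\<^sup>+x. ennreal \<bar>f x\<bar> * ennreal \<bar>g x\<bar> \<partial>M)\<^sup>2"
    by (simp add: I_def abs_mult ennreal_mult)
  also have "\<dots> \<le> (\<integral>\<^sup>+x. ennreal \<bar>f x\<bar> ^ 2 \<partial>M) * (\<integral>\<^sup>+x. ennreal \<bar>g x\<bar> ^ 2 \<partial>M)"
    by (rule Cauchy_Schwarz_nn_integral) measurable
  also have "\<dots> \<le> ennreal (a\<^sup>2) * ennreal (b\<^sup>2)"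
    using f g by (intro mult_mono) (auto simp: ennreal_power)
  also have "\<dots> = ennreal ((a * b)\<^sup>2)" by (simp add: power_mult_distrib flip: ennreal_mult)
  finally have le: "I\<^sup>2 \<le> ennreal ((a * b)\<^sup>2)" .
  have "I \<noteq> \<infinity>"
  proof
    assume "I = \<infinity>"
    hence "I\<^sup>2 = top" by (simp add: power2_eq_square)
    thus False using le by (simp add: top_unique)
  qed
  then obtain r where r: "I = ennreal r" "r \<ge> 0" by (cases I) auto
  hence "ennreal (r\<^sup>2) \<le> ennreal ((a * b)\<^sup>2)" using le by (simp only: ennreal_power)
  hence "r\<^sup>2 \<le> (a * b)\<^sup>2" by (subst (asm) ennreal_le_iff) simp_all
  hence "r \<le> a * b" by (rule power2_le_imp_le) (use assms(5,6) in simp)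
  thus ?thesis using r by (simp add: I_def ennreal_leI)
qed

lemma nn_integral_gauss1_exp_sq: "(\<integral>\<^sup>+x. ennreal (exp (x\<^sup>2 / 4)) \<partial>gauss1) = ennreal (sqrt 2)"
proof -
  have eq: "std_normal_density x * exp (x\<^sup>2 / 4) = sqrt 2 * normal_density 0 (sqrt 2) x" for x :: real
  proof -
    have "exp (- x\<^sup>2 / 2) * exp (x\<^sup>2 / 4) = exp (- x\<^sup>2 / 4)" by (simp flip: exp_add)
    thus ?thesis by (simp add: normal_density_def real_sqrt_mult field_simps)
  qed
  have n: "(\<integral>\<^sup>+w. ennreal (normal_density 0 (sqrt 2) w) \<partial>lborel) = 1"
    using prob_space.emeasure_space_1[OF prob_space_normal_density[of "sqrt 2" 0]]
    by (simp add: emeasure_density)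
  have "(\<integral>\<^sup>+x. ennreal (exp (x\<^sup>2 / 4)) \<partial>gauss1) = (\<integral>\<^sup>+x. ennreal (sqrt 2) * ennreal (normal_density 0 (sqrt 2) x) \<partial>lborel)"
    by (subst nn_integral_density) (auto simp: eq simp flip: ennreal_mult intro!: nn_integral_cong)
  also have "\<dots> = ennreal (sqrt 2)" using n by (subst nn_integral_cmult) auto
  finally show ?thesis .
qed

lemma nn_integral_stdg_prod:
  assumes "\<And>i. i < d \<Longrightarrow> f i \<in> borel_measurable borel"
  shows "(\<integral>\<^sup>+x. (\<Prod>i<d. f i (x i)) \<partial>stdg d) = (\<Prod>i<d. \<integral>\<^sup>+x. f i x \<partial>gauss1)"
  unfolding stdg_def by (rule gauss1.product_nn_integral_prod) (use assms in auto)

lemma nn_integral_stdg_exp_ip: "(\<integral>\<^sup>+x. ennreal (exp (ip d x x / 4)) \<partial>stdg d) = ennreal (sqrt 2 ^ d)"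
proof -
  have "ennreal (exp (ip d x x / 4)) = (\<Prod>i<d. ennreal (exp ((x i)\<^sup>2 / 4)))" for x
    by (simp add: ip_def power2_eq_square sum_divide_distrib exp_sum prod_ennreal)
  thus ?thesis
    by (simp add: nn_integral_stdg_prod[where f="\<lambda>_ x. ennreal (exp (x\<^sup>2 / 4))"] nn_integral_gauss1_exp_sq ennreal_power)
qed

lemma sqrt_2_power_le_exp: "sqrt 2 ^ d \<le> exp (real d / 2)"
proof -
  have "sqrt 2 = exp (ln 2 / 2)" by (simp add: ln_sqrt[symmetric])
  also have "\<dots> \<le> exp (1 / 2)" using ln_2_less_1 by simp
  finally have "sqrt 2 ^ d \<le> exp (1/2) ^ d" by (intro power_mono) auto
  thus ?thesis by (simp add: exp_of_nat_mult[symmetric])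
qed

text \<open>Chernoff's bound at exponent 1/4: beyond \<open>r\<close>, a |x|^2 is at most |x|^2 / 4
  - (1/4 - a) r, and the mean of exp (|x|^2 / 4) is 2^(d/2), at most exp (d/2).\<close>

lemma stdg_exp_tail:
  assumes "a \<le> 1 / 4"
  shows "(\<integral>\<^sup>+x. indicator {x. r < ip d x x} x * ennreal (exp (a * ip d x x)) \<partial>stdg d)
    \<le> ennreal (exp (real d / 2 - (1/4 - a) * r))"
proof -
  have "(\<integral>\<^sup>+x. indicator {x. r < ip d x x} x * ennreal (exp (a * ip d x x)) \<partial>stdg d)
    \<le> (\<integral>\<^sup>+x. ennreal (exp (- ((1/4 - a) * r))) * ennreal (exp (ip d x x / 4)) \<partial>stdg d)"
  proof (rule nn_integral_mono)
    fix x
    have "exp (a * ip d x x) \<le> exp (- ((1/4 - a) * r)) * exp (ip d x x / 4)" if "r < ip d x x"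
    proof -
      have "(1/4 - a) * r \<le> (1/4 - a) * ip d x x" using that assms by (intro mult_left_mono) auto
      thus ?thesis by (simp add: exp_add[symmetric] algebra_simps)
    qed
    thus "indicator {x. r < ip d x x} x * ennreal (exp (a * ip d x x))
      \<le> ennreal (exp (- ((1/4 - a) * r))) * ennreal (exp (ip d x x / 4))"
      by (auto simp: indicator_def simp flip: ennreal_mult intro!: ennreal_leI)
  qed
  also have "\<dots> = ennreal (exp (- ((1/4 - a) * r)) * sqrt 2 ^ d)"
    by (subst nn_integral_cmult) (auto simp: measurable_stdg_eq nn_integral_stdg_exp_ip ennreal_mult)
  also have "\<dots> \<le> ennreal (exp (- ((1/4 - a) * r)) * exp (real d / 2))"
    by (intro ennreal_leI mult_left_mono sqrt_2_power_le_exp) auto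
  also have "exp (- ((1/4 - a) * r)) * exp (real d / 2) = exp (real d / 2 - (1/4 - a) * r)"
    by (simp flip: exp_add)
  finally show ?thesis .
qed

lemma nn_integral_stdg_coord:
  assumes "i < d" "f \<in> borel_measurable borel"
  shows "(\<integral>\<^sup>+x. f (x i) \<partial>stdg d) = (\<integral>\<^sup>+x. f x \<partial>gauss1)"
proof -
  interpret prob_space gauss1 by (rule prob_space_gauss1)
  have "(\<integral>\<^sup>+x. f (x i) \<partial>stdg d) = (\<integral>\<^sup>+x. (\<Prod>j<d. if j = i then f (x j) else 1) \<partial>stdg d)"
    using assms(1) by (simp add: prod.delta)
  also have "\<dots> = (\<Prod>j<d. \<integral>\<^sup>+y. (if j = i then f y else 1) \<partial>gauss1)"
  proof (rule nn_integral_stdg_prod[where f="\<lambda>j y. if j = i then f y else 1"])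
    show "(\<lambda>y. if j = i then f y else 1) \<in> borel_measurable borel" for j
      using assms(2) by (cases "j = i") auto
  qed
  also have "\<dots> = (\<Prod>j<d. if j = i then (\<integral>\<^sup>+x. f x \<partial>gauss1) else 1)"
    using emeasure_space_1 by (intro prod.cong refl) auto
  also have "\<dots> = (\<integral>\<^sup>+x. f x \<partial>gauss1)" using assms(1) by (simp add: prod.delta)
  finally show ?thesis .
qed

lemma ip_power4_le: "(ip d x x) ^ 4 \<le> real d ^ 3 * (\<Sum>i<d. x i ^ 8)"
proof -
  have 1: "(\<Sum>i<d. a i)\<^sup>2 \<le> real d * (\<Sum>i<d. (a i)\<^sup>2)" for a :: "nat \<Rightarrow> real"
    using sum_squared_le_sum_of_squares[of a "{..<d}"] by (simp add: mult.commute)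
  have a2: "(ip d x x)\<^sup>2 \<le> real d * (\<Sum>i<d. x i ^ 4)"
    using 1[of "\<lambda>i. x i * x i"] by (simp add: ip_def power4_eq_xxxx power2_eq_square mult.assoc)
  have "((ip d x x)\<^sup>2)\<^sup>2 \<le> (real d * (\<Sum>i<d. x i ^ 4))\<^sup>2"
    by (rule power_mono[OF a2]) simp
  also have "\<dots> \<le> (real d)\<^sup>2 * (real d * (\<Sum>i<d. (x i ^ 4)\<^sup>2))"
    unfolding power_mult_distrib by (intro mult_left_mono 1) auto
  finally have "((ip d x x)\<^sup>2)\<^sup>2 \<le> real d ^ 3 * (\<Sum>i<d. (x i ^ 4)\<^sup>2)"
    by (simp add: power2_eq_square power3_eq_cube mult.assoc)
  moreover have "((ip d x x)\<^sup>2)\<^sup>2 = ip d x x ^ 4" "(x i ^ 4)\<^sup>2 = x i ^ 8" for i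
    by (simp_all flip: power_mult)
  ultimately show ?thesis by simp
qed

text \<open>105 = 1 * 3 * 5 * 7 is the eighth moment of a standard normal variable. The order d^4 is
  what compensates the factor 1/d^2 in the fourth-order remainder after Cauchy-Schwarz.\<close>

lemma stdg_ip_power4: "(\<integral>\<^sup>+x. ennreal ((ip d x x) ^ 4) \<partial>stdg d) \<le> ennreal (105 * real d ^ 4)"
proof -
  have m: "(\<integral>\<^sup>+x. ennreal (x ^ 8) \<partial>gauss1) = ennreal 105"
  proof -
    have "(\<integral>\<^sup>+x. ennreal (x ^ 8) \<partial>gauss1) = (\<integral>\<^sup>+x. ennreal (std_normal_density x * x ^ (2 * 4)) \<partial>lborel)"
      by (subst nn_integral_density) (auto simp: ennreal_mult)
    also have "\<dots> = ennreal (fact (2 * 4) / (2 ^ 4 * fact 4))"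
    proof (subst nn_integral_eq_integral)
      show "integrable lborel (\<lambda>x. std_normal_density x * x ^ (2 * 4))"
        using std_normal_moment_even[of 4] by (rule integrable.intros)
      show "AE x in lborel. 0 \<le> std_normal_density x * x ^ (2 * 4)" by simp
    qed (simp only: integral_std_normal_moment_even)
    also have "fact (2 * 4) / (2 ^ 4 * fact 4) = (105 :: real)" by (simp add: fact_numeral)
    finally show ?thesis .
  qed
  have "(\<integral>\<^sup>+x. ennreal ((ip d x x) ^ 4) \<partial>stdg d) \<le> (\<integral>\<^sup>+x. ennreal (real d ^ 3) * (\<Sum>i<d. ennreal (x i ^ 8)) \<partial>stdg d)"
    using ip_power4_le by (intro nn_integral_mono) (auto simp: sum_nonneg simp flip: ennreal_mult intro!: ennreal_leI)
  also have "\<dots> = ennreal (real d ^ 3) * (\<Sum>i<d. \<integral>\<^sup>+x. ennreal (x i ^ 8) \<partial>stdg d)"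
    by (subst nn_integral_cmult, simp add: measurable_stdg_eq)
       (subst nn_integral_sum, simp_all add: measurable_stdg_eq)
  also have "(\<Sum>i<d. \<integral>\<^sup>+x. ennreal (x i ^ 8) \<partial>stdg d) = (\<Sum>i<d. ennreal 105)"
    using m by (intro sum.cong refl) (subst nn_integral_stdg_coord, auto)
  also have "\<dots> = ennreal (\<Sum>i<d. 105)" by (rule sum_ennreal) simp
  also have "ennreal (real d ^ 3) * \<dots> = ennreal (105 * real d ^ 4)"
    by (subst ennreal_mult[symmetric]) (simp_all add: power4_eq_xxxx power3_eq_cube)
  finally show ?thesis .
qed

lemma sum_abs_le_nrm: "(\<Sum>i<d. \<bar>x i\<bar>) \<le> sqrt (real d) * nrm d x"
proof -
  have "(\<Sum>i<d. \<bar>x i\<bar>)\<^sup>2 \<le> real d * ip d x x"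
    using sum_squared_le_sum_of_squares[of "\<lambda>i. \<bar>x i\<bar>" "{..<d}"]
    by (simp add: mult.commute ip_def power2_eq_square)
  also have "\<dots> = (sqrt (real d) * nrm d x)\<^sup>2" by (simp add: power_mult_distrib nrm_sq)
  finally show ?thesis by (rule power2_le_imp_le) simp
qed

lemma nn_integral_exp_abs:
  assumes "b > 0" shows "(\<integral>\<^sup>+x. ennreal (exp (- (b * \<bar>x\<bar>))) \<partial>lborel) \<le> ennreal (2 / b)"
proof -
  let ?e = "\<lambda>x::real. ennreal (exponential_density b x)"
  have e: "(\<integral>\<^sup>+x. ?e x \<partial>lborel) = 1"
    using prob_space.emeasure_space_1[OF prob_space_exponential_density[OF assms]]
    by (simp add: emeasure_density)
  have e': "(\<integral>\<^sup>+x. ?e (- x) \<partial>lborel) = 1"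
    using nn_integral_real_affine[of ?e "-1" 0] e by simp
  have ed0: "exponential_density b x \<ge> 0" for x using assms by (simp add: exponential_density_def)
  have "(\<integral>\<^sup>+x. ennreal (exp (- (b * \<bar>x\<bar>))) \<partial>lborel) \<le> (\<integral>\<^sup>+x. ennreal (1 / b) * (?e x + ?e (- x)) \<partial>lborel)"
  proof (rule nn_integral_mono)
    fix x :: real
    have "exp (- (b * \<bar>x\<bar>)) \<le> 1 / b * (exponential_density b x + exponential_density b (- x))"
      using assms by (auto simp: exponential_density_def field_simps)
    thus "ennreal (exp (- (b * \<bar>x\<bar>))) \<le> ennreal (1 / b) * (?e x + ?e (- x))"
      using assms ed0 by (simp flip: ennreal_plus ennreal_mult add: ennreal_leI)
  qed
  also have "\<dots> = ennreal (1 / b) * (1 + 1)"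
    by (subst nn_integral_cmult, simp, subst nn_integral_add) (simp_all add: e e')
  also have "\<dots> = ennreal (2 / b)" using assms
    by (simp add: mult_2_right flip: ennreal_plus)
  finally show ?thesis .
qed

lemma exp_abs_bound: "\<bar>exp x - 1\<bar> \<le> \<bar>x\<bar> * exp \<bar>x\<bar>" for x :: real
proof -
  obtain t where t: "\<bar>t\<bar> \<le> \<bar>x\<bar>" "exp x = 1 + exp t * x" using Maclaurin_exp_le[of x 1] by auto
  have "exp t \<le> exp \<bar>x\<bar>" using t(1) by simp
  thus ?thesis using t(2) by (simp add: abs_mult mult.commute mult_left_mono)
qed

lemma exp_quadratic_bound: "\<bar>exp x - 1 - x\<bar> \<le> x\<^sup>2 / 2 * exp \<bar>x\<bar>" for x :: real
proof -
  obtain t where t: "\<bar>t\<bar> \<le> \<bar>x\<bar>" "exp x = 1 + x + exp t / 2 * x\<^sup>2"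
    using Maclaurin_exp_le[of x 2] by (auto simp: numeral_2_eq_2)
  have "exp t \<le> exp \<bar>x\<bar>" using t(1) by simp
  hence "exp t * x\<^sup>2 \<le> exp \<bar>x\<bar> * x\<^sup>2" by (rule mult_right_mono) simp
  thus ?thesis using t(2) by (simp add: mult.commute)
qed

lemma power_le_fact_exp: "0 \<le> x \<Longrightarrow> x ^ n \<le> fact n * exp x" for x :: real
proof -
  assume x: "0 \<le> x"
  obtain t where t: "exp x = (\<Sum>m<Suc n. (x ^ m) / fact m) + (exp t / fact (Suc n)) * x ^ Suc n"
    using Maclaurin_exp_le[of x "Suc n"] by blast
  have "x ^ n / fact n \<le> exp x" unfolding t using x
    by (auto intro!: add_nonneg_nonneg sum_nonneg)
  thus ?thesis by (simp add: field_simps)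
qed

section \<open>Exponential moments of odd Lipschitz functions\<close>

lemma nn_integral_stdg_neg:
  assumes "f \<in> borel_measurable (leb d)"
  shows "(\<integral>\<^sup>+z. f (\<lambda>i\<in>{..<d}. - z i) \<partial>stdg d) = (\<integral>\<^sup>+z. f z \<partial>stdg d)"
proof -
  have "(\<lambda>z. \<lambda>i\<in>{..<d}. - z i) \<in> measurable (leb d) (leb d)"
    by (rule measurable_into_leb) (auto simp: Rd_def)
  hence "(\<lambda>z. \<lambda>i\<in>{..<d}. - z i) \<in> measurable (stdg d) (stdg d)"
    using sets_stdg[of d] by (simp add: measurable_stdg_eq cong: measurable_cong_sets)
  hence "(\<integral>\<^sup>+z. f z \<partial>distr (stdg d) (stdg d) (\<lambda>z. \<lambda>i\<in>{..<d}. - z i)) = (\<integral>\<^sup>+z. f (\<lambda>i\<in>{..<d}. - z i) \<partial>stdg d)"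
    using assms by (intro nn_integral_distr) (auto simp: measurable_stdg_eq)
  thus ?thesis by (simp add: distr_stdg_neg)
qed

text \<open>Both functions vanish off the ball, so the transport condition has content only for
  pairs inside it, where \<open>f\<close> is Lipschitz. By oddness and reflection both integrals
  equal \<open>X\<close>, up to the factor \<open>e\<close>, so \<open>e * X * X\<close> is at most
  1.\<close>

lemma odd_lipschitz_exp_moment:
  assumes [measurable]: "f \<in> borel_measurable (leb d)"
    and odd: "\<And>z. z \<in> Rd d \<Longrightarrow> f (\<lambda>i\<in>{..<d}. - z i) = - f z"
    and lip: "\<And>x y. x \<in> Rd d \<Longrightarrow> y \<in> Rd d \<Longrightarrow> nrm d x \<le> \<rho> \<Longrightarrow> nrm d y \<le> \<rho> \<Longrightarrow>
       f x - f y \<le> L * nrm d (\<lambda>i. x i - y i)"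
  shows "(\<integral>\<^sup>+z. indicator {z. nrm d z \<le> \<rho>} z * ennreal (exp (f z)) \<partial>stdg d) \<le> ennreal (exp (L\<^sup>2 / 2))"
proof -
  define e where "e = ennreal (exp (- L\<^sup>2))"
  define X where "X = (\<integral>\<^sup>+z. indicator {z. nrm d z \<le> \<rho>} z * ennreal (exp (f z)) \<partial>stdg d)"
  have m1: "(\<lambda>z. indicator {z. nrm d z \<le> \<rho>} z * ennreal (exp (f z))) \<in> borel_measurable (leb d)" by measurable
  have m2: "(\<lambda>z. indicator {z. nrm d z \<le> \<rho>} z * ennreal (exp (- f z))) \<in> borel_measurable (leb d)" by measurable
  have "(\<integral>\<^sup>+x. e * (indicator {z. nrm d z \<le> \<rho>} x * ennreal (exp (f x))) \<partial>stdg d) *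
        (\<integral>\<^sup>+y. indicator {z. nrm d z \<le> \<rho>} y * ennreal (exp (- f y)) \<partial>stdg d) \<le> 1"
    unfolding stdg_def
  proof (rule PiM_gauss1_transport)
    fix x y :: "nat \<Rightarrow> real" assume xy: "x \<in> {..<d} \<rightarrow>\<^sub>E UNIV" "y \<in> {..<d} \<rightarrow>\<^sub>E UNIV"
    show "e * (indicator {z. nrm d z \<le> \<rho>} x * ennreal (exp (f x))) * (indicator {z. nrm d z \<le> \<rho>} y * ennreal (exp (- f y)))
      \<le> ennreal (exp ((\<Sum>i<d. (x i - y i)\<^sup>2) / 4))"
    proof (cases "nrm d x \<le> \<rho> \<and> nrm d y \<le> \<rho>")
      case True
      define D where "D = nrm d (\<lambda>i. x i - y i)"
      have "f x - f y \<le> L * D" using lip[of x y] xy True by (simp add: Rd_def D_def)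
      \<comment> \<open>Young's inequality, split to leave exactly the transport cost D^2 / 4; the
        remaining L^2 is removed by \<open>e\<close>.\<close>
      also have "\<dots> \<le> L\<^sup>2 + D\<^sup>2 / 4"
        using zero_le_power2[of "L - D / 2"] by (simp add: power2_eq_square algebra_simps)
      also have "D\<^sup>2 = (\<Sum>i<d. (x i - y i)\<^sup>2)" by (simp only: D_def nrm_sq) (simp add: ip_def power2_eq_square)
      finally have "exp (- L\<^sup>2 + f x - f y) \<le> exp ((\<Sum>i<d. (x i - y i)\<^sup>2) / 4)" by simp
      thus ?thesis using True by (auto simp: e_def simp flip: ennreal_mult exp_add intro!: ennreal_leI)
    qed auto
  qed (use m1 m2 in \<open>simp_all add: measurable_stdg_eq flip: stdg_def\<close>)
  moreover have "(\<integral>\<^sup>+y. indicator {z. nrm d z \<le> \<rho>} y * ennreal (exp (- f y)) \<partial>stdg d) = X"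
  proof -
    have "X = (\<integral>\<^sup>+z. indicator {z. nrm d z \<le> \<rho>} (\<lambda>i\<in>{..<d}. - z i) * ennreal (exp (f (\<lambda>i\<in>{..<d}. - z i))) \<partial>stdg d)"
      unfolding X_def by (rule nn_integral_stdg_neg[OF m1, symmetric])
    also have "\<dots> = (\<integral>\<^sup>+y. indicator {z. nrm d z \<le> \<rho>} y * ennreal (exp (- f y)) \<partial>stdg d)"
      by (intro nn_integral_cong) (auto simp: space_stdg odd indicator_def nrm_def ip_def)
    finally show ?thesis ..
  qed
  ultimately have "e * X * X \<le> 1"
    unfolding X_def using m1 by (subst (asm) nn_integral_cmult) (auto simp: measurable_stdg_eq)
  hence "ennreal (exp (L\<^sup>2)) * (e * X * X) \<le> ennreal (exp (L\<^sup>2)) * 1" by (rule mult_left_mono) simp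
  moreover have "ennreal (exp (L\<^sup>2)) * e = 1" by (simp add: e_def flip: ennreal_mult exp_add)
  ultimately have XX: "X * X \<le> ennreal (exp (L\<^sup>2))" by (simp add: mult.assoc[symmetric])
  hence "X \<noteq> \<infinity>" by (auto simp: ennreal_top_mult top_unique)
  then obtain r where r: "X = ennreal r" "r \<ge> 0" by (cases X) auto
  hence "r * r \<le> exp (L\<^sup>2)" using XX by (simp flip: ennreal_mult)
  also have "\<dots> = (exp (L\<^sup>2 / 2))\<^sup>2" by (simp flip: exp_double)
  finally have "r\<^sup>2 \<le> (exp (L\<^sup>2 / 2))\<^sup>2" by (simp add: power2_eq_square)
  hence "r \<le> exp (L\<^sup>2 / 2)" by (rule power2_le_imp_le) simp
  thus ?thesis using r by (simp add: X_def ennreal_leI)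
qed

section \<open>The central estimate in whitened coordinates\<close>

lemma ennreal_lincomb:
  "0 \<le> a \<Longrightarrow> 0 \<le> b \<Longrightarrow> 0 \<le> x \<Longrightarrow> 0 \<le> y \<Longrightarrow> ennreal a * ennreal x + ennreal b * ennreal y = ennreal (a * x + b * y)"
  by (simp add: ennreal_mult ennreal_plus)

lemma nn_integral_lincomb3:
  assumes [measurable]: "f \<in> borel_measurable M" "g \<in> borel_measurable M" "h \<in> borel_measurable M"
  shows "(\<integral>\<^sup>+z. a * (f z + g z) + b * h z \<partial>M) = a * ((\<integral>\<^sup>+z. f z \<partial>M) + (\<integral>\<^sup>+z. g z \<partial>M)) + b * (\<integral>\<^sup>+z. h z \<partial>M)"
  by (simp add: nn_integral_add nn_integral_cmult)

text \<open>What the whitened problem provides. \<open>e3\<close> contains a factor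
  \<open>d\<close>, so \<open>e3 / (6 * d)\<close> is one sixth of the operator norm of the cubic
  form; the 2/3 in the Lipschitz bound is 4/6, with the 4 from polarisation. The bound in
  \<open>q_out\<close> is the linear growth of the potential after division by the Gaussian
  exponential.\<close>

locale perturbed_gaussian =
  fixes d :: nat and s c0 e3 e4 :: real and S q :: "(nat \<Rightarrow> real) \<Rightarrow> real"
  assumes d1: "1 \<le> d" and c0: "0 < c0" "c0 \<le> 1" and s: "8 / c0 * ln (2 * exp 1 / c0) \<le> s"
    and e3: "0 \<le> e3" and e4: "0 \<le> e4"
    and S_meas [measurable]: "S \<in> borel_measurable (leb d)"
    and S_odd: "\<And>z. z \<in> Rd d \<Longrightarrow> S (\<lambda>i\<in>{..<d}. - z i) = - S z"
    and S_bound: "\<And>z. z \<in> Rd d \<Longrightarrow> \<bar>S z\<bar> \<le> e3 / (6 * real d) * nrm d z ^ 3"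
    and S_lip: "\<And>\<rho> x y. x \<in> Rd d \<Longrightarrow> y \<in> Rd d \<Longrightarrow> nrm d x \<le> \<rho> \<Longrightarrow> nrm d y \<le> \<rho> \<Longrightarrow>
       \<bar>S x - S y\<bar> \<le> 2 / 3 * (e3 / real d) * \<rho>\<^sup>2 * nrm d (\<lambda>i. x i - y i)"
    and q_meas [measurable]: "q \<in> borel_measurable (leb d)"
    and q_in: "\<And>z. z \<in> Rd d \<Longrightarrow> nrm d z \<le> s * sqrt (real d) \<Longrightarrow>
       \<exists>r. q z = exp (S z - r) \<and> \<bar>r\<bar> \<le> e4\<^sup>2 * (ip d z z)\<^sup>2 / (24 * (real d)\<^sup>2)"
    and q_out: "\<And>z. z \<in> Rd d \<Longrightarrow> \<not> nrm d z \<le> s * sqrt (real d) \<Longrightarrow>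
       0 \<le> q z \<and> q z \<le> exp (- (c0 * sqrt (real d) * nrm d z) + ip d z z / 2)"
begin

definition U :: "(nat \<Rightarrow> real) set" where "U = {z. nrm d z \<le> s * sqrt (real d)}"
definition E :: real where "E = exp ((e3\<^sup>2 + e4\<^sup>2) * s ^ 4)"

lemma U_meas [measurable]: "Measurable.pred (leb d) (\<lambda>z. z \<in> U)"
  unfolding U_def by measurable

text \<open>As \<open>c0\<close> is at most 1, the factor \<open>8 / c0\<close> is at least 8 and
  the logarithm at least 1.\<close>

lemma s_ge_8: "8 \<le> s"
proof -
  have "exp 1 \<le> 2 * exp 1 / c0" using c0 mult_left_mono[of c0 2 "exp 1"] by (simp add: field_simps)
  hence "1 \<le> ln (2 * exp 1 / c0)" using c0 by (subst ln_ge_iff) auto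
  moreover have "8 \<le> 8 / c0" using c0 by (simp add: field_simps)
  ultimately have "8 * 1 \<le> 8 / c0 * ln (2 * exp 1 / c0)"
    using mult_mono[of 8 "8 / c0" 1 "ln (2 * exp 1 / c0)"] c0 by simp
  thus ?thesis using s by simp
qed

lemma E_ge_1: "1 \<le> E"
  unfolding E_def using s_ge_8 by simp

lemma tau_nonneg: "0 \<le> tau d c0 s" by (simp add: tau_def)

lemma exp_le_tau: "exp (- (c0 * s * real d / 8)) \<le> tau d c0 s"
  using mult_right_mono[of 1 "real d" "exp (- (c0 * s * real d / 8))"] d1 by (simp add: tau_def)

text \<open>The bound of |S| by |z|^3 alone would give e3^4 * d^2. On the ball of radius 2 sqrt d,
  however, S is Lipschitz with constant \<open>l\<close> free of \<open>d\<close>, so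
  \<open>S / l\<close> has bounded exponential moments of both signs; beyond it, the Gaussian tail
  absorbs the polynomial growth.\<close>

lemma S_fourth_moment: "(\<integral>\<^sup>+z. ennreal ((S z) ^ 4) \<partial>stdg d) \<le> ennreal ((400 * e3\<^sup>2)\<^sup>2)"
proof (cases "e3 = 0")
  case True
  have "(\<integral>\<^sup>+z. ennreal ((S z) ^ 4) \<partial>stdg d) = (\<integral>\<^sup>+z. 0 \<partial>stdg d)"
    using S_bound True by (intro nn_integral_cong) (auto simp: space_stdg)
  thus ?thesis by simp
next
  case False
  hence e3p: "e3 > 0" using e3 by simp
  define l where "l = 8 / 3 * e3"
  have l: "l > 0" using e3p by (simp add: l_def)
  define \<rho> where "\<rho> = 2 * sqrt (real d)"
  \<comment> \<open>720 = 6! and 262144 = 8^6, from (|z|^2 / 8)^6 \<le> 6! * exp (|z|^2 /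
    8).\<close>
  define b where "b = (e3 / (6 * real d)) ^ 4 * (720 * 262144)"
  have b0: "b \<ge> 0" by (simp add: b_def)
  let ?B = "{z. nrm d z \<le> \<rho>}"
  have lip1: "2 / 3 * (e3 / real d) * \<rho>\<^sup>2 = l" using d1 by (simp add: \<rho>_def l_def power_mult_distrib)
  have exp_half: "exp ((1::real)\<^sup>2 / 2) \<le> 2"
  proof -
    have "exp (1 / 2 :: real) ^ 2 = exp 1" by (simp flip: exp_double)
    also have "\<dots> \<le> 2\<^sup>2" using exp_le by simp
    finally show ?thesis using power2_le_imp_le[of "exp (1/2 :: real)" 2] by simp
  qed
  have expm: "(\<integral>\<^sup>+z. indicator ?B z * ennreal (exp (\<sigma> * S z / l)) \<partial>stdg d) \<le> ennreal 2" if \<sigma>: "\<sigma> = 1 \<or> \<sigma> = -1" for \<sigma> :: real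
  proof -
    have "(\<integral>\<^sup>+z. indicator ?B z * ennreal (exp (\<sigma> * S z / l)) \<partial>stdg d) \<le> ennreal (exp (1\<^sup>2 / 2))"
    proof (rule odd_lipschitz_exp_moment)
      fix x y assume xy: "x \<in> Rd d" "y \<in> Rd d" "nrm d x \<le> \<rho>" "nrm d y \<le> \<rho>"
      have "\<sigma> * S x / l - \<sigma> * S y / l = \<sigma> * (S x - S y) / l" by (simp add: diff_divide_distrib algebra_simps)
      also have "\<dots> \<le> \<bar>S x - S y\<bar> / l" using \<sigma> l by (intro divide_right_mono) auto
      also have "\<dots> \<le> 1 * nrm d (\<lambda>i. x i - y i)"
        using S_lip[OF xy] l unfolding lip1 by (simp add: pos_divide_le_eq mult.commute)
      finally show "\<sigma> * S x / l - \<sigma> * S y / l \<le> 1 * nrm d (\<lambda>i. x i - y i)" .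
    qed (auto simp: S_odd)
    thus ?thesis using exp_half ennreal_leI order_trans by blast
  qed
  \<comment> \<open>The radius 2 sqrt d is chosen so that the exponent d/2 - (1/4 - 1/8) * 4d is
    0.\<close>
  have tail: "(\<integral>\<^sup>+x. indicator {x. 4 * real d < ip d x x} x * ennreal (exp (1/8 * ip d x x)) \<partial>stdg d) \<le> ennreal 1"
    using stdg_exp_tail[where a="1/8" and r="4 * real d" and d=d] by simp
  have "(\<integral>\<^sup>+z. ennreal ((S z) ^ 4) \<partial>stdg d) \<le>
    (\<integral>\<^sup>+z. ennreal (24 * l ^ 4) * (indicator ?B z * ennreal (exp (1 * S z / l)) + indicator ?B z * ennreal (exp (-1 * S z / l)))
        + ennreal b * (indicator {x. 4 * real d < ip d x x} z * ennreal (exp (1/8 * ip d z z))) \<partial>stdg d)"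
  proof (rule nn_integral_mono)
    fix z assume "z \<in> space (stdg d)"
    hence z: "z \<in> Rd d" by (simp add: space_stdg)
    show "ennreal ((S z) ^ 4) \<le> ennreal (24 * l ^ 4) * (indicator ?B z * ennreal (exp (1 * S z / l)) + indicator ?B z * ennreal (exp (-1 * S z / l)))
        + ennreal b * (indicator {x. 4 * real d < ip d x x} z * ennreal (exp (1/8 * ip d z z)))"
    proof (cases "nrm d z \<le> \<rho>")
      case True
      define t where "t = S z / l"
      have "\<bar>t\<bar> ^ 4 \<le> fact 4 * exp \<bar>t\<bar>" by (rule power_le_fact_exp) simp
      also have "exp \<bar>t\<bar> \<le> exp t + exp (- t)" by (auto simp: abs_if)
      finally have "t ^ 4 \<le> 24 * (exp t + exp (- t))" by (simp add: fact_numeral)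
      hence "(S z / l) ^ 4 \<le> 24 * (exp (S z / l) + exp (- S z / l))" by (simp add: t_def)
      hence "(S z) ^ 4 \<le> 24 * l ^ 4 * (exp (S z / l) + exp (- S z / l))"
        using l by (simp add: power_divide field_simps)
      hence "ennreal ((S z) ^ 4) \<le> ennreal (24 * l ^ 4) * (indicator ?B z * ennreal (exp (1 * S z / l)) + indicator ?B z * ennreal (exp (-1 * S z / l)))"
        using True l by (simp flip: ennreal_plus ennreal_mult add: ennreal_leI)
      thus ?thesis by (rule order_trans) simp
    next
      case False
      hence "\<rho> < nrm d z" by simp
      hence "\<rho>\<^sup>2 < (nrm d z)\<^sup>2" by (intro power_strict_mono) (auto simp: \<rho>_def)
      hence ip: "4 * real d < ip d z z" by (simp add: \<rho>_def power_mult_distrib nrm_sq)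
      have "\<bar>S z\<bar> ^ 4 \<le> (e3 / (6 * real d) * nrm d z ^ 3) ^ 4" by (rule power_mono[OF S_bound[OF z]]) simp
      also have "\<dots> = (e3 / (6 * real d)) ^ 4 * (ip d z z) ^ 6"
        unfolding power_mult_distrib nrm_sq[symmetric] by (simp flip: power_mult)
      also have "(ip d z z) ^ 6 \<le> 720 * 262144 * exp (1/8 * ip d z z)"
        using power_le_fact_exp[of "ip d z z / 8" 6] by (simp add: ip_self_nonneg power_divide fact_numeral)
      finally have "(S z) ^ 4 \<le> b * exp (1/8 * ip d z z)" by (simp add: b_def mult_left_mono mult.assoc)
      hence "ennreal ((S z) ^ 4) \<le> ennreal b * (indicator {x. 4 * real d < ip d x x} z * ennreal (exp (1/8 * ip d z z)))"
        using ip b0 by (simp flip: ennreal_mult add: ennreal_leI)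
      thus ?thesis by (rule order_trans) simp
    qed
  qed
  also have "\<dots> = ennreal (24 * l ^ 4) * ((\<integral>\<^sup>+z. indicator ?B z * ennreal (exp (1 * S z / l)) \<partial>stdg d) + (\<integral>\<^sup>+z. indicator ?B z * ennreal (exp (-1 * S z / l)) \<partial>stdg d))
    + ennreal b * (\<integral>\<^sup>+z. indicator {x. 4 * real d < ip d x x} z * ennreal (exp (1/8 * ip d z z)) \<partial>stdg d)"
  proof -
    have m: "(\<lambda>z. indicator ?B z * ennreal (exp (\<sigma> * S z / l))) \<in> borel_measurable (stdg d)" for \<sigma>
      unfolding measurable_stdg_eq by measurable
    have m': "(\<lambda>z. indicator {x. 4 * real d < ip d x x} z * ennreal (exp (1/8 * ip d z z))) \<in> borel_measurable (stdg d)"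
      unfolding measurable_stdg_eq by measurable
    show ?thesis by (rule nn_integral_lincomb3[OF m m m'])
  qed
  also have "\<dots> \<le> ennreal (24 * l ^ 4) * (ennreal 2 + ennreal 2) + ennreal b * ennreal 1"
    by (intro add_mono mult_left_mono expm tail) auto
  also have "ennreal 2 + ennreal 2 = ennreal 4" by (simp flip: ennreal_plus del: ennreal_numeral)
  also have "ennreal (24 * l ^ 4) * ennreal 4 + ennreal b * ennreal 1 = ennreal (24 * l ^ 4 * 4 + b)"
    using ennreal_lincomb[of "24 * l ^ 4" b 4 1] l b0 by simp
  \<comment> \<open>In units of e3^4: 96 * (8/3)^4 is below 5000 and 6! * 8^6 / 6^4 below 145636,
    together less than 400^2.\<close>
  also have "\<dots> \<le> ennreal ((400 * e3\<^sup>2)\<^sup>2)"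
  proof (rule ennreal_leI)
    have "b = e3 ^ 4 * (720 * 262144 / 1296) / real d ^ 4"
      by (simp add: b_def power_divide power_mult_distrib)
    also have "\<dots> \<le> e3 ^ 4 * (720 * 262144 / 1296) / 1"
      using d1 by (intro divide_left_mono) auto
    also have "\<dots> \<le> e3 ^ 4 * 145636" unfolding div_by_1 by (rule mult_left_mono) auto
    finally have "b \<le> 145636 * e3 ^ 4" by (simp only: mult.commute)
    moreover have "24 * l ^ 4 * 4 \<le> 5000 * e3 ^ 4" by (simp add: l_def power_mult_distrib power_divide)
    moreover have "(400 * e3\<^sup>2)\<^sup>2 = 160000 * e3 ^ 4" by (simp add: power_mult_distrib flip: power_mult)
    moreover have "e3 ^ 4 \<ge> 0" by simp
    ultimately show "24 * l ^ 4 * 4 + b \<le> (400 * e3\<^sup>2)\<^sup>2" by linarith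
  qed
  finally show ?thesis .
qed

lemma S_second_moment: "(\<integral>\<^sup>+z. ennreal ((S z)\<^sup>2) \<partial>stdg d) \<le> ennreal (400 * e3\<^sup>2)"
proof -
  interpret prob_space "stdg d" by (rule prob_space_stdg)
  have "(\<integral>\<^sup>+z. ennreal \<bar>(S z)\<^sup>2 * 1\<bar> \<partial>stdg d) \<le> ennreal (400 * e3\<^sup>2 * 1)"
    using S_fourth_moment
    by (intro nn_integral_Cauchy_Schwarz_le) (auto simp: measurable_stdg_eq emeasure_space_1 simp flip: power_mult)
  thus ?thesis by simp
qed

text \<open>The Lipschitz constant of \<open>2 * S\<close> on the ball \<open>U\<close>; the factor
  2 is there because Cauchy-Schwarz squares \<open>exp S\<close>.\<close>

definition L :: real where "L = 4 / 3 * e3 * s\<^sup>2"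

lemma S_exp_moment:
  assumes \<sigma>: "\<sigma> = 2 \<or> \<sigma> = -2"
  shows "(\<integral>\<^sup>+z. indicator U z * ennreal (exp (\<sigma> * S z)) \<partial>stdg d) \<le> ennreal (exp (L\<^sup>2 / 2))"
  unfolding U_def
proof (rule odd_lipschitz_exp_moment)
  fix x y assume xy: "x \<in> Rd d" "y \<in> Rd d" "nrm d x \<le> s * sqrt (real d)" "nrm d y \<le> s * sqrt (real d)"
  have "\<sigma> * S x - \<sigma> * S y = \<sigma> * (S x - S y)" by (simp add: algebra_simps)
  also have "\<dots> \<le> 2 * \<bar>S x - S y\<bar>" using \<sigma> by (elim disjE) (auto simp: abs_if)
  also have "\<dots> \<le> 2 * (2 / 3 * (e3 / real d) * (s * sqrt (real d))\<^sup>2 * nrm d (\<lambda>i. x i - y i))"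
    using S_lip[OF xy] by simp
  also have "\<dots> = L * nrm d (\<lambda>i. x i - y i)"
    using d1 by (simp add: L_def power_mult_distrib)
  finally show "\<sigma> * S x - \<sigma> * S y \<le> L * nrm d (\<lambda>i. x i - y i)" .
qed (auto simp: S_odd)

text \<open>The origin of the factor \<open>E\<close>: since L^2 / 4 is 4/9 of e3^2 * s^4, the
  concentration bound and the exponential of the fourth-order remainder fit together under
  it.\<close>

lemma exp_L_le: "0 \<le> a \<Longrightarrow> a \<le> e4\<^sup>2 * s ^ 4 \<Longrightarrow> exp a * exp (L\<^sup>2 / 4) \<le> E"
proof -
  assume a: "0 \<le> a" "a \<le> e4\<^sup>2 * s ^ 4"
  have "L\<^sup>2 / 4 = 4 / 9 * (e3\<^sup>2 * s ^ 4)" by (simp add: L_def power_mult_distrib power_divide flip: power_mult)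
  moreover have "0 \<le> e3\<^sup>2 * s ^ 4" by simp
  ultimately have "a + L\<^sup>2 / 4 \<le> (e3\<^sup>2 + e4\<^sup>2) * s ^ 4" using a unfolding distrib_right by linarith
  thus ?thesis by (simp add: E_def flip: exp_add)
qed

text \<open>The prefactor |r| is kept as a multiple of |z|^4 / d^2, whose mean is bounded in
  \<open>d\<close>; only the factor exp |r| is replaced by its maximum over the ball.\<close>

lemma pointwise_inside:
  assumes z: "z \<in> Rd d" "z \<in> U"
  shows "\<bar>q z - 1 - S z\<bar> \<le> exp (e4\<^sup>2 * s ^ 4 / 24) * (e4\<^sup>2 / (24 * (real d)\<^sup>2)) * ((ip d z z)\<^sup>2 * exp (S z))
     + 1 / 2 * ((S z)\<^sup>2 * exp \<bar>S z\<bar>)"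
proof -
  obtain r where r: "q z = exp (S z - r)" "\<bar>r\<bar> \<le> e4\<^sup>2 * (ip d z z)\<^sup>2 / (24 * (real d)\<^sup>2)"
    using q_in z by (auto simp: U_def)
  have "nrm d z \<le> s * sqrt (real d)" using z by (simp add: U_def)
  hence "(nrm d z)\<^sup>2 \<le> (s * sqrt (real d))\<^sup>2" by (rule power_mono) simp
  hence "ip d z z \<le> s\<^sup>2 * real d" by (simp add: nrm_sq power_mult_distrib)
  hence "(ip d z z)\<^sup>2 \<le> (s\<^sup>2 * real d)\<^sup>2" by (rule power_mono) (rule ip_self_nonneg)
  hence "e4\<^sup>2 * (ip d z z)\<^sup>2 / (24 * (real d)\<^sup>2) \<le> e4\<^sup>2 * (s\<^sup>2 * real d)\<^sup>2 / (24 * (real d)\<^sup>2)"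
    by (intro divide_right_mono mult_left_mono) auto
  also have "\<dots> = e4\<^sup>2 * s ^ 4 / 24" using d1 by (simp add: power_mult_distrib flip: power_mult)
  finally have R: "\<bar>r\<bar> \<le> e4\<^sup>2 * s ^ 4 / 24" using r(2) by simp
  have "q z - 1 - S z = exp (S z) * (exp (- r) - 1) + (exp (S z) - 1 - S z)"
    by (simp add: r(1) exp_diff exp_minus field_simps)
  also have "\<bar>\<dots>\<bar> \<le> exp (S z) * \<bar>exp (- r) - 1\<bar> + \<bar>exp (S z) - 1 - S z\<bar>"
    by (rule order_trans[OF abs_triangle_ineq]) (simp add: abs_mult)
  also have "\<dots> \<le> exp (S z) * (\<bar>r\<bar> * exp \<bar>r\<bar>) + (S z)\<^sup>2 / 2 * exp \<bar>S z\<bar>"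
    using exp_abs_bound[of "- r"] exp_quadratic_bound[of "S z"] by (intro add_mono mult_left_mono) auto
  also have "\<bar>r\<bar> * exp \<bar>r\<bar> \<le> (e4\<^sup>2 * (ip d z z)\<^sup>2 / (24 * (real d)\<^sup>2)) * exp (e4\<^sup>2 * s ^ 4 / 24)"
    using r(2) R by (intro mult_mono) auto
  finally show ?thesis by (simp add: mult_ac mult_left_mono)
qed

lemma integral_inside:
  "(\<integral>\<^sup>+z. indicator U z * ennreal \<bar>q z - 1 - S z\<bar> \<partial>stdg d) \<le> ennreal ((400 * e3\<^sup>2 + e4\<^sup>2) * E)"
proof -
  define k where "k = exp (e4\<^sup>2 * s ^ 4 / 24) * (e4\<^sup>2 / (24 * (real d)\<^sup>2))"
  have k0: "k \<ge> 0" by (simp add: k_def)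
  have sq2: "(exp (L\<^sup>2 / 4))\<^sup>2 = exp (L\<^sup>2 / 2)" by (simp flip: exp_double)
  have i1: "(\<integral>\<^sup>+z. ennreal \<bar>(ip d z z)\<^sup>2 * (indicator U z * exp (S z))\<bar> \<partial>stdg d) \<le> ennreal (11 * (real d)\<^sup>2 * exp (L\<^sup>2 / 4))"
  proof (rule nn_integral_Cauchy_Schwarz_le)
    \<comment> \<open>11^2 = 121 exceeds 105.\<close>
    have "105 * real d ^ 4 \<le> (11 * (real d)\<^sup>2)\<^sup>2" by (simp add: power_mult_distrib flip: power_mult)
    thus "(\<integral>\<^sup>+x. ennreal (((ip d x x)\<^sup>2)\<^sup>2) \<partial>stdg d) \<le> ennreal ((11 * (real d)\<^sup>2)\<^sup>2)"
      using order_trans[OF stdg_ip_power4 ennreal_leI] by (simp flip: power_mult)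
    have "(\<integral>\<^sup>+x. ennreal ((indicator U x * exp (S x))\<^sup>2) \<partial>stdg d) = (\<integral>\<^sup>+z. indicator U z * ennreal (exp (2 * S z)) \<partial>stdg d)"
      by (intro nn_integral_cong) (auto simp: indicator_def exp_double)
    thus "(\<integral>\<^sup>+x. ennreal ((indicator U x * exp (S x))\<^sup>2) \<partial>stdg d) \<le> ennreal ((exp (L\<^sup>2 / 4))\<^sup>2)"
      using S_exp_moment[of 2] by (simp add: sq2)
  qed (auto simp: measurable_stdg_eq)
  have i2: "(\<integral>\<^sup>+z. ennreal \<bar>(S z)\<^sup>2 * (indicator U z * exp \<bar>S z\<bar>)\<bar> \<partial>stdg d) \<le> ennreal (400 * e3\<^sup>2 * (2 * exp (L\<^sup>2 / 4)))"
  proof (rule nn_integral_Cauchy_Schwarz_le)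
    show "(\<integral>\<^sup>+x. ennreal (((S x)\<^sup>2)\<^sup>2) \<partial>stdg d) \<le> ennreal ((400 * e3\<^sup>2)\<^sup>2)"
      using S_fourth_moment by (simp flip: power_mult)
    \<comment> \<open>exp (2 |S|) is at most exp (2 S) + exp (-2 S), and each sign has the same
      bound; the resulting factor 2 is enlarged to 2^2 to obtain a square.\<close>
    have "(\<integral>\<^sup>+x. ennreal ((indicator U x * exp \<bar>S x\<bar>)\<^sup>2) \<partial>stdg d)
      \<le> (\<integral>\<^sup>+z. indicator U z * ennreal (exp (2 * S z)) + indicator U z * ennreal (exp (-2 * S z)) \<partial>stdg d)"
      by (intro nn_integral_mono) (auto simp: indicator_def abs_if simp flip: exp_double ennreal_plus intro!: ennreal_leI)
    also have "\<dots> = (\<integral>\<^sup>+z. indicator U z * ennreal (exp (2 * S z)) \<partial>stdg d) + (\<integral>\<^sup>+z. indicator U z * ennreal (exp (-2 * S z)) \<partial>stdg d)"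
      by (rule nn_integral_add) (simp_all add: measurable_stdg_eq)
    also have "\<dots> \<le> ennreal (exp (L\<^sup>2 / 2)) + ennreal (exp (L\<^sup>2 / 2))"
      by (intro add_mono S_exp_moment) auto
    also have "\<dots> = ennreal (2 * exp (L\<^sup>2 / 2))" by (simp flip: ennreal_plus)
    also have "\<dots> \<le> ennreal ((2 * exp (L\<^sup>2 / 4))\<^sup>2)"
      by (intro ennreal_leI) (simp add: power_mult_distrib sq2)
    finally show "(\<integral>\<^sup>+x. ennreal ((indicator U x * exp \<bar>S x\<bar>)\<^sup>2) \<partial>stdg d) \<le> ennreal ((2 * exp (L\<^sup>2 / 4))\<^sup>2)" .
  qed (auto simp: measurable_stdg_eq)
  have "(\<integral>\<^sup>+z. indicator U z * ennreal \<bar>q z - 1 - S z\<bar> \<partial>stdg d) \<le>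
    (\<integral>\<^sup>+z. ennreal k * ennreal \<bar>(ip d z z)\<^sup>2 * (indicator U z * exp (S z))\<bar> + ennreal (1/2) * ennreal \<bar>(S z)\<^sup>2 * (indicator U z * exp \<bar>S z\<bar>)\<bar> \<partial>stdg d)"
  proof (rule nn_integral_mono)
    fix z assume "z \<in> space (stdg d)"
    hence z: "z \<in> Rd d" by (simp add: space_stdg)
    show "indicator U z * ennreal \<bar>q z - 1 - S z\<bar> \<le> ennreal k * ennreal \<bar>(ip d z z)\<^sup>2 * (indicator U z * exp (S z))\<bar> + ennreal (1/2) * ennreal \<bar>(S z)\<^sup>2 * (indicator U z * exp \<bar>S z\<bar>)\<bar>"
    proof (cases "z \<in> U")
      case True
      have "ennreal k * ennreal ((ip d z z)\<^sup>2 * exp (S z)) + ennreal (1/2) * ennreal ((S z)\<^sup>2 * exp \<bar>S z\<bar>)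
        = ennreal (k * ((ip d z z)\<^sup>2 * exp (S z)) + 1 / 2 * ((S z)\<^sup>2 * exp \<bar>S z\<bar>))"
        using k0 by (intro ennreal_lincomb) auto
      also have "ennreal \<bar>q z - 1 - S z\<bar> \<le> \<dots>"
        using pointwise_inside[OF z True] unfolding k_def by (rule ennreal_leI)
      finally show ?thesis using True by (simp only: indicator_simps mult_1 abs_mult abs_power2 power2_abs abs_exp_cancel)
    qed auto
  qed
  also have "\<dots> = ennreal k * (\<integral>\<^sup>+z. ennreal \<bar>(ip d z z)\<^sup>2 * (indicator U z * exp (S z))\<bar> \<partial>stdg d)
      + ennreal (1/2) * (\<integral>\<^sup>+z. ennreal \<bar>(S z)\<^sup>2 * (indicator U z * exp \<bar>S z\<bar>)\<bar> \<partial>stdg d)"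
    by (subst nn_integral_add, simp_all add: measurable_stdg_eq nn_integral_cmult del: abs_mult)
  also have "\<dots> \<le> ennreal k * ennreal (11 * (real d)\<^sup>2 * exp (L\<^sup>2 / 4)) + ennreal (1/2) * ennreal (400 * e3\<^sup>2 * (2 * exp (L\<^sup>2 / 4)))"
    by (intro add_mono mult_left_mono i1 i2) auto
  also have "\<dots> = ennreal (k * (11 * (real d)\<^sup>2 * exp (L\<^sup>2 / 4)) + 1/2 * (400 * e3\<^sup>2 * (2 * exp (L\<^sup>2 / 4))))"
    using k0 by (intro ennreal_lincomb) auto
  also have "\<dots> \<le> ennreal ((400 * e3\<^sup>2 + e4\<^sup>2) * E)"
  proof (rule ennreal_leI)
    have "0 \<le> e4\<^sup>2 * s ^ 4" by simp
    hence 1: "exp (e4\<^sup>2 * s ^ 4 / 24) * exp (L\<^sup>2 / 4) \<le> E" by (intro exp_L_le) auto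
    have 2: "exp 0 * exp (L\<^sup>2 / 4) \<le> E" by (intro exp_L_le) auto
    have "k * (11 * (real d)\<^sup>2 * exp (L\<^sup>2 / 4)) = e4\<^sup>2 * (11 / 24 * (exp (e4\<^sup>2 * s ^ 4 / 24) * exp (L\<^sup>2 / 4)))"
      using d1 by (simp add: k_def field_simps)
    also have "\<dots> \<le> e4\<^sup>2 * E"
    proof (rule mult_left_mono)
      have "0 \<le> exp (e4\<^sup>2 * s ^ 4 / 24) * exp (L\<^sup>2 / 4)" by simp
      thus "11 / 24 * (exp (e4\<^sup>2 * s ^ 4 / 24) * exp (L\<^sup>2 / 4)) \<le> E" using 1 by linarith
    qed simp
    finally have "k * (11 * (real d)\<^sup>2 * exp (L\<^sup>2 / 4)) \<le> e4\<^sup>2 * E" .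
    moreover have "400 * e3\<^sup>2 * exp (L\<^sup>2 / 4) \<le> 400 * e3\<^sup>2 * E" using 2 by (intro mult_left_mono) auto
    ultimately
    show "k * (11 * (real d)\<^sup>2 * exp (L\<^sup>2 / 4)) + 1/2 * (400 * e3\<^sup>2 * (2 * exp (L\<^sup>2 / 4))) \<le> (400 * e3\<^sup>2 + e4\<^sup>2) * E"
      by (simp add: distrib_right)
  qed
  finally show ?thesis .
qed

section \<open>Contributions from outside the ball\<close>

lemma emeasure_outside: "(\<integral>\<^sup>+z. indicator (- U) z \<partial>stdg d) \<le> ennreal (tau d c0 s)"
proof -
  have s0: "s \<ge> 0" using s_ge_8 by simp
  have "z \<in> - U \<longleftrightarrow> s\<^sup>2 * real d < ip d z z" for z
  proof -
    have "z \<in> - U \<longleftrightarrow> \<not> (nrm d z)\<^sup>2 \<le> (s * sqrt (real d))\<^sup>2"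
      using s0 by (subst power2_le_iff_abs_le) (auto simp: U_def)
    thus ?thesis by (simp add: nrm_sq power_mult_distrib not_le)
  qed
  hence "- U = {z. s\<^sup>2 * real d < ip d z z}" by auto
  hence "(\<integral>\<^sup>+z. indicator (- U) z \<partial>stdg d) \<le> ennreal (exp (real d / 2 - (1/4 - 0) * (s\<^sup>2 * real d)))"
    using stdg_exp_tail[where a=0 and r="s\<^sup>2 * real d" and d=d] by simp
  also have "\<dots> \<le> ennreal (exp (- (c0 * s * real d / 8)))"
  proof (intro ennreal_leI, simp)
    \<comment> \<open>With s at least 8, s^2 / 4 is at least 2 s, which pays for the 1/2 from the
      Chernoff bound and for the rate c0 * s / 8 in \<open>tau\<close>.\<close>
    have "c0 * s \<le> 1 * s" using c0 s0 by (intro mult_right_mono) auto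
    moreover have "8 * s \<le> s * s" using s_ge_8 by (intro mult_right_mono) auto
    ultimately have "1 / 2 + c0 * s / 8 \<le> s\<^sup>2 / 4" using s_ge_8 unfolding power2_eq_square by linarith
    hence "(1 / 2 + c0 * s / 8) * real d \<le> s\<^sup>2 / 4 * real d" by (rule mult_right_mono) simp
    thus "real d / 2 - s\<^sup>2 * real d / 4 \<le> - (c0 * s * real d / 8)" by (simp add: algebra_simps)
  qed
  also have "\<dots> \<le> ennreal (tau d c0 s)" by (rule ennreal_leI[OF exp_le_tau])
  finally show ?thesis .
qed

text \<open>By |S| \<le> 1 + S^2 / 2 the constants are paid by the Gaussian tail and the square by
  the second moment, which has the required order e3^2 without any gain from the tail.\<close>

lemma integral_outside_S:
  "(\<integral>\<^sup>+z. indicator (- U) z * ennreal (1 + \<bar>S z\<bar>) \<partial>stdg d) \<le> ennreal (2 * tau d c0 s + 200 * e3\<^sup>2)"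
proof -
  have "(\<integral>\<^sup>+z. indicator (- U) z * ennreal (1 + \<bar>S z\<bar>) \<partial>stdg d) \<le>
    (\<integral>\<^sup>+z. ennreal 2 * indicator (- U) z + ennreal (1/2) * ennreal ((S z)\<^sup>2) \<partial>stdg d)"
  proof (rule nn_integral_mono)
    fix z
    have "1 + \<bar>S z\<bar> \<le> 2 + 1/2 * (S z)\<^sup>2"
      using zero_le_power2[of "\<bar>S z\<bar> - 1"] unfolding power2_diff by simp
    hence "ennreal (1 + \<bar>S z\<bar>) \<le> ennreal (2 * 1 + 1/2 * (S z)\<^sup>2)" by (intro ennreal_leI) simp
    also have "\<dots> = ennreal 2 * ennreal 1 + ennreal (1/2) * ennreal ((S z)\<^sup>2)"
      by (rule ennreal_lincomb[symmetric]) auto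
    finally have "ennreal (1 + \<bar>S z\<bar>) \<le> ennreal 2 + ennreal (1/2) * ennreal ((S z)\<^sup>2)" by simp
    thus "indicator (- U) z * ennreal (1 + \<bar>S z\<bar>) \<le> ennreal 2 * indicator (- U) z + ennreal (1/2) * ennreal ((S z)\<^sup>2)"
      by (auto simp: indicator_def)
  qed
  also have "\<dots> = ennreal 2 * (\<integral>\<^sup>+z. indicator (- U) z \<partial>stdg d) + ennreal (1/2) * (\<integral>\<^sup>+z. ennreal ((S z)\<^sup>2) \<partial>stdg d)"
    by (subst nn_integral_add, simp_all add: measurable_stdg_eq nn_integral_cmult del: nn_integral_indicator)
  also have "\<dots> \<le> ennreal 2 * ennreal (tau d c0 s) + ennreal (1/2) * ennreal (400 * e3\<^sup>2)"
    by (intro add_mono mult_left_mono emeasure_outside S_second_moment) auto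
  also have "\<dots> = ennreal (2 * tau d c0 s + 1/2 * (400 * e3\<^sup>2))"
    using tau_nonneg by (intro ennreal_lincomb) auto
  finally show ?thesis by simp
qed

text \<open>Against Lebesgue measure the integrand is at most exp (- c0 * sqrt d * |z|). One half of
  the exponent is used at |z| \<ge> s * sqrt d and gives \<open>a\<close>; the other half dominates
  the sum of the |z_i|, so that the integral factorises and contributes (4 / c0)^d.\<close>

lemma integral_outside_q:
  "(\<integral>\<^sup>+z. indicator (- U) z * ennreal (q z) \<partial>stdg d) \<le> ennreal (tau d c0 s)"
proof -
  define \<kappa> where "\<kappa> = (1 / sqrt (2 * pi)) ^ d"
  define a where "a = exp (- (c0 * s * real d / 2))"
  have "(\<integral>\<^sup>+z. indicator (- U) z * ennreal (q z) \<partial>stdg d)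
    = ennreal \<kappa> * (\<integral>\<^sup>+z. ennreal (exp (- ip d z z / 2)) * (indicator (- U) z * ennreal (q z)) \<partial>leb d)"
    unfolding \<kappa>_def by (rule nn_integral_stdg) measurable
  also have "\<dots> \<le> ennreal \<kappa> * (\<integral>\<^sup>+z. ennreal a * (\<Prod>i<d. ennreal (exp (- (c0 / 2 * \<bar>z i\<bar>)))) \<partial>leb d)"
  proof (intro mult_left_mono nn_integral_mono)
    fix z assume "z \<in> space (leb d)"
    hence z: "z \<in> Rd d" by (simp add: space_leb)
    show "ennreal (exp (- ip d z z / 2)) * (indicator (- U) z * ennreal (q z)) \<le> ennreal a * (\<Prod>i<d. ennreal (exp (- (c0 / 2 * \<bar>z i\<bar>))))"
    proof (cases "z \<in> U")
      case False
      hence nz: "s * sqrt (real d) \<le> nrm d z" by (simp add: U_def)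
      have q: "q z \<le> exp (- (c0 * sqrt (real d) * nrm d z) + ip d z z / 2)" "0 \<le> q z"
        using q_out[OF z] False by (auto simp: U_def)
      have "exp (- ip d z z / 2) * q z \<le> exp (- ip d z z / 2) * exp (- (c0 * sqrt (real d) * nrm d z) + ip d z z / 2)"
        by (intro mult_left_mono q) simp
      also have "\<dots> = exp (- (c0 * sqrt (real d) * nrm d z))" by (simp flip: exp_add)
      also have "\<dots> \<le> exp (- (c0 * s * real d / 2) - c0 / 2 * (\<Sum>i<d. \<bar>z i\<bar>))"
      proof -
        have "s * real d = sqrt (real d) * (s * sqrt (real d))" by simp
        also have "\<dots> \<le> sqrt (real d) * nrm d z" by (intro mult_left_mono nz) auto
        finally have "c0 / 2 * (s * real d) \<le> c0 / 2 * (sqrt (real d) * nrm d z)"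
          by (rule mult_left_mono) (use c0 in auto)
        moreover have "c0 / 2 * (\<Sum>i<d. \<bar>z i\<bar>) \<le> c0 / 2 * (sqrt (real d) * nrm d z)"
          using c0 by (intro mult_left_mono sum_abs_le_nrm) auto
        moreover have "c0 * sqrt (real d) * nrm d z = c0 / 2 * (sqrt (real d) * nrm d z) + c0 / 2 * (sqrt (real d) * nrm d z)"
          "c0 * s * real d / 2 = c0 / 2 * (s * real d)" by simp_all
        ultimately have "c0 * s * real d / 2 + c0 / 2 * (\<Sum>i<d. \<bar>z i\<bar>) \<le> c0 * sqrt (real d) * nrm d z" by linarith
        thus ?thesis by simp
      qed
      also have "\<dots> = a * (\<Prod>i<d. exp (- (c0 / 2 * \<bar>z i\<bar>)))"
        by (simp add: a_def exp_sum[symmetric] sum_negf sum_distrib_left[symmetric] sum_divide_distrib[symmetric] flip: exp_add)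
      finally have "ennreal (exp (- ip d z z / 2) * q z) \<le> ennreal (a * (\<Prod>i<d. exp (- (c0 / 2 * \<bar>z i\<bar>))))" by (rule ennreal_leI)
      thus ?thesis using False q by (simp add: ennreal_mult prod_ennreal prod_nonneg a_def)
    qed simp
  qed simp
  also have "(\<integral>\<^sup>+z. ennreal a * (\<Prod>i<d. ennreal (exp (- (c0 / 2 * \<bar>z i\<bar>)))) \<partial>leb d)
     = ennreal a * (\<integral>\<^sup>+z. (\<Prod>i<d. ennreal (exp (- (c0 / 2 * \<bar>z i\<bar>)))) \<partial>leb d)"
    by (rule nn_integral_cmult) measurable
  also have "(\<integral>\<^sup>+z. (\<Prod>i<d. ennreal (exp (- (c0 / 2 * \<bar>z i\<bar>)))) \<partial>leb d) = (\<Prod>i<d. \<integral>\<^sup>+x. ennreal (exp (- (c0 / 2 * \<bar>x\<bar>))) \<partial>lborel)"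
    unfolding leb_def by (rule lborel_prod.product_nn_integral_prod) auto
  also have "\<dots> \<le> (\<Prod>i<d. ennreal (2 / (c0 / 2)))"
    unfolding prod_constant using c0 by (intro power_mono nn_integral_exp_abs) auto
  also have "(\<Prod>i<d. ennreal (2 / (c0 / 2))) = ennreal ((4 / c0) ^ d)"
    using c0 by (simp add: ennreal_power)
  also have "ennreal \<kappa> * (ennreal a * ennreal ((4 / c0) ^ d)) = ennreal (a * (4 / (sqrt (2 * pi) * c0)) ^ d)"
    using c0 by (simp add: \<kappa>_def a_def power_divide power_mult_distrib flip: ennreal_mult)
  also have "\<dots> \<le> ennreal (tau d c0 s)"
  proof (rule ennreal_leI)
    \<comment> \<open>The logarithmic lower bound on \<open>s\<close> says that 2 e / c0 is at most
      exp (c0 * s / 8). Hence the volume factor uses up only c0 * s * d / 8 of the exponent c0 * s *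
      d / 2 in \<open>a\<close>.\<close>
    have "1 \<le> sqrt (2 * pi)" using pi_ge_two by simp
    moreover have "(2::real) \<le> exp 1" using exp_ge_add_one_self[of 1] by simp
    ultimately have "4 / (sqrt (2 * pi) * c0) \<le> 2 * exp 1 / c0"
    proof -
      have "4 / (sqrt (2 * pi) * c0) \<le> 4 / (1 * c0)"
        using c0 \<open>1 \<le> sqrt (2 * pi)\<close> by (intro divide_left_mono mult_right_mono mult_pos_pos) auto
      also have "\<dots> \<le> 2 * exp 1 / c0" using c0 \<open>2 \<le> exp 1\<close> by (intro divide_mono) auto
      finally show ?thesis by simp
    qed
    also have "\<dots> \<le> exp (c0 * s / 8)"
    proof -
      have "ln (2 * exp 1 / c0) \<le> c0 * s / 8" using s c0 by (simp add: field_simps)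
      thus ?thesis using c0 by (metis divide_pos_pos exp_gt_zero exp_le_cancel_iff exp_ln mult_pos_pos zero_less_numeral)
    qed
    finally have "(4 / (sqrt (2 * pi) * c0)) ^ d \<le> exp (c0 * s / 8) ^ d" using c0 by (intro power_mono) auto
    also have "\<dots> = exp (c0 * s * real d / 8)" by (simp add: exp_of_nat_mult[symmetric] mult_ac)
    finally have "a * (4 / (sqrt (2 * pi) * c0)) ^ d \<le> a * exp (c0 * s * real d / 8)"
      by (intro mult_left_mono) (auto simp: a_def)
    also have "\<dots> = exp (- (3 * (c0 * s * real d / 8)))" by (simp add: a_def flip: exp_add)
    also have "\<dots> \<le> exp (- (c0 * s * real d / 8))" using c0 s_ge_8 by simp
    also have "\<dots> \<le> tau d c0 s" by (rule exp_le_tau)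
    finally show "a * (4 / (sqrt (2 * pi) * c0)) ^ d \<le> tau d c0 s" .
  qed
  finally show ?thesis by (simp add: mult_left_mono)
qed

theorem perturbation_bound:
  "(\<integral>\<^sup>+z. ennreal \<bar>q z - 1 - S z\<bar> \<partial>stdg d) \<le> ennreal (600 * (E * (e3\<^sup>2 + e4\<^sup>2) + tau d c0 s))"
proof -
  have "(\<integral>\<^sup>+z. ennreal \<bar>q z - 1 - S z\<bar> \<partial>stdg d) \<le>
    (\<integral>\<^sup>+z. indicator U z * ennreal \<bar>q z - 1 - S z\<bar> + (indicator (- U) z * ennreal (1 + \<bar>S z\<bar>) + indicator (- U) z * ennreal (q z)) \<partial>stdg d)"
  proof (rule nn_integral_mono)
    fix z assume "z \<in> space (stdg d)"
    hence z: "z \<in> Rd d" by (simp add: space_stdg)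
    show "ennreal \<bar>q z - 1 - S z\<bar> \<le> indicator U z * ennreal \<bar>q z - 1 - S z\<bar> + (indicator (- U) z * ennreal (1 + \<bar>S z\<bar>) + indicator (- U) z * ennreal (q z))"
    proof (cases "z \<in> U")
      case False
      hence q: "0 \<le> q z" using q_out[OF z] by (auto simp: U_def)
      hence "ennreal \<bar>q z - 1 - S z\<bar> \<le> ennreal ((1 + \<bar>S z\<bar>) + q z)" by (intro ennreal_leI) auto
      thus ?thesis using False q by (subst (asm) ennreal_plus) auto
    qed simp
  qed
  also have "\<dots> = (\<integral>\<^sup>+z. indicator U z * ennreal \<bar>q z - 1 - S z\<bar> \<partial>stdg d) +
     ((\<integral>\<^sup>+z. indicator (- U) z * ennreal (1 + \<bar>S z\<bar>) \<partial>stdg d) + (\<integral>\<^sup>+z. indicator (- U) z * ennreal (q z) \<partial>stdg d))"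
    by (subst nn_integral_add, simp_all add: measurable_stdg_eq) (subst nn_integral_add, simp_all add: measurable_stdg_eq)
  also have "\<dots> \<le> ennreal ((400 * e3\<^sup>2 + e4\<^sup>2) * E) + (ennreal (2 * tau d c0 s + 200 * e3\<^sup>2) + ennreal (tau d c0 s))"
    by (intro add_mono integral_inside integral_outside_S integral_outside_q)
  also have "\<dots> = ennreal ((400 * e3\<^sup>2 + e4\<^sup>2) * E + (2 * tau d c0 s + 200 * e3\<^sup>2 + tau d c0 s))"
    using tau_nonneg E_ge_1 by (simp flip: ennreal_plus)
  also have "\<dots> \<le> ennreal (600 * (E * (e3\<^sup>2 + e4\<^sup>2) + tau d c0 s))"
  proof (rule ennreal_leI)
    \<comment> \<open>600 = 400 + 200, the coefficients of e3^2 inside and outside the ball;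
      \<open>E\<close> being at least 1 merges them.\<close>
    have "e3\<^sup>2 * 1 \<le> e3\<^sup>2 * E" by (rule mult_left_mono[OF E_ge_1]) simp
    moreover have "0 \<le> e4\<^sup>2 * E" using E_ge_1 by simp
    ultimately show "(400 * e3\<^sup>2 + e4\<^sup>2) * E + (2 * tau d c0 s + 200 * e3\<^sup>2 + tau d c0 s) \<le> 600 * (E * (e3\<^sup>2 + e4\<^sup>2) + tau d c0 s)"
      using tau_nonneg by (simp add: algebra_simps)
  qed
  finally show ?thesis .
qed

end

section \<open>Calculus with partial derivatives\<close>

lemma PiE_UNIV_iff: "x \<in> (\<Pi>\<^sub>E i\<in>UNIV. X i) \<longleftrightarrow> (\<forall>i. x i \<in> X i)"
  by auto

text \<open>The topology is a product over all natural numbers, but two points of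
  \<open>Rd d\<close> agree from \<open>d\<close> on, so finitely many coordinates decide and the
  smallest radius works.\<close>

lemma open_Rd_box:
  assumes \<Theta>: "openin (top_of_set (Rd d)) \<Theta>" and x: "x \<in> \<Theta>"
  shows "\<exists>\<delta>>0. \<forall>y\<in>Rd d. (\<forall>i<d. \<bar>y i - x i\<bar> < \<delta>) \<longrightarrow> y \<in> \<Theta>"
proof -
  obtain O' where O': "open O'" "\<Theta> = Rd d \<inter> O'" using \<Theta> by (auto simp: openin_open)
  have "openin (product_topology (\<lambda>i. euclidean) UNIV) O'" using O'(1) by (simp add: euclidean_product_topology)
  from product_topology_open_contains_basis[OF this, of x] obtain X where
    X: "\<forall>i. x i \<in> X i" "\<forall>i. open (X i)" "\<And>y. (\<forall>i. y i \<in> X i) \<Longrightarrow> y \<in> O'"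
    using x O'(2) unfolding PiE_UNIV_iff subset_iff by auto
  have "\<forall>i. \<exists>e>0. \<forall>t. \<bar>t - x i\<bar> < e \<longrightarrow> t \<in> X i"
    using X(1,2) unfolding open_dist dist_real_def by blast
  then obtain e where e: "\<And>i. e i > 0" "\<And>i t. \<bar>t - x i\<bar> < e i \<Longrightarrow> t \<in> X i" by metis
  define \<delta> where "\<delta> = Min (insert 1 (e ` {..<d}))"
  have \<delta>: "\<delta> > 0" "\<And>i. i < d \<Longrightarrow> \<delta> \<le> e i" using e(1) by (auto simp: \<delta>_def)
  have xR: "x \<in> Rd d" using x O' by auto
  show ?thesis
  proof (intro exI[of _ \<delta>] conjI ballI impI)
    fix y assume y: "y \<in> Rd d" "\<forall>i<d. \<bar>y i - x i\<bar> < \<delta>"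
    have "y i \<in> X i" for i
    proof (cases "i < d")
      case True
      thus ?thesis using y(2) \<delta>(2) e(2) by force
    next
      case False
      hence "y i = x i" using y(1) xR by (simp add: Rd_def PiE_iff extensional_def)
      thus ?thesis using X(1) by simp
    qed
    thus "y \<in> \<Theta>" using X(3) y(1) O'(2) by blast
  qed (rule \<delta>)
qed

lemma continuous_on_box:
  fixes f :: "_ \<Rightarrow> real"
  assumes \<Theta>: "openin (top_of_set (Rd d)) \<Theta>" and x: "x \<in> \<Theta>" and f: "continuous_on \<Theta> f" and "e > 0"
  shows "\<exists>\<delta>>0. \<forall>y\<in>Rd d. (\<forall>i<d. \<bar>y i - x i\<bar> < \<delta>) \<longrightarrow> y \<in> \<Theta> \<and> \<bar>f y - f x\<bar> < e"
proof -
  have "openin (top_of_set \<Theta>) (\<Theta> \<inter> f -` ball (f x) e)"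
    by (rule continuous_openin_preimage_gen[OF f]) simp
  hence "openin (top_of_set (Rd d)) (\<Theta> \<inter> f -` ball (f x) e)" using \<Theta> by (rule openin_trans)
  from open_Rd_box[OF this, of x] x \<open>e > 0\<close> show ?thesis
    by (auto simp: dist_real_def abs_minus_commute)
qed

lemma fun_upd_Rd: "y \<in> Rd d \<Longrightarrow> i < d \<Longrightarrow> y(i := t) \<in> Rd d"
  by (auto simp: Rd_def PiE_iff extensional_def)

lemma open_subset_Rd: "openin (top_of_set (Rd d)) \<Theta> \<Longrightarrow> x \<in> \<Theta> \<Longrightarrow> x \<in> Rd d"
  using openin_imp_subset by blast

lemma eventually_fun_upd_open:
  assumes \<Theta>: "openin (top_of_set (Rd d)) \<Theta>" and x: "x \<in> \<Theta>" and "i < d"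
  shows "\<forall>\<^sub>F t in nhds (x i). x(i := t) \<in> \<Theta>"
proof -
  obtain \<delta> where \<delta>: "\<delta> > 0" "\<forall>y\<in>Rd d. (\<forall>j<d. \<bar>y j - x j\<bar> < \<delta>) \<longrightarrow> y \<in> \<Theta>" using open_Rd_box[OF \<Theta> x] by blast
  show ?thesis unfolding eventually_nhds_metric
    using \<delta> fun_upd_Rd[OF open_subset_Rd[OF \<Theta> x] \<open>i < d\<close>]
    by (intro exI[of _ \<delta>]) (auto simp: dist_real_def)
qed

lemma partial_cong_open:
  assumes \<Theta>: "openin (top_of_set (Rd d)) \<Theta>" and x: "x \<in> \<Theta>" and "i < d" and eq: "\<And>y. y \<in> \<Theta> \<Longrightarrow> f y = g y"
  shows "partial i f x = partial i g x"
  unfolding partial_def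
  by (rule deriv_cong_ev) (use eventually_fun_upd_open[OF \<Theta> x \<open>i < d\<close>] eq in \<open>auto elim: eventually_mono\<close>)

section \<open>The chain rule along lines\<close>

definition C1 :: "nat \<Rightarrow> (nat \<Rightarrow> real) set \<Rightarrow> ((nat \<Rightarrow> real) \<Rightarrow> real) \<Rightarrow> bool" where
  "C1 d \<Theta> f \<longleftrightarrow> (\<forall>i<d. \<forall>x\<in>\<Theta>. (\<lambda>t. f (x(i := t))) differentiable at (x i)) \<and> (\<forall>i<d. continuous_on \<Theta> (partial i f))"

lemma C1_has_partial:
  assumes "C1 d \<Theta> f" "i < d" "x \<in> \<Theta>"
  shows "((\<lambda>t. f (x(i := t))) has_real_derivative partial i f x) (at (x i))"
  using assms unfolding C1_def partial_def by (metis DERIV_deriv_iff_real_differentiable)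

lemma C1_has_partial_upd:
  assumes "C1 d \<Theta> f" "i < d" "x(i := \<tau>) \<in> \<Theta>"
  shows "((\<lambda>t. f (x(i := t))) has_real_derivative partial i f (x(i := \<tau>))) (at \<tau>)"
  using C1_has_partial[OF assms] by simp

lemma mvt_between:
  fixes g :: "real \<Rightarrow> real"
  assumes "\<And>\<tau>. min a b \<le> \<tau> \<Longrightarrow> \<tau> \<le> max a b \<Longrightarrow> (g has_real_derivative g' \<tau>) (at \<tau>)"
  shows "\<exists>\<xi>. min a b \<le> \<xi> \<and> \<xi> \<le> max a b \<and> g b - g a = (b - a) * g' \<xi>"
proof -
  consider "a < b" | "b < a" | "a = b" by linarith
  thus ?thesis
  proof cases
    case 1
    obtain z where "a < z" "z < b" "g b - g a = (b - a) * g' z"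
      using MVT2[OF 1, of g g'] assms 1 by auto
    thus ?thesis using 1 by (intro exI[of _ z]) auto
  next
    case 2
    obtain z where "b < z" "z < a" "g a - g b = (a - b) * g' z"
      using MVT2[OF 2, of g g'] assms 2 by auto
    thus ?thesis using 2 by (intro exI[of _ z]) (auto simp: algebra_simps)
  qed auto
qed

definition lin :: "nat \<Rightarrow> (nat \<Rightarrow> real) \<Rightarrow> (nat \<Rightarrow> real) \<Rightarrow> real \<Rightarrow> nat \<Rightarrow> real" where
  "lin d x w t = (\<lambda>i\<in>{..<d}. x i + t * w i)"

lemma lin_Rd [simp]: "lin d x w t \<in> Rd d" by (simp add: lin_def Rd_def)
lemma lin_0: "x \<in> Rd d \<Longrightarrow> lin d x w 0 = x" by (simp add: lin_def Rd_def PiE_restrict)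
lemma lin_add: "lin d x w (t + u) = lin d (lin d x w t) w u" by (auto simp: lin_def algebra_simps)

text \<open>The increment is telescoped along the staircase \<open>p k\<close>, in which the first
  \<open>k\<close> coordinates have been moved; the mean value theorem applies to each step, and
  continuity replaces the intermediate partial derivatives by those at \<open>x\<close>.\<close>

lemma directional_derivative_at_0:
  assumes \<Theta>: "openin (top_of_set (Rd d)) \<Theta>" and x: "x \<in> \<Theta>" and f: "C1 d \<Theta> f"
  shows "((\<lambda>t. f (lin d x w t)) has_real_derivative (\<Sum>i<d. w i * partial i f x)) (at 0)"
  unfolding DERIV_def
proof (rule LIM_I)
  fix r :: real assume "r > 0"
  \<comment> \<open>The added 1 keeps \<open>W\<close> positive for \<open>w = 0\<close> and makes
    the final estimate strict.\<close>
  define W where "W = 1 + (\<Sum>i<d. \<bar>w i\<bar>)"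
  have W: "W > 0" unfolding W_def by (intro add_pos_nonneg sum_nonneg) auto
  have Wi: "\<bar>w i\<bar> < W" if "i < d" for i
    using member_le_sum[of i "{..<d}" "\<lambda>i. \<bar>w i\<bar>"] that by (simp add: W_def)
  define e where "e = r / W"
  have e: "e > 0" using \<open>r > 0\<close> W by (simp add: e_def)
  have xR: "x \<in> Rd d" using open_subset_Rd[OF \<Theta> x] .
  have "\<forall>i. \<exists>\<delta>>0. i < d \<longrightarrow> (\<forall>y\<in>Rd d. (\<forall>j<d. \<bar>y j - x j\<bar> < \<delta>) \<longrightarrow> y \<in> \<Theta> \<and> \<bar>partial i f y - partial i f x\<bar> < e)"
  proof
    fix i show "\<exists>\<delta>>0. i < d \<longrightarrow> (\<forall>y\<in>Rd d. (\<forall>j<d. \<bar>y j - x j\<bar> < \<delta>) \<longrightarrow> y \<in> \<Theta> \<and> \<bar>partial i f y - partial i f x\<bar> < e)"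
    proof (cases "i < d")
      case True
      hence "continuous_on \<Theta> (partial i f)" using f by (simp add: C1_def)
      from continuous_on_box[OF \<Theta> x this e] show ?thesis by blast
    qed (auto intro: exI[of _ 1])
  qed
  then obtain \<Delta> where \<Delta>: "\<And>i. \<Delta> i > 0"
    "\<And>i y. i < d \<Longrightarrow> y \<in> Rd d \<Longrightarrow> (\<forall>j<d. \<bar>y j - x j\<bar> < \<Delta> i) \<Longrightarrow> y \<in> \<Theta> \<and> \<bar>partial i f y - partial i f x\<bar> < e"
    by metis
  define \<delta> where "\<delta> = Min (insert 1 (\<Delta> ` {..<d}))"
  have \<delta>: "\<delta> > 0" "\<And>i. i < d \<Longrightarrow> \<delta> \<le> \<Delta> i" using \<Delta>(1) by (auto simp: \<delta>_def)
  show "\<exists>s>0. \<forall>t. t \<noteq> 0 \<and> norm (t - 0) < s \<longrightarrow>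
     norm ((f (lin d x w (0 + t)) - f (lin d x w 0)) / t - (\<Sum>i<d. w i * partial i f x)) < r"
  proof (intro exI[of _ "\<delta> / W"] conjI allI impI)
    show "\<delta> / W > 0" using \<delta> W by simp
    fix t :: real assume t: "t \<noteq> 0 \<and> norm (t - 0) < \<delta> / W"
    hence tW: "\<bar>t\<bar> * W < \<delta>" using W by (simp add: field_simps)
    have tw: "\<bar>t * w i\<bar> < \<delta>" if "i < d" for i
    proof -
      have "\<bar>t * w i\<bar> \<le> \<bar>t\<bar> * W" using Wi[OF that] by (simp add: abs_mult mult_left_mono)
      thus ?thesis using tW by linarith
    qed
    define p where "p k = (\<lambda>i\<in>{..<d}. if i < k then x i + t * w i else x i)" for k
    have step: "\<bar>f (p (Suc k)) - f (p k) - t * (w k * partial k f x)\<bar> \<le> \<bar>t\<bar> * \<bar>w k\<bar> * e" if k: "k < d" for k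
    proof -
      have upd: "(p k)(k := \<tau>) \<in> Rd d \<and> (\<forall>j<d. \<bar>((p k)(k := \<tau>)) j - x j\<bar> < \<Delta> k)"
        if "min (x k) (x k + t * w k) \<le> \<tau>" "\<tau> \<le> max (x k) (x k + t * w k)" for \<tau>
      proof (intro conjI allI impI)
        show "(p k)(k := \<tau>) \<in> Rd d" using k by (intro fun_upd_Rd) (auto simp: p_def Rd_def)
        fix j assume j: "j < d"
        have "\<bar>((p k)(k := \<tau>)) j - x j\<bar> < \<delta>"
          using tw[OF j] tw[OF k] that j \<delta>(1) by (auto simp: p_def min_def max_def split: if_splits)
        thus "\<bar>((p k)(k := \<tau>)) j - x j\<bar> < \<Delta> k" using \<delta>(2)[OF k] by linarith
      qed
      have "\<exists>\<xi>. min (x k) (x k + t * w k) \<le> \<xi> \<and> \<xi> \<le> max (x k) (x k + t * w k) \<and>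
        f ((p k)(k := x k + t * w k)) - f ((p k)(k := x k)) = (x k + t * w k - x k) * partial k f ((p k)(k := \<xi>))"
        by (rule mvt_between, rule C1_has_partial_upd[OF f k]) (use upd \<Delta>(2)[OF k] in blast)
      then obtain \<xi> where \<xi>: "min (x k) (x k + t * w k) \<le> \<xi>" "\<xi> \<le> max (x k) (x k + t * w k)"
        "f ((p k)(k := x k + t * w k)) - f ((p k)(k := x k)) = (t * w k) * partial k f ((p k)(k := \<xi>))" by auto
      have "(p k)(k := x k + t * w k) = p (Suc k)" "(p k)(k := x k) = p k"
        using k by (auto simp: p_def fun_eq_iff)
      hence "f (p (Suc k)) - f (p k) - t * (w k * partial k f x) = t * w k * (partial k f ((p k)(k := \<xi>)) - partial k f x)"
        using \<xi>(3) by (simp add: algebra_simps)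
      moreover have "\<bar>partial k f ((p k)(k := \<xi>)) - partial k f x\<bar> \<le> e"
        using \<Delta>(2)[OF k] upd[OF \<xi>(1,2)] by (meson less_imp_le)
      ultimately show ?thesis by (simp add: abs_mult mult_left_mono)
    qed
    have "p d = lin d x w t" by (auto simp: p_def lin_def)
    moreover have "p 0 = x" using xR by (simp add: p_def Rd_def PiE_restrict)
    ultimately have "f (lin d x w t) - f x - t * (\<Sum>i<d. w i * partial i f x) = (\<Sum>k<d. f (p (Suc k)) - f (p k) - t * (w k * partial k f x))"
      using sum_lessThan_telescope[of "\<lambda>k. f (p k)" d] by (simp add: sum_subtractf sum_distrib_left)
    also have "\<bar>\<dots>\<bar> \<le> (\<Sum>k<d. \<bar>t\<bar> * \<bar>w k\<bar> * e)"
      by (rule order_trans[OF sum_abs sum_mono]) (use step in auto)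
    also have "\<dots> = \<bar>t\<bar> * e * (W - 1)"
      by (simp add: W_def sum_distrib_left sum_distrib_right mult_ac)
    also have "\<dots> < \<bar>t\<bar> * e * W" using t e by (intro mult_strict_left_mono) auto
    also have "\<dots> = \<bar>t\<bar> * r" using W by (simp add: e_def)
    finally have "\<bar>f (lin d x w t) - f x - t * (\<Sum>i<d. w i * partial i f x)\<bar> / \<bar>t\<bar> < r"
      using t by (simp add: pos_divide_less_eq mult.commute)
    moreover have "(f (lin d x w t) - f x) / t - (\<Sum>i<d. w i * partial i f x) = (f (lin d x w t) - f x - t * (\<Sum>i<d. w i * partial i f x)) / t"
      using t by (simp add: diff_divide_distrib)
    ultimately show "norm ((f (lin d x w (0 + t)) - f (lin d x w 0)) / t - (\<Sum>i<d. w i * partial i f x)) < r"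
      using lin_0[OF xR] by (simp add: abs_divide)
  qed
qed

lemma directional_derivative:
  assumes \<Theta>: "openin (top_of_set (Rd d)) \<Theta>" and x: "lin d x w t \<in> \<Theta>" and f: "C1 d \<Theta> f"
  shows "((\<lambda>t. f (lin d x w t)) has_real_derivative (\<Sum>i<d. w i * partial i f (lin d x w t))) (at t)"
  using directional_derivative_at_0[OF \<Theta> x f, of w] DERIV_shift[of "\<lambda>t. f (lin d x w t)" _ 0 t]
  by (simp add: lin_add[symmetric] add.commute)

subsection \<open>Symmetry of second derivatives\<close>

text \<open>Two applications of the mean value theorem to the second difference over a square of
  side \<open>h\<close>. The left side is symmetric in \<open>i\<close> and \<open>j\<close>, which
  is the source of the symmetry of mixed derivatives.\<close>

lemma second_difference_mvt:
  assumes f: "C1 d \<Theta> f" and fi: "C1 d \<Theta> (partial i f)" and ij: "i < d" "j < d" "i \<noteq> j" and "h > 0"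
    and box: "\<And>a b. \<bar>a - x i\<bar> \<le> h \<Longrightarrow> \<bar>b - x j\<bar> \<le> h \<Longrightarrow> x(i := a, j := b) \<in> \<Theta>"
  shows "\<exists>a b. \<bar>a - x i\<bar> \<le> h \<and> \<bar>b - x j\<bar> \<le> h \<and>
    f (x(i := x i + h, j := x j + h)) - f (x(i := x i + h, j := x j)) - f (x(i := x i, j := x j + h)) + f (x(i := x i, j := x j))
      = h * (h * partial j (partial i f) (x(i := a, j := b)))"
proof -
  have tw: "x(i := a, j := b) = (x(j := b))(i := a)" for a b using ij(3) by (simp add: fun_upd_twist)
  define g where "g a = f (x(i := a, j := x j + h)) - f (x(i := a, j := x j))" for a
  have "\<exists>\<xi>. min (x i) (x i + h) \<le> \<xi> \<and> \<xi> \<le> max (x i) (x i + h) \<and> g (x i + h) - g (x i)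
     = (x i + h - x i) * (partial i f (x(i := \<xi>, j := x j + h)) - partial i f (x(i := \<xi>, j := x j)))"
  proof (rule mvt_between)
    fix \<tau> assume "min (x i) (x i + h) \<le> \<tau>" "\<tau> \<le> max (x i) (x i + h)"
    hence "\<bar>\<tau> - x i\<bar> \<le> h" using \<open>h > 0\<close> by (auto simp: min_def max_def split: if_splits)
    hence "x(i := \<tau>, j := x j + h) \<in> \<Theta>" "x(i := \<tau>, j := x j) \<in> \<Theta>" using box \<open>h > 0\<close> by auto
    thus "(g has_real_derivative partial i f (x(i := \<tau>, j := x j + h)) - partial i f (x(i := \<tau>, j := x j))) (at \<tau>)"
      unfolding g_def tw by (intro DERIV_diff C1_has_partial_upd[OF f ij(1)])
  qed
  then obtain \<xi> where \<xi>0: "min (x i) (x i + h) \<le> \<xi>" "\<xi> \<le> max (x i) (x i + h)" "g (x i + h) - g (x i)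
     = (x i + h - x i) * (partial i f (x(i := \<xi>, j := x j + h)) - partial i f (x(i := \<xi>, j := x j)))" by blast
  have \<xi>: "\<bar>\<xi> - x i\<bar> \<le> h" "g (x i + h) - g (x i) = h * (partial i f (x(i := \<xi>, j := x j + h)) - partial i f (x(i := \<xi>, j := x j)))"
    using \<xi>0 \<open>h > 0\<close> by auto
  have "\<exists>\<eta>. min (x j) (x j + h) \<le> \<eta> \<and> \<eta> \<le> max (x j) (x j + h) \<and>
     partial i f ((x(i := \<xi>))(j := x j + h)) - partial i f ((x(i := \<xi>))(j := x j)) = (x j + h - x j) * partial j (partial i f) (x(i := \<xi>, j := \<eta>))"
  proof (rule mvt_between)
    fix \<tau> assume "min (x j) (x j + h) \<le> \<tau>" "\<tau> \<le> max (x j) (x j + h)"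
    hence "\<bar>\<tau> - x j\<bar> \<le> h" using \<open>h > 0\<close> by (auto simp: min_def max_def split: if_splits)
    thus "((\<lambda>b. partial i f ((x(i := \<xi>))(j := b))) has_real_derivative partial j (partial i f) (x(i := \<xi>, j := \<tau>))) (at \<tau>)"
      using box[OF \<xi>(1)] by (intro C1_has_partial_upd[OF fi ij(2)]) auto
  qed
  then obtain \<eta> where \<eta>0: "min (x j) (x j + h) \<le> \<eta>" "\<eta> \<le> max (x j) (x j + h)"
     "partial i f (x(i := \<xi>, j := x j + h)) - partial i f (x(i := \<xi>, j := x j)) = (x j + h - x j) * partial j (partial i f) (x(i := \<xi>, j := \<eta>))"
    by blast
  have "\<bar>\<eta> - x j\<bar> \<le> h"
    "partial i f (x(i := \<xi>, j := x j + h)) - partial i f (x(i := \<xi>, j := x j)) = h * partial j (partial i f) (x(i := \<xi>, j := \<eta>))"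
    using \<eta>0 \<open>h > 0\<close> by auto
  thus ?thesis using \<xi> by (intro exI[of _ \<xi>] exI[of _ \<eta>]) (auto simp: g_def algebra_simps)
qed

lemma partial_commute:
  assumes \<Theta>: "openin (top_of_set (Rd d)) \<Theta>" and x: "x \<in> \<Theta>" and f: "C1 d \<Theta> f"
    and fi: "C1 d \<Theta> (partial i f)" and fj: "C1 d \<Theta> (partial j f)" and ij: "i < d" "j < d"
  shows "partial i (partial j f) x = partial j (partial i f) x"
proof (cases "i = j")
  case False
  have "\<bar>partial i (partial j f) x - partial j (partial i f) x\<bar> \<le> e" if "e > 0" for e
  proof -
    have c: "continuous_on \<Theta> (partial i (partial j f))" "continuous_on \<Theta> (partial j (partial i f))"
      using fi fj ij by (auto simp: C1_def)
    have e2: "e / 2 > 0" using that by simp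
    obtain \<delta> where \<delta>: "\<delta> > 0" "\<And>y. y \<in> Rd d \<Longrightarrow> (\<forall>l<d. \<bar>y l - x l\<bar> < \<delta>) \<Longrightarrow> y \<in> \<Theta> \<and> \<bar>partial i (partial j f) y - partial i (partial j f) x\<bar> < e / 2"
      using continuous_on_box[OF \<Theta> x c(1) e2] by blast
    obtain \<delta>' where \<delta>': "\<delta>' > 0" "\<And>y. y \<in> Rd d \<Longrightarrow> (\<forall>l<d. \<bar>y l - x l\<bar> < \<delta>') \<Longrightarrow> y \<in> \<Theta> \<and> \<bar>partial j (partial i f) y - partial j (partial i f) x\<bar> < e / 2"
      using continuous_on_box[OF \<Theta> x c(2) e2] by blast
    define h where "h = min \<delta> \<delta>' / 2"
    have h: "h > 0" "h < \<delta>" "h < \<delta>'" using \<delta>(1) \<delta>'(1) by (auto simp: h_def)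
    have near: "x(i := a, j := b) \<in> Rd d" "\<And>l. l < d \<Longrightarrow> \<bar>(x(i := a, j := b)) l - x l\<bar> \<le> h"
      if "\<bar>a - x i\<bar> \<le> h" "\<bar>b - x j\<bar> \<le> h" for a b
      using that h(1) by (auto intro!: fun_upd_Rd ij open_subset_Rd[OF \<Theta> x])
    have box: "x(i := a, j := b) \<in> \<Theta>" if "\<bar>a - x i\<bar> \<le> h" "\<bar>b - x j\<bar> \<le> h" for a b
      using \<delta>(2)[OF near(1)[OF that]] near(2)[OF that] h by (meson le_less_trans)
    have tw: "x(i := a, j := b) = x(j := b, i := a)" for a b using False by (simp add: fun_upd_twist)
    obtain a b where ab: "\<bar>a - x i\<bar> \<le> h" "\<bar>b - x j\<bar> \<le> h"
      "f (x(i := x i + h, j := x j + h)) - f (x(i := x i + h, j := x j)) - f (x(i := x i, j := x j + h)) + f (x(i := x i, j := x j))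
        = h * (h * partial j (partial i f) (x(i := a, j := b)))"
      using second_difference_mvt[OF f fi ij False h(1) box] by blast
    obtain b' a' where ab': "\<bar>b' - x j\<bar> \<le> h" "\<bar>a' - x i\<bar> \<le> h"
      "f (x(j := x j + h, i := x i + h)) - f (x(j := x j + h, i := x i)) - f (x(j := x j, i := x i + h)) + f (x(j := x j, i := x i))
        = h * (h * partial i (partial j f) (x(j := b', i := a')))"
      using second_difference_mvt[OF f fj ij(2,1) False[symmetric] h(1), of x] box unfolding tw by blast
    \<comment> \<open>The two orders of differentiation describe the same second difference; their
      intermediate points differ, but both lie within \<open>h\<close> of \<open>x\<close>.\<close>
    have "h * (h * partial j (partial i f) (x(i := a, j := b))) = h * (h * partial i (partial j f) (x(i := a', j := b')))"
      using ab(3) ab'(3) unfolding tw by linarith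
    hence "partial j (partial i f) (x(i := a, j := b)) = partial i (partial j f) (x(i := a', j := b'))" using h by simp
    moreover have "\<bar>partial i (partial j f) (x(i := a', j := b')) - partial i (partial j f) x\<bar> < e / 2"
      using \<delta>(2)[OF near(1)[OF ab'(2,1)]] near(2)[OF ab'(2,1)] h by (meson le_less_trans)
    moreover have "\<bar>partial j (partial i f) (x(i := a, j := b)) - partial j (partial i f) x\<bar> < e / 2"
      using \<delta>'(2)[OF near(1)[OF ab(1,2)]] near(2)[OF ab(1,2)] h by (meson le_less_trans)
    ultimately show ?thesis by linarith
  qed
  hence "\<bar>partial i (partial j f) x - partial j (partial i f) x\<bar> \<le> 0" by (rule field_le_epsilon) auto
  thus ?thesis by simp
qed simp

subsection \<open>Iterated partial derivatives\<close>

lemma multi_idx_0: "multi_idx d 0 = {[]}" by (auto simp: multi_idx_def)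

lemma multi_idx_Suc: "multi_idx d (Suc k) = (\<lambda>(i, is). i # is) ` ({..<d} \<times> multi_idx d k)"
  by (auto simp: multi_idx_def length_Suc_conv image_iff)

lemma finite_multi_idx [simp]: "finite (multi_idx d k)"
  by (induction k) (auto simp: multi_idx_0 multi_idx_Suc)

lemma sum_multi_idx_Suc: "(\<Sum>is\<in>multi_idx d (Suc k). F is) = (\<Sum>i<d. \<Sum>is\<in>multi_idx d k. F (i # is))"
proof -
  have "inj_on (\<lambda>(i, is). i # is) ({..<d} \<times> multi_idx d k)" by (auto simp: inj_on_def)
  hence "(\<Sum>is\<in>multi_idx d (Suc k). F is) = (\<Sum>(i, is)\<in>{..<d} \<times> multi_idx d k. F (i # is))"
    unfolding multi_idx_Suc by (subst sum.reindex) (auto intro!: sum.cong)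
  thus ?thesis by (simp add: sum.cartesian_product)
qed

lemma Ck_on_C1:
  assumes "Ck_on d k \<Theta> f" "is \<in> multi_idx d m" "m < k"
  shows "C1 d \<Theta> (partials is f)"
proof -
  have "continuous_on \<Theta> (partials (i # is) f)" if "i < d" for i
  proof -
    have "i # is \<in> multi_idx d (Suc m)" using assms(2) that by (auto simp: multi_idx_Suc)
    moreover have "Suc m \<le> k" using assms(3) by simp
    ultimately show ?thesis using assms(1) unfolding Ck_on_def by blast
  qed
  thus ?thesis using assms unfolding C1_def Ck_on_def by auto
qed

lemma partials_pot:
  assumes \<Theta>: "openin (top_of_set (Rd d)) \<Theta>" and f: "Ck_on d k \<Theta> f"
    and "is \<in> multi_idx d m" "m \<le> k" "x \<in> \<Theta>"
  shows "partials is (pot n f) x = n * partials is f x"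
  using assms(3-5)
proof (induction m arbitrary: "is" x)
  case 0
  thus ?case by (simp add: multi_idx_0 pot_def)
next
  case (Suc m)
  then obtain i js where i: "is = i # js" "i < d" "js \<in> multi_idx d m" by (auto simp: multi_idx_Suc)
  have "partials is (pot n f) x = partial i (\<lambda>y. n * partials js f y) x"
    unfolding i partials.simps by (rule partial_cong_open[OF \<Theta> Suc.prems(3) i(2)]) (use Suc i in auto)
  also have "\<dots> = n * partial i (partials js f) x"
  proof -
    have "((\<lambda>t. n * partials js f (x(i := t))) has_real_derivative n * partial i (partials js f) x) (at (x i))"
      using Suc.prems by (intro DERIV_cmult C1_has_partial[OF Ck_on_C1[OF f i(3)] i(2)]) auto
    thus ?thesis unfolding partial_def[of i "\<lambda>y. n * partials js f y"] by (rule DERIV_imp_deriv)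
  qed
  finally show ?case by (simp add: i)
qed

lemma Ck_on_pot:
  assumes \<Theta>: "openin (top_of_set (Rd d)) \<Theta>" and f: "Ck_on d k \<Theta> f"
  shows "Ck_on d k \<Theta> (pot n f)"
  unfolding Ck_on_def
proof (intro conjI allI impI ballI)
  fix m "is" i x assume m: "m < k" "is \<in> multi_idx d m" "i < d" "x \<in> \<Theta>"
  have "((\<lambda>t. n * partials is f (x(i := t))) has_real_derivative n * partial i (partials is f) x) (at (x i))"
    using m by (intro DERIV_cmult C1_has_partial[OF Ck_on_C1[OF f m(2)]]) auto
  moreover have "\<forall>\<^sub>F t in nhds (x i). partials is (pot n f) (x(i := t)) = n * partials is f (x(i := t))"
    using eventually_fun_upd_open[OF \<Theta> m(4,3)]
    by eventually_elim (use partials_pot[OF \<Theta> f m(2)] m(1) in auto)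
  ultimately have "((\<lambda>t. partials is (pot n f) (x(i := t))) has_real_derivative n * partial i (partials is f) x) (at (x i))"
    by (subst DERIV_cong_ev[OF refl _ refl]) auto
  thus "(\<lambda>t. partials is (pot n f) (x(i := t))) differentiable at (x i)" by (auto simp: real_differentiable_def)
next
  fix m "is" assume m: "m \<le> k" "is \<in> multi_idx d m"
  have "continuous_on \<Theta> (\<lambda>x. n * partials is f x)"
    using f m unfolding Ck_on_def by (intro continuous_intros) blast
  thus "continuous_on \<Theta> (partials is (pot n f))"
    using partials_pot[OF \<Theta> f m(2,1)] by (simp cong: continuous_on_cong)
qed

text \<open>Each derivative along the line contracts one further slot, put in front, with
  \<open>w\<close>. Iterated, this yields the Taylor coefficients of the one-variable
  function.\<close>

lemma tinner_dtensor_derivative: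
  assumes \<Theta>: "openin (top_of_set (Rd d)) \<Theta>" and f: "Ck_on d k \<Theta> f" and "m < k" and x: "lin d x w t \<in> \<Theta>"
  shows "((\<lambda>t. tinner d m (dtensor f (lin d x w t)) (tpow w)) has_real_derivative
     tinner d (Suc m) (dtensor f (lin d x w t)) (tpow w)) (at t)"
proof -
  have "((\<lambda>t. \<Sum>is\<in>multi_idx d m. partials is f (lin d x w t) * tpow w is) has_real_derivative
     (\<Sum>is\<in>multi_idx d m. (\<Sum>i<d. w i * partial i (partials is f) (lin d x w t)) * tpow w is)) (at t)"
    by (intro DERIV_sum DERIV_cmult_right directional_derivative[OF \<Theta> x] Ck_on_C1[OF f _ \<open>m < k\<close>])
  also have "(\<Sum>is\<in>multi_idx d m. (\<Sum>i<d. w i * partial i (partials is f) (lin d x w t)) * tpow w is)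
    = (\<Sum>i<d. \<Sum>is\<in>multi_idx d m. partials (i # is) f (lin d x w t) * tpow w (i # is))"
    unfolding sum_distrib_right by (subst sum.swap) (simp add: tpow_def mult_ac)
  finally show ?thesis unfolding tinner_def dtensor_def sum_multi_idx_Suc .
qed

lemma taylor4:
  assumes \<Theta>: "openin (top_of_set (Rd d)) \<Theta>" and f: "Ck_on d 4 \<Theta> f" and x: "x \<in> Rd d"
    and seg: "\<And>t. 0 \<le> t \<Longrightarrow> t \<le> 1 \<Longrightarrow> lin d x w t \<in> \<Theta>"
  shows "\<exists>\<theta>. 0 < \<theta> \<and> \<theta> < 1 \<and> f (lin d x w 1) = f x + tinner d 1 (dtensor f x) (tpow w)
    + tinner d 2 (dtensor f x) (tpow w) / 2 + tinner d 3 (dtensor f x) (tpow w) / 6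
    + tinner d 4 (dtensor f (lin d x w \<theta>)) (tpow w) / 24"
proof -
  define D where "D m t = tinner d m (dtensor f (lin d x w t)) (tpow w)" for m t
  have "\<exists>t>0. t < 1 \<and> D 0 1 = (\<Sum>m<4. D m 0 / fact m * 1 ^ m) + D 4 t / fact 4 * 1 ^ 4"
  proof (rule Maclaurin)
    show "\<forall>m t. m < 4 \<and> 0 \<le> t \<and> t \<le> 1 \<longrightarrow> (D m has_real_derivative D (Suc m) t) (at t)"
      unfolding D_def using tinner_dtensor_derivative[OF \<Theta> f _ seg] by blast
  qed auto
  moreover have "tinner d 0 (dtensor f y) (tpow w) = f y" for y by (simp add: tinner_def multi_idx_0 dtensor_def tpow_def)
  ultimately show ?thesis
    by (simp add: D_def lin_0[OF x] eval_nat_numeral fact_numeral)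
qed

lemma partial_zero_at_min:
  assumes \<Theta>: "openin (top_of_set (Rd d)) \<Theta>" and f: "C1 d \<Theta> f" and x: "x \<in> \<Theta>" "i < d" and min: "\<And>y. y \<in> \<Theta> \<Longrightarrow> f x \<le> f y"
  shows "partial i f x = 0"
proof -
  obtain \<delta> where \<delta>: "\<delta> > 0" "\<And>y. y \<in> Rd d \<Longrightarrow> (\<forall>j<d. \<bar>y j - x j\<bar> < \<delta>) \<Longrightarrow> y \<in> \<Theta>" using open_Rd_box[OF \<Theta> x(1)] by blast
  have "x(i := t) \<in> \<Theta>" if "\<bar>x i - t\<bar> < \<delta>" for t
    using that \<delta>(1) by (intro \<delta>(2) fun_upd_Rd[OF open_subset_Rd[OF \<Theta> x(1)] x(2)]) auto
  thus ?thesis using DERIV_local_min[OF C1_has_partial[OF f x(2,1)] \<delta>(1)] min by simp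
qed

lemma partials3_symmetric:
  assumes \<Theta>: "openin (top_of_set (Rd d)) \<Theta>" and f: "Ck_on d 4 \<Theta> f" and x: "x \<in> \<Theta>" and "a < d" "b < d" "c < d"
  shows "partials [a, b, c] f x = partials [b, a, c] f x" "partials [a, b, c] f x = partials [a, c, b] f x"
proof -
  have C0: "C1 d \<Theta> f" using Ck_on_C1[OF f, of "[]" 0] by (simp add: multi_idx_0)
  have C1': "C1 d \<Theta> (partial i f)" if "i < d" for i using Ck_on_C1[OF f, of "[i]" 1] that by (simp add: multi_idx_def)
  have C2: "C1 d \<Theta> (partial j (partial i f))" if "i < d" "j < d" for i j
    using Ck_on_C1[OF f, of "[j, i]" 2] that by (simp add: multi_idx_def)
  show "partials [a, b, c] f x = partials [b, a, c] f x"
    using partial_commute[OF \<Theta> x C1' C2 C2] assms by simp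
  have "partial b (partial c f) y = partial c (partial b f) y" if "y \<in> \<Theta>" for y
    using partial_commute[OF \<Theta> that C0 C1' C1'] assms by simp
  thus "partials [a, b, c] f x = partials [a, c, b] f x"
    using partial_cong_open[OF \<Theta> x \<open>a < d\<close>, of "partial b (partial c f)" "partial c (partial b f)"] by simp
qed

subsection \<open>Affine substitution\<close>

text \<open>An entry of the tensor power of \<open>R\<close>, the coefficient in the chain rule for
  an affine substitution.\<close>

fun rprod :: "mtrx \<Rightarrow> nat list \<Rightarrow> nat list \<Rightarrow> real" where
  "rprod R (j # js) (i # is) = R j i * rprod R js is"
| "rprod R _ _ = 1"

text \<open>The induction step for \<open>partials_affine\<close>. Lower derivatives of the composed
  function are known only as finite sums, and only where the image lies in \<Theta>, which is why
  \<open>G\<close> is compared with a sum there. Moving coordinate \<open>i\<close> of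
  \<open>y\<close> moves the image along column \<open>i\<close> of \<open>R\<close>.\<close>

lemma partial_affine_sum:
  assumes \<Theta>: "openin (top_of_set (Rd d)) \<Theta>" and M: "finite M" "\<And>m. m \<in> M \<Longrightarrow> C1 d \<Theta> (F m)"
    and y: "y \<in> Rd d" "vadd d c (matvec d R y) \<in> \<Theta>" and i: "i < d"
    and G: "\<And>y. y \<in> Rd d \<Longrightarrow> vadd d c (matvec d R y) \<in> \<Theta> \<Longrightarrow> G y = (\<Sum>m\<in>M. b m * F m (vadd d c (matvec d R y)))"
  shows "partial i G y = (\<Sum>j<d. \<Sum>m\<in>M. R j i * b m * partial j (F m) (vadd d c (matvec d R y)))"
proof -
  define x where "x = vadd d c (matvec d R y)"
  define w where "w j = R j i" for j
  have T: "vadd d c (matvec d R (y(i := t))) = lin d x w (t - y i)" for t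
  proof
    fix l
    show "vadd d c (matvec d R (y(i := t))) l = lin d x w (t - y i) l"
    proof (cases "l < d")
      case True
      have "(\<Sum>j<d. R l j * (y(i := t)) j) = (\<Sum>j<d. R l j * y j + (if j = i then R l i * (t - y i) else 0))"
        by (intro sum.cong) (auto simp: algebra_simps)
      also have "\<dots> = (\<Sum>j<d. R l j * y j) + R l i * (t - y i)" using i by (simp add: sum.distrib)
      finally show ?thesis using True by (simp add: vadd_def matvec_def lin_def x_def w_def mult.commute)
    qed (simp add: vadd_def lin_def)
  qed
  have xR: "x \<in> Rd d" by (simp add: x_def vadd_def Rd_def)
  have xT: "x \<in> \<Theta>" using y by (simp add: x_def)
  have "((\<lambda>t. \<Sum>m\<in>M. b m * F m (lin d x w (t - y i))) has_real_derivative (\<Sum>m\<in>M. b m * (\<Sum>j<d. w j * partial j (F m) x))) (at (y i))"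
  proof (intro DERIV_sum DERIV_cmult)
    fix m assume "m \<in> M"
    have "((\<lambda>u. F m (lin d x w u)) has_real_derivative (\<Sum>j<d. w j * partial j (F m) x)) (at (y i + - y i))"
      using directional_derivative_at_0[OF \<Theta> xT M(2)[OF \<open>m \<in> M\<close>], of w] by simp
    thus "((\<lambda>t. F m (lin d x w (t - y i))) has_real_derivative (\<Sum>j<d. w j * partial j (F m) x)) (at (y i))"
      by (subst (asm) DERIV_shift) simp
  qed
  moreover have "\<forall>\<^sub>F t in nhds (y i). G (y(i := t)) = (\<Sum>m\<in>M. b m * F m (lin d x w (t - y i)))"
  proof -
    obtain \<delta> where \<delta>: "\<delta> > 0" "\<And>y. y \<in> Rd d \<Longrightarrow> (\<forall>j<d. \<bar>y j - x j\<bar> < \<delta>) \<Longrightarrow> y \<in> \<Theta>" using open_Rd_box[OF \<Theta> xT] by blast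
    define W where "W = 1 + (\<Sum>i<d. \<bar>w i\<bar>)"
    have W: "W > 0" unfolding W_def by (intro add_pos_nonneg sum_nonneg) auto
    have Wi: "\<bar>w j\<bar> \<le> W" if "j < d" for j
      using member_le_sum[of j "{..<d}" "\<lambda>i. \<bar>w i\<bar>"] that by (simp add: W_def)
    show ?thesis unfolding eventually_nhds_metric
    proof (intro exI[of _ "\<delta> / W"] conjI allI impI)
      show "\<delta> / W > 0" using \<delta> W by simp
      fix t assume "dist t (y i) < \<delta> / W"
      hence tW: "\<bar>t - y i\<bar> * W < \<delta>" using W by (simp add: dist_real_def field_simps)
      have "lin d x w (t - y i) \<in> \<Theta>"
      proof (intro \<delta>(2) allI impI)
        fix j assume j: "j < d"
        have "\<bar>lin d x w (t - y i) j - x j\<bar> = \<bar>t - y i\<bar> * \<bar>w j\<bar>" using j by (simp add: lin_def abs_mult)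
        also have "\<dots> \<le> \<bar>t - y i\<bar> * W" using Wi[OF j] by (intro mult_left_mono) auto
        finally show "\<bar>lin d x w (t - y i) j - x j\<bar> < \<delta>" using tW by simp
      qed simp
      thus "G (y(i := t)) = (\<Sum>m\<in>M. b m * F m (lin d x w (t - y i)))"
        using G[OF fun_upd_Rd[OF y(1) i], of t] by (simp add: T)
    qed
  qed
  ultimately have "((\<lambda>t. G (y(i := t))) has_real_derivative (\<Sum>m\<in>M. b m * (\<Sum>j<d. w j * partial j (F m) x))) (at (y i))"
    by (subst DERIV_cong_ev[OF refl _ refl]) auto
  hence "partial i G y = (\<Sum>m\<in>M. b m * (\<Sum>j<d. w j * partial j (F m) x))"
    unfolding partial_def by (rule DERIV_imp_deriv)
  also have "\<dots> = (\<Sum>j<d. \<Sum>m\<in>M. R j i * b m * partial j (F m) x)"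
    unfolding sum_distrib_left by (subst sum.swap) (simp add: w_def mult_ac)
  finally show ?thesis by (simp add: x_def)
qed

lemma partials_affine:
  assumes \<Theta>: "openin (top_of_set (Rd d)) \<Theta>" and f: "Ck_on d k \<Theta> f"
    and "is \<in> multi_idx d m" "m \<le> k" "y \<in> Rd d" "vadd d c (matvec d R y) \<in> \<Theta>"
  shows "partials is (\<lambda>y. f (vadd d c (matvec d R y))) y = (\<Sum>js\<in>multi_idx d m. rprod R js is * partials js f (vadd d c (matvec d R y)))"
  using assms(3-6)
proof (induction m arbitrary: "is" y)
  case 0
  thus ?case by (simp add: multi_idx_0)
next
  case (Suc m)
  then obtain i l where i: "is = i # l" "i < d" "l \<in> multi_idx d m" by (auto simp: multi_idx_Suc)
  have "partials is (\<lambda>y. f (vadd d c (matvec d R y))) y =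
    (\<Sum>j<d. \<Sum>js\<in>multi_idx d m. R j i * rprod R js l * partial j (partials js f) (vadd d c (matvec d R y)))"
    unfolding i partials.simps
    by (rule partial_affine_sum[OF \<Theta> finite_multi_idx Ck_on_C1[OF f] Suc.prems(3,4) i(2)]) (use Suc i in auto)
  thus ?case by (simp add: sum_multi_idx_Suc i)
qed

section \<open>Cubic forms\<close>

definition cubic :: "nat \<Rightarrow> (nat \<Rightarrow> nat \<Rightarrow> nat \<Rightarrow> real) \<Rightarrow> (nat \<Rightarrow> real) \<Rightarrow> real" where
  "cubic d Q z = (\<Sum>a<d. \<Sum>b<d. \<Sum>c<d. Q a b c * (z a * z b * z c))"

text \<open>The derivative of \<open>cubic d Q\<close> at \<open>y\<close> in direction
  \<open>u\<close>, written so that it is correct for \<open>Q\<close> without symmetry.\<close>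

definition cubic_deriv :: "nat \<Rightarrow> (nat \<Rightarrow> nat \<Rightarrow> nat \<Rightarrow> real) \<Rightarrow> (nat \<Rightarrow> real) \<Rightarrow> (nat \<Rightarrow> real) \<Rightarrow> real" where
  "cubic_deriv d Q y u = (\<Sum>a<d. \<Sum>b<d. \<Sum>c<d. Q a b c * (u a * y b * y c + y a * u b * y c + y a * y b * u c))"

lemma cubic_add: "cubic d Q (\<lambda>i. y i + h * u i) = cubic d Q y + h * cubic_deriv d Q y u + h\<^sup>2 * cubic_deriv d Q u y + h ^ 3 * cubic d Q u"
  unfolding cubic_def cubic_deriv_def sum_distrib_left sum.distrib[symmetric]
  by (intro sum.cong refl) (simp add: power2_eq_square power3_eq_cube algebra_simps)

lemma cubic_deriv_add: "cubic_deriv d Q (\<lambda>i. y i + h * u i) u = cubic_deriv d Q y u + 2 * h * cubic_deriv d Q u y + 3 * h\<^sup>2 * cubic d Q u"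
  unfolding cubic_def cubic_deriv_def sum_distrib_left sum.distrib[symmetric]
  by (intro sum.cong refl) (simp add: power2_eq_square algebra_simps)

lemma cubic_deriv_scale: "cubic_deriv d Q (\<lambda>i. a * y i) (\<lambda>i. b * u i) = a\<^sup>2 * b * cubic_deriv d Q y u"
  unfolding cubic_deriv_def sum_distrib_left
  by (intro sum.cong refl) (simp add: power2_eq_square algebra_simps)

lemma nrm_L2_set: "nrm d x = L2_set x {..<d}"
  by (simp add: nrm_def ip_def L2_set_def power2_eq_square)

lemma nrm_triangle: "nrm d (\<lambda>i. x i + y i) \<le> nrm d x + nrm d y"
  unfolding nrm_L2_set by (rule L2_set_triangle_ineq)

lemma nrm_scale: "nrm d (\<lambda>i. c * x i) = \<bar>c\<bar> * nrm d x"
proof -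
  have "ip d (\<lambda>i. c * x i) (\<lambda>i. c * x i) = c\<^sup>2 * ip d x x"
    by (simp add: ip_def sum_distrib_left power2_eq_square mult_ac)
  thus ?thesis by (simp add: nrm_def real_sqrt_mult)
qed

lemma nrm_sq_sum: "(nrm d x)\<^sup>2 = (\<Sum>i<d. (x i)\<^sup>2)"
  unfolding nrm_sq ip_def by (simp add: power2_eq_square)

lemma nrm_eq_0: "nrm d x = 0 \<longleftrightarrow> (\<forall>i<d. x i = 0)"
  by (simp add: nrm_def ip_self_eq_0)

text \<open>Polarisation: for unit vectors, \<open>P (y + u/2) - P (y - u/2) = DP(y) u + P u / 4\<close>, and the
  parallelogram law bounds the sum of the cubes of the two norms on the left by \<open>15/4\<close>.\<close>

lemma cubic_deriv_bound:
  assumes P: "\<And>z. \<bar>cubic d Q z\<bar> \<le> \<kappa> * nrm d z ^ 3"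
  shows "\<bar>cubic_deriv d Q y u\<bar> \<le> 4 * \<kappa> * (nrm d y)\<^sup>2 * nrm d u"
proof (cases "nrm d y = 0 \<or> nrm d u = 0")
  case True
  have "cubic_deriv d Q y u = 0"
    unfolding cubic_deriv_def using True by (intro sum.neutral ballI) (auto simp: nrm_eq_0)
  thus ?thesis using True by auto
next
  case False
  hence pos: "nrm d y > 0" "nrm d u > 0" using nrm_nonneg[of d y] nrm_nonneg[of d u] by linarith+
  define y' where "y' i = (1 / nrm d y) * y i" for i
  define u' where "u' i = (1 / nrm d u) * u i" for i
  have unit: "nrm d y' = 1" "nrm d u' = 1"
    unfolding y'_def[abs_def] u'_def[abs_def] nrm_scale using pos by simp_all
  have kap: "\<kappa> \<ge> 0" using order_trans[OF abs_ge_zero P[of u']] unit by simp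
  define a where "a = nrm d (\<lambda>i. y' i + (1/2) * u' i)"
  define b where "b = nrm d (\<lambda>i. y' i + (-1/2) * u' i)"
  have ab0: "a \<ge> 0" "b \<ge> 0" by (auto simp: a_def b_def)
  have ab1: "a \<le> 3/2" "b \<le> 3/2"
    using nrm_triangle[of d y' "\<lambda>i. (1/2) * u' i"] nrm_triangle[of d y' "\<lambda>i. (-1/2) * u' i"] unit
    unfolding a_def b_def nrm_scale by auto
  have "a\<^sup>2 + b\<^sup>2 = (\<Sum>i<d. 2 * (y' i)\<^sup>2 + 1/2 * (u' i)\<^sup>2)"
    unfolding a_def b_def nrm_sq ip_def sum.distrib[symmetric]
    by (intro sum.cong refl) (simp add: power2_eq_square algebra_simps)
  also have "\<dots> = 2 * (nrm d y')\<^sup>2 + 1/2 * (nrm d u')\<^sup>2"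
    by (simp add: nrm_sq_sum sum.distrib sum_distrib_left)
  finally have ab2: "a\<^sup>2 + b\<^sup>2 = 5/2" by (simp add: unit)
  have "a ^ 3 + b ^ 3 \<le> 3/2 * a\<^sup>2 + 3/2 * b\<^sup>2"
    using mult_right_mono[OF ab1(1), of "a\<^sup>2"] mult_right_mono[OF ab1(2), of "b\<^sup>2"]
    by (simp add: power3_eq_cube power2_eq_square mult.assoc)
  hence cube: "a ^ 3 + b ^ 3 \<le> 15/4" using ab2 by simp
  define A where "A = cubic_deriv d Q y' u'"
  have "cubic d Q (\<lambda>i. y' i + (1/2) * u' i) - cubic d Q (\<lambda>i. y' i + (-1/2) * u' i) = A + 1/4 * cubic d Q u'"
    unfolding cubic_add A_def by (simp add: power2_eq_square power3_eq_cube)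
  hence "\<bar>A\<bar> \<le> \<bar>cubic d Q (\<lambda>i. y' i + (1/2) * u' i)\<bar> + \<bar>cubic d Q (\<lambda>i. y' i + (-1/2) * u' i)\<bar> + 1/4 * \<bar>cubic d Q u'\<bar>" by linarith
  also have "\<dots> \<le> \<kappa> * a ^ 3 + \<kappa> * b ^ 3 + 1/4 * (\<kappa> * 1)"
    unfolding a_def b_def using P[of u'] unit by (intro add_mono P mult_left_mono) auto
  also have "\<dots> = \<kappa> * (a ^ 3 + b ^ 3 + 1/4)" by (simp add: algebra_simps)
  also have "\<dots> \<le> \<kappa> * 4" using cube kap by (intro mult_left_mono) auto
  finally have A: "\<bar>A\<bar> \<le> 4 * \<kappa>" by simp
  have "cubic_deriv d Q y u = (nrm d y)\<^sup>2 * nrm d u * A"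
    unfolding A_def cubic_deriv_scale[symmetric] y'_def u'_def using pos by simp
  hence "\<bar>cubic_deriv d Q y u\<bar> = (nrm d y)\<^sup>2 * nrm d u * \<bar>A\<bar>" using pos by (simp add: abs_mult)
  also have "\<dots> \<le> (nrm d y)\<^sup>2 * nrm d u * (4 * \<kappa>)" using A by (intro mult_left_mono) auto
  finally show ?thesis by (simp add: mult_ac)
qed

lemma cubic_lipschitz:
  assumes P: "\<And>z. \<bar>cubic d Q z\<bar> \<le> \<kappa> * nrm d z ^ 3" and \<kappa>: "\<kappa> \<ge> 0" and xy: "nrm d x \<le> \<rho>" "nrm d y \<le> \<rho>"
  shows "\<bar>cubic d Q x - cubic d Q y\<bar> \<le> 4 * \<kappa> * \<rho>\<^sup>2 * nrm d (\<lambda>i. x i - y i)"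
proof -
  define u where "u i = x i - y i" for i
  define g where "g t = cubic d Q (\<lambda>i. y i + t * u i)" for t
  have g: "g = (\<lambda>t. cubic d Q y + t * cubic_deriv d Q y u + t\<^sup>2 * cubic_deriv d Q u y + t ^ 3 * cubic d Q u)"
    unfolding g_def cubic_add ..
  have "(g has_real_derivative cubic_deriv d Q (\<lambda>i. y i + t * u i) u) (at t)" for t
    unfolding g cubic_deriv_add by (auto intro!: derivative_eq_intros simp: power2_eq_square)
  then obtain t where t: "0 < t" "t < 1" "g 1 - g 0 = (1 - 0) * cubic_deriv d Q (\<lambda>i. y i + t * u i) u"
    using MVT2[of 0 1 g "\<lambda>t. cubic_deriv d Q (\<lambda>i. y i + t * u i) u"] by auto
  have "(\<lambda>i. y i + t * u i) = (\<lambda>i. (1 - t) * y i + t * x i)" by (auto simp: u_def algebra_simps)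
  hence "nrm d (\<lambda>i. y i + t * u i) \<le> (1 - t) * nrm d y + t * nrm d x"
    using nrm_triangle[of d "\<lambda>i. (1 - t) * y i" "\<lambda>i. t * x i"] t by (simp add: nrm_scale)
  also have "\<dots> \<le> (1 - t) * \<rho> + t * \<rho>" using t xy by (intro add_mono mult_left_mono) auto
  finally have n: "nrm d (\<lambda>i. y i + t * u i) \<le> \<rho>" by (simp add: algebra_simps)
  have "cubic d Q x - cubic d Q y = cubic_deriv d Q (\<lambda>i. y i + t * u i) u" using t by (simp add: g_def u_def)
  also have "\<bar>\<dots>\<bar> \<le> 4 * \<kappa> * (nrm d (\<lambda>i. y i + t * u i))\<^sup>2 * nrm d u" by (rule cubic_deriv_bound[OF P])
  also have "\<dots> \<le> 4 * \<kappa> * \<rho>\<^sup>2 * nrm d u"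
    using n \<kappa> by (intro mult_right_mono mult_left_mono power_mono) auto
  finally show ?thesis by (simp add: u_def[abs_def])
qed

subsection \<open>Moments of monomials\<close>

definition moment1 :: "nat \<Rightarrow> real" where "moment1 k = (\<integral>x. x ^ k \<partial>gauss1)"

lemma integrable_gauss1_power: "integrable gauss1 (\<lambda>x. x ^ k)"
  using integrable_std_normal_moment[of k]
  by (subst integrable_density) (auto simp: normal_density_nonneg)

lemma moment1_eq: "moment1 k = (\<integral>x. std_normal_density x * x ^ k \<partial>lborel)"
  unfolding moment1_def by (subst integral_density) (auto simp: normal_density_nonneg)

lemma moment1_odd: "moment1 (2 * k + 1) = 0"
  unfolding moment1_eq by (rule integral_std_normal_moment_odd)

lemma moment1_even: "moment1 (2 * k) = fact (2 * k) / (2 ^ k * fact k)"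
  unfolding moment1_eq by (rule integral_std_normal_moment_even)

text \<open>Gaussian integration by parts. At \<open>k = 0\<close> the truncated
  \<open>k - 1\<close> is harmless because the factor is 0.\<close>

lemma moment1_rec: "moment1 (Suc k) = real k * moment1 (k - 1)"
proof (cases "even k")
  case True
  then obtain m where m: "k = 2 * m" by auto
  show ?thesis
  proof (cases m)
    case 0
    thus ?thesis using moment1_odd[of 0] m by simp
  next
    case (Suc l)
    hence "k - 1 = 2 * l + 1" using m by simp
    thus ?thesis using moment1_odd[of m] moment1_odd[of l] m by simp
  qed
next
  case False
  then obtain m where m: "k = 2 * m + 1" by (auto elim: oddE)
  hence k: "Suc k = 2 * Suc m" "k - 1 = 2 * m" by auto
  have "fact (2 * Suc m) / (2 ^ Suc m * fact (Suc m)) = real (2 * m + 1) * (fact (2 * m) / (2 ^ m * fact m))"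
  proof -
    have "(fact (2 * Suc m) :: real) = real (2 * m + 2) * (real (2 * m + 1) * fact (2 * m))" by (simp add: algebra_simps)
    moreover have "(2 ^ Suc m * fact (Suc m) :: real) = real (2 * m + 2) * (2 ^ m * fact m)" by (simp add: algebra_simps)
    moreover have "real (2 * m + 2) \<noteq> 0" by linarith
    ultimately show ?thesis by (simp only: mult_divide_mult_cancel_left times_divide_eq_right not_False_eq_True)
  qed
  thus ?thesis unfolding k moment1_even using m by simp
qed

definition moment :: "nat \<Rightarrow> nat list \<Rightarrow> real" where
  "moment d xs = (\<Prod>j<d. moment1 (count_list xs j))"

lemma prod_list_count:
  fixes xs :: "nat list"
  assumes "set xs \<subseteq> {..<d}"
  shows "prod_list (map z xs) = (\<Prod>j<d. (z j :: real) ^ count_list xs j)"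
  using assms
proof (induction xs)
  case (Cons x xs)
  have "(\<Prod>j<d. z j ^ count_list (x # xs) j) = (\<Prod>j<d. (if j = x then z j else 1) * z j ^ count_list xs j)"
    by (intro prod.cong) auto
  also have "\<dots> = z x * (\<Prod>j<d. z j ^ count_list xs j)"
    using Cons.prems by (subst prod.distrib, subst prod.delta) auto
  finally show ?case using Cons by simp
qed simp

lemma
  assumes "set xs \<subseteq> {..<d}"
  shows integrable_monomial: "integrable (stdg d) (\<lambda>z. prod_list (map z xs))"
    and integral_monomial: "(\<integral>z. prod_list (map z xs) \<partial>stdg d) = moment d xs"
  unfolding prod_list_count[OF assms] stdg_def moment_def moment1_def
  by (rule gauss1.product_integrable_prod gauss1.product_integral_prod; simp add: integrable_gauss1_power)+

lemma moment_cong_mset: "mset xs = mset ys \<Longrightarrow> moment d xs = moment d ys"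
  unfolding moment_def by (intro prod.cong refl arg_cong[where f=moment1]) (metis count_mset)

lemma moment_Cons:
  assumes "i < d" shows "moment d (i # xs) = real (count_list xs i) * moment d (remove1 i xs)"
proof -
  have split: "moment d ys = moment1 (count_list ys i) * (\<Prod>j\<in>{..<d} - {i}. moment1 (count_list ys j))" for ys
    unfolding moment_def using assms by (intro prod.remove) auto
  have "count_list (remove1 i xs) j = (if j = i then count_list xs i - 1 else count_list xs j)" for j
    unfolding count_mset[symmetric] by simp
  hence "(\<Prod>j\<in>{..<d} - {i}. moment1 (count_list (i # xs) j)) = (\<Prod>j\<in>{..<d} - {i}. moment1 (count_list (remove1 i xs) j))"
    "count_list (remove1 i xs) i = count_list xs i - 1"
    by (auto intro!: prod.cong)
  thus ?thesis unfolding split by (simp add: moment1_rec)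
qed

text \<open>Wick's sum over the possible partners of \<open>i\<close>. The argument
  \<open>pre\<close> stores the entries already passed, so that deleting the current one leaves
  \<open>pre @ xs\<close>.\<close>

fun contractions :: "nat \<Rightarrow> nat \<Rightarrow> nat list \<Rightarrow> nat list \<Rightarrow> real" where
  "contractions d i pre [] = 0"
| "contractions d i pre (x # xs) = (if i = x then 1 else 0) * moment d (pre @ xs) + contractions d i (pre @ [x]) xs"

text \<open>A moment depends only on the multiset of its indices, so every occurrence of
  \<open>i\<close> contributes the same term.\<close>

lemma contractions_eq: "contractions d i pre xs = real (count_list xs i) * moment d (pre @ remove1 i xs)"
proof (induction xs arbitrary: pre)
  case (Cons x xs)
  show ?case
  proof (cases "i = x")
    case True
    have "real (count_list xs i) * moment d (pre @ i # remove1 i xs) = real (count_list xs i) * moment d (pre @ xs)"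
    proof (cases "i \<in> set xs")
      case True
      thus ?thesis by (simp add: moment_cong_mset[of "pre @ i # remove1 i xs" "pre @ xs"])
    qed (simp add: count_list_0_iff)
    thus ?thesis using True Cons by (simp add: algebra_simps)
  qed (use Cons in simp)
qed simp

lemma moment_wick: "i < d \<Longrightarrow> moment d (i # xs) = contractions d i [] xs"
  by (simp add: moment_Cons contractions_eq)

lemma moment_Nil: "moment d [] = 1"
proof -
  interpret prob_space gauss1 by (rule prob_space_gauss1)
  show ?thesis using prob_space by (simp add: moment_def moment1_def)
qed

lemma moment4:
  assumes "a < d" "b < d" "c < d"
  shows "moment d [a, b, c, e] = ident a b * ident c e + ident a c * ident b e + ident a e * ident b c"
  using assms by (simp add: moment_wick moment_Nil ident_def)

lemma moment6:
  assumes "a < d"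
  shows "moment d [a, b, c, e, f, g] = ident a b * moment d [c, e, f, g] + ident a c * moment d [b, e, f, g]
    + ident a e * moment d [b, c, f, g] + ident a f * moment d [b, c, e, g] + ident a g * moment d [b, c, e, f]"
  using assms by (simp add: moment_wick ident_def)

section \<open>The second moment of a cubic form\<close>

lemma sum_ident: "a < d \<Longrightarrow> (\<Sum>b<d. ident a b * X b) = X a" "a < d \<Longrightarrow> (\<Sum>b<d. ident b a * X b) = X a"
  by (simp_all add: ident_def if_distrib[of "\<lambda>t. t * _"] cong: if_cong)

lemma cubic_square:
  "(cubic d Q z)\<^sup>2 = (\<Sum>a<d. \<Sum>b<d. \<Sum>c<d. \<Sum>e<d. \<Sum>f<d. \<Sum>g<d. Q a b c * Q e f g * prod_list (map z [a, b, c, e, f, g]))"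
  unfolding power2_eq_square cubic_def sum_distrib_left sum_distrib_right by (simp add: mult_ac)

lemma integrable_cubic_square: "integrable (stdg d) (\<lambda>z. (cubic d Q z)\<^sup>2)"
  unfolding cubic_square
  by (intro Bochner_Integration.integrable_sum integrable_mult_right integrable_monomial) auto

lemma integral_cubic_square:
  "(\<integral>z. (cubic d Q z)\<^sup>2 \<partial>stdg d) = (\<Sum>a<d. \<Sum>b<d. \<Sum>c<d. \<Sum>e<d. \<Sum>f<d. \<Sum>g<d. Q a b c * Q e f g * moment d [a, b, c, e, f, g])"
proof -
  have m: "integrable (stdg d) (\<lambda>z. Q a b c * Q e f g * prod_list (map z [a, b, c, e, f, g]))"
     "(\<integral>z. Q a b c * Q e f g * prod_list (map z [a, b, c, e, f, g]) \<partial>stdg d) = Q a b c * Q e f g * moment d [a, b, c, e, f, g]"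
    if "a < d" "b < d" "c < d" "e < d" "f < d" "g < d" for a b c e f g
    using integrable_monomial[of "[a, b, c, e, f, g]" d] integral_monomial[of "[a, b, c, e, f, g]" d] that
    by (auto intro!: integrable_mult_right simp del: prod_list.Cons list.map)
  show ?thesis unfolding cubic_square
    by (subst Bochner_Integration.integral_sum, (intro Bochner_Integration.integrable_sum m; simp), intro sum.cong refl)+
       (intro m(2); simp)
qed

text \<open>Of the 15 pairings of six indices, 6 match the two copies of \<open>Q\<close> completely
  and give the squared entries; the other 9 contain one pair inside each copy and give the squared
  trace vector \<open>w\<close>. They are sorted here by the partner of the first index.\<close>

lemma integral_cubic_square_symmetric:
  assumes s1: "\<And>a b c. a < d \<Longrightarrow> b < d \<Longrightarrow> c < d \<Longrightarrow> Q a b c = Q b a c"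
    and s2: "\<And>a b c. a < d \<Longrightarrow> b < d \<Longrightarrow> c < d \<Longrightarrow> Q a b c = Q a c b"
  shows "(\<integral>z. (cubic d Q z)\<^sup>2 \<partial>stdg d) =
    6 * (\<Sum>a<d. \<Sum>b<d. \<Sum>c<d. (Q a b c)\<^sup>2) + 9 * (\<Sum>a<d. (\<Sum>b<d. Q a b b)\<^sup>2)"
proof -
  define w where "w a = (\<Sum>b<d. Q a b b)" for a
  define N where "N = (\<Sum>a<d. \<Sum>b<d. \<Sum>c<d. (Q a b c)\<^sup>2)"
  define m where "m a b c e = moment d [a, b, c, e]" for a b c e
  \<comment> \<open>Partner in the same copy: the remaining index \<open>c\<close> meets the whole
    other copy, and all three pairings give \<open>w c\<close> by symmetry.\<close>
  have q: "(\<Sum>e<d. \<Sum>f<d. \<Sum>g<d. Q e f g * m c e f g) = 3 * w c" if c: "c < d" for c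
  proof -
    have "(\<Sum>e<d. \<Sum>f<d. \<Sum>g<d. Q e f g * m c e f g)
      = (\<Sum>e<d. \<Sum>f<d. \<Sum>g<d. ident c e * (ident f g * Q e f g) + ident c f * (ident e g * Q e f g) + ident c g * (ident e f * Q e f g))"
      unfolding m_def using c by (intro sum.cong refl, subst moment4) (auto simp: algebra_simps)
    also have "\<dots> = (\<Sum>e<d. ident c e * (\<Sum>f<d. \<Sum>g<d. ident f g * Q e f g)) + (\<Sum>e<d. \<Sum>f<d. ident c f * (\<Sum>g<d. ident e g * Q e f g))
       + (\<Sum>e<d. \<Sum>f<d. \<Sum>g<d. ident c g * (ident e f * Q e f g))"
      by (simp only: sum.distrib sum_distrib_left)
    also have "(\<Sum>e<d. ident c e * (\<Sum>f<d. \<Sum>g<d. ident f g * Q e f g)) = w c"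
      unfolding sum_ident(1)[OF c] w_def by (intro sum.cong refl sum_ident) auto
    also have "(\<Sum>e<d. \<Sum>f<d. ident c f * (\<Sum>g<d. ident e g * Q e f g)) = w c"
      unfolding sum_ident(1)[OF c] w_def using c s1 by (intro sum.cong refl) (auto simp: sum_ident)
    also have "(\<Sum>e<d. \<Sum>f<d. \<Sum>g<d. ident c g * (ident e f * Q e f g)) = w c"
      unfolding sum_ident(1)[OF c] w_def using c s1 s2 by (intro sum.cong refl) (auto simp: sum_ident)
    finally show ?thesis by simp
  qed
  \<comment> \<open>Partner in the other copy: of the three pairings left, one contracts within the
    copies and two match them.\<close>
  have p: "(\<Sum>b<d. \<Sum>c<d. \<Sum>f<d. \<Sum>g<d. Q a b c * Q a f g * m b c f g) = (w a)\<^sup>2 + 2 * (\<Sum>b<d. \<Sum>c<d. (Q a b c)\<^sup>2)" if a: "a < d" for a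
  proof -
    have "(\<Sum>b<d. \<Sum>c<d. \<Sum>f<d. \<Sum>g<d. Q a b c * Q a f g * m b c f g) =
      (\<Sum>b<d. \<Sum>c<d. \<Sum>f<d. \<Sum>g<d. ident b c * (Q a b c * (ident f g * Q a f g)) + Q a b c * (ident b f * (ident c g * Q a f g)) + Q a b c * (ident c f * (ident b g * Q a f g)))"
      unfolding m_def by (intro sum.cong refl, subst moment4) (auto simp: algebra_simps)
    also have "\<dots> = (\<Sum>b<d. \<Sum>c<d. ident b c * (Q a b c * (\<Sum>f<d. \<Sum>g<d. ident f g * Q a f g)))
        + (\<Sum>b<d. \<Sum>c<d. Q a b c * (\<Sum>f<d. ident b f * (\<Sum>g<d. ident c g * Q a f g)))
        + (\<Sum>b<d. \<Sum>c<d. Q a b c * (\<Sum>f<d. ident c f * (\<Sum>g<d. ident b g * Q a f g)))"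
      by (simp only: sum.distrib sum_distrib_left)
    also have "(\<Sum>b<d. \<Sum>c<d. ident b c * (Q a b c * (\<Sum>f<d. \<Sum>g<d. ident f g * Q a f g))) = (w a)\<^sup>2"
    proof -
      have "(\<Sum>f<d. \<Sum>g<d. ident f g * Q a f g) = w a"
        unfolding w_def by (intro sum.cong refl sum_ident) auto
      hence "(\<Sum>b<d. \<Sum>c<d. ident b c * (Q a b c * (\<Sum>f<d. \<Sum>g<d. ident f g * Q a f g))) = (\<Sum>b<d. Q a b b * w a)"
        by (intro sum.cong refl) (simp add: sum_ident)
      thus ?thesis by (simp add: w_def power2_eq_square sum_distrib_right)
    qed
    also have "(\<Sum>b<d. \<Sum>c<d. Q a b c * (\<Sum>f<d. ident b f * (\<Sum>g<d. ident c g * Q a f g))) = (\<Sum>b<d. \<Sum>c<d. (Q a b c)\<^sup>2)"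
      by (intro sum.cong refl) (simp add: sum_ident power2_eq_square)
    also have "(\<Sum>b<d. \<Sum>c<d. Q a b c * (\<Sum>f<d. ident c f * (\<Sum>g<d. ident b g * Q a f g))) = (\<Sum>b<d. \<Sum>c<d. (Q a b c)\<^sup>2)"
      using a s2 by (intro sum.cong refl) (simp add: sum_ident power2_eq_square)
    finally show ?thesis by simp
  qed
  have "(\<integral>z. (cubic d Q z)\<^sup>2 \<partial>stdg d) = (\<Sum>a<d. \<Sum>b<d. \<Sum>c<d. \<Sum>e<d. \<Sum>f<d. \<Sum>g<d.
      ident a b * (Q a b c * (Q e f g * m c e f g)) + ident a c * (Q a b c * (Q e f g * m b e f g))
      + ident a e * (Q a b c * Q e f g * m b c f g) + ident a f * (Q a b c * Q e f g * m b c e g) + ident a g * (Q a b c * Q e f g * m b c e f))"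
    unfolding integral_cubic_square m_def
    by (intro sum.cong refl, subst moment6) (auto simp: algebra_simps)
  also have "\<dots> = (\<Sum>a<d. \<Sum>b<d. ident a b * (\<Sum>c<d. Q a b c * (\<Sum>e<d. \<Sum>f<d. \<Sum>g<d. Q e f g * m c e f g)))
     + (\<Sum>a<d. \<Sum>b<d. \<Sum>c<d. ident a c * (Q a b c * (\<Sum>e<d. \<Sum>f<d. \<Sum>g<d. Q e f g * m b e f g)))
     + (\<Sum>a<d. \<Sum>b<d. \<Sum>c<d. \<Sum>e<d. ident a e * (\<Sum>f<d. \<Sum>g<d. Q a b c * Q e f g * m b c f g))
     + (\<Sum>a<d. \<Sum>b<d. \<Sum>c<d. \<Sum>e<d. \<Sum>f<d. ident a f * (\<Sum>g<d. Q a b c * Q e f g * m b c e g))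
     + (\<Sum>a<d. \<Sum>b<d. \<Sum>c<d. \<Sum>e<d. \<Sum>f<d. \<Sum>g<d. ident a g * (Q a b c * Q e f g * m b c e f))"
    by (simp only: sum.distrib sum_distrib_left)
  also have "(\<Sum>a<d. \<Sum>b<d. ident a b * (\<Sum>c<d. Q a b c * (\<Sum>e<d. \<Sum>f<d. \<Sum>g<d. Q e f g * m c e f g))) = (\<Sum>a<d. 3 * (w a)\<^sup>2)"
  proof -
    have "(\<Sum>a<d. \<Sum>b<d. ident a b * (\<Sum>c<d. Q a b c * (\<Sum>e<d. \<Sum>f<d. \<Sum>g<d. Q e f g * m c e f g))) = (\<Sum>a<d. \<Sum>c<d. Q a a c * (3 * w c))"
      by (rule sum.cong[OF refl]) (simp add: sum_ident q cong: sum.cong_simp)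
    also have "\<dots> = (\<Sum>c<d. \<Sum>a<d. Q c a a * (3 * w c))"
      by (subst sum.swap, intro sum.cong refl) (use s1 s2 in auto)
    finally show ?thesis by (simp add: w_def power2_eq_square sum_distrib_right sum_distrib_left mult_ac)
  qed
  also have "(\<Sum>a<d. \<Sum>b<d. \<Sum>c<d. ident a c * (Q a b c * (\<Sum>e<d. \<Sum>f<d. \<Sum>g<d. Q e f g * m b e f g))) = (\<Sum>a<d. 3 * (w a)\<^sup>2)"
  proof -
    have "(\<Sum>a<d. \<Sum>b<d. \<Sum>c<d. ident a c * (Q a b c * (\<Sum>e<d. \<Sum>f<d. \<Sum>g<d. Q e f g * m b e f g))) = (\<Sum>a<d. \<Sum>b<d. Q a b a * (3 * w b))"
      by (intro sum.cong refl) (simp add: sum_ident q)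
    also have "\<dots> = (\<Sum>b<d. \<Sum>a<d. Q b a a * (3 * w b))"
      by (subst sum.swap, intro sum.cong refl) (use s1 in auto)
    finally show ?thesis by (simp add: w_def power2_eq_square sum_distrib_right sum_distrib_left mult_ac)
  qed
  also have "(\<Sum>a<d. \<Sum>b<d. \<Sum>c<d. \<Sum>e<d. ident a e * (\<Sum>f<d. \<Sum>g<d. Q a b c * Q e f g * m b c f g))
     = (\<Sum>a<d. (w a)\<^sup>2 + 2 * (\<Sum>b<d. \<Sum>c<d. (Q a b c)\<^sup>2))"
    by (intro sum.cong refl) (simp add: sum_ident p)
  also have "(\<Sum>a<d. \<Sum>b<d. \<Sum>c<d. \<Sum>e<d. \<Sum>f<d. ident a f * (\<Sum>g<d. Q a b c * Q e f g * m b c e g))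
     = (\<Sum>a<d. (w a)\<^sup>2 + 2 * (\<Sum>b<d. \<Sum>c<d. (Q a b c)\<^sup>2))"
  proof (intro sum.cong refl)
    fix a assume a: "a \<in> {..<d}"
    have "(\<Sum>b<d. \<Sum>c<d. \<Sum>e<d. \<Sum>f<d. ident a f * (\<Sum>g<d. Q a b c * Q e f g * m b c e g))
      = (\<Sum>b<d. \<Sum>c<d. \<Sum>e<d. \<Sum>g<d. Q a b c * Q a e g * m b c e g)"
    proof (rule sum.cong[OF refl], rule sum.cong[OF refl], rule sum.cong[OF refl])
      fix b c e assume e: "e \<in> {..<d}"
      have "(\<Sum>f<d. ident a f * (\<Sum>g<d. Q a b c * Q e f g * m b c e g)) = (\<Sum>g<d. Q a b c * Q e a g * m b c e g)"
        by (rule sum_ident(1)) (use a in simp)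
      also have "\<dots> = (\<Sum>g<d. Q a b c * Q a e g * m b c e g)"
        using s1[of e a] a e by (intro sum.cong refl) auto
      finally show "(\<Sum>f<d. ident a f * (\<Sum>g<d. Q a b c * Q e f g * m b c e g)) = (\<Sum>g<d. Q a b c * Q a e g * m b c e g)" .
    qed
    thus "(\<Sum>b<d. \<Sum>c<d. \<Sum>e<d. \<Sum>f<d. ident a f * (\<Sum>g<d. Q a b c * Q e f g * m b c e g)) = (w a)\<^sup>2 + 2 * (\<Sum>b<d. \<Sum>c<d. (Q a b c)\<^sup>2)"
      using p a by simp
  qed
  also have "(\<Sum>a<d. \<Sum>b<d. \<Sum>c<d. \<Sum>e<d. \<Sum>f<d. \<Sum>g<d. ident a g * (Q a b c * Q e f g * m b c e f))
     = (\<Sum>a<d. (w a)\<^sup>2 + 2 * (\<Sum>b<d. \<Sum>c<d. (Q a b c)\<^sup>2))"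
  proof (intro sum.cong refl)
    fix a assume a: "a \<in> {..<d}"
    have "(\<Sum>b<d. \<Sum>c<d. \<Sum>e<d. \<Sum>f<d. \<Sum>g<d. ident a g * (Q a b c * Q e f g * m b c e f))
      = (\<Sum>b<d. \<Sum>c<d. \<Sum>e<d. \<Sum>f<d. Q a b c * Q a e f * m b c e f)"
    proof (intro sum.cong refl)
      fix b c e f assume "b \<in> {..<d}" "c \<in> {..<d}" "e \<in> {..<d}" "f \<in> {..<d}"
      hence "Q e f a = Q a e f" using a s1[of a e f] s2[of e a f] by simp
      thus "(\<Sum>g<d. ident a g * (Q a b c * Q e f g * m b c e f)) = Q a b c * Q a e f * m b c e f"
        using a by (simp add: sum_ident)
    qed
    thus "(\<Sum>b<d. \<Sum>c<d. \<Sum>e<d. \<Sum>f<d. \<Sum>g<d. ident a g * (Q a b c * Q e f g * m b c e f)) = (w a)\<^sup>2 + 2 * (\<Sum>b<d. \<Sum>c<d. (Q a b c)\<^sup>2)"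
      using p a by simp
  qed
  finally show ?thesis unfolding w_def
    by (simp add: sum.distrib sum_distrib_left[symmetric])
qed

section \<open>Tensor norms in whitened coordinates\<close>

lemma matvec_Rd [simp]: "matvec d A x \<in> Rd d" by (simp add: matvec_def Rd_def)

lemma matvec_matvec:
  assumes "i < d" shows "matvec d A (matvec d B u) i = (\<Sum>l<d. mm d A B i l * u l)"
proof -
  have "matvec d A (matvec d B u) i = (\<Sum>j<d. \<Sum>l<d. A i j * B j l * u l)"
    using assms by (simp add: matvec_def sum_distrib_left mult.assoc)
  also have "\<dots> = (\<Sum>l<d. \<Sum>j<d. A i j * B j l * u l)" by (rule sum.swap)
  finally show ?thesis by (simp add: mm_def sum_distrib_right)
qed

lemma wnorm_matvec_inv_sqrt:
  "pos_def d H \<Longrightarrow> is_inv_sqrt d H R \<Longrightarrow> wnorm d H (matvec d R z) = nrm d z"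
  by (simp add: wnorm_def nrm_def quad_form_matvec_inv_sqrt)

lemma matvec_inv_sqrt_surj:
  assumes R: "is_inv_sqrt d H R" and u: "u \<in> Rd d"
  shows "matvec d R (matvec d (mm d R H) u) = u"
proof
  fix i
  show "matvec d R (matvec d (mm d R H) u) i = u i"
  proof (cases "i < d")
    case True
    have "matvec d R (matvec d (mm d R H) u) i = (\<Sum>l<d. ident i l * u l)"
      unfolding matvec_matvec[OF True] using R True by (intro sum.cong) (auto simp: is_inv_sqrt_def meq_def)
    thus ?thesis using True by (simp add: sum_ident)
  next
    case False
    thus ?thesis using u by (simp add: matvec_def Rd_def PiE_iff extensional_def)
  qed
qed

text \<open>A crude operator norm for qualitative purposes: boundedness of the suprema in
  \<open>tnorm\<close> and \<open>eps4\<close>, and of the local region. Its size does not enter the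
  estimates.\<close>

definition entry_sum :: "nat \<Rightarrow> mtrx \<Rightarrow> real" where
  "entry_sum d R = (\<Sum>i<d. \<Sum>j<d. \<bar>R i j\<bar>)"

lemma entry_sum_nonneg [simp]: "0 \<le> entry_sum d R"
  by (simp add: entry_sum_def sum_nonneg)

lemma abs_matvec_le:
  assumes "i < d" shows "\<bar>matvec d R z i\<bar> \<le> entry_sum d R * nrm d z"
proof -
  have zi: "\<bar>z j\<bar> \<le> nrm d z" if "j < d" for j
    using abs_coord_le_ip[OF that, of z] unfolding nrm_sq[symmetric] by (rule abs_le_square_iff[THEN iffD2, of "z j" "nrm d z", simplified])
  have "\<bar>matvec d R z i\<bar> \<le> (\<Sum>j<d. \<bar>R i j * z j\<bar>)" using assms by (simp add: matvec_def sum_abs)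
  also have "\<dots> \<le> (\<Sum>j<d. \<bar>R i j\<bar> * nrm d z)"
    by (intro sum_mono) (auto simp: abs_mult intro!: mult_left_mono zi)
  also have "\<dots> = (\<Sum>j<d. \<bar>R i j\<bar>) * nrm d z" by (simp add: sum_distrib_right)
  also have "\<dots> \<le> entry_sum d R * nrm d z"
    unfolding entry_sum_def using assms
    by (intro mult_right_mono member_le_sum[of i "{..<d}" "\<lambda>i. \<Sum>j<d. \<bar>R i j\<bar>"]) (auto intro: sum_nonneg)
  finally show ?thesis .
qed

lemma abs_tpow_le:
  assumes "\<And>i. i < d \<Longrightarrow> \<bar>u i\<bar> \<le> M" "0 \<le> M" "is \<in> multi_idx d k"
  shows "\<bar>tpow u is\<bar> \<le> M ^ k"
  using assms(3)
proof (induction k arbitrary: "is")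
  case (Suc k)
  then obtain i js where i: "is = i # js" "i < d" "js \<in> multi_idx d k" by (auto simp: multi_idx_Suc)
  have "\<bar>u i\<bar> * \<bar>tpow u js\<bar> \<le> M * M ^ k"
    using assms(1,2) Suc.IH[OF i(3)] i(2) by (intro mult_mono) auto
  thus ?case using i by (simp add: tpow_def abs_mult)
qed (simp add: multi_idx_0 tpow_def)

lemma tpow_scale: "is \<in> multi_idx d k \<Longrightarrow> tpow (\<lambda>i. c * u i) is = c ^ k * tpow u is"
  by (induction k arbitrary: "is") (auto simp: multi_idx_0 multi_idx_Suc tpow_def)

lemma tpow_cong: "is \<in> multi_idx d k \<Longrightarrow> (\<And>i. i < d \<Longrightarrow> u i = w i) \<Longrightarrow> tpow u is = tpow w is"
  by (induction k arbitrary: "is") (auto simp: multi_idx_0 multi_idx_Suc tpow_def)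

context
  fixes d :: nat and H R :: mtrx
  assumes H: "pos_def d H" and R: "is_inv_sqrt d H R"
begin

lemma abs_tinner_unit_le:
  assumes u: "u \<in> Rd d" "wnorm d H u = 1"
  shows "\<bar>tinner d k K (tpow u)\<bar> \<le> (\<Sum>is\<in>multi_idx d k. \<bar>K is\<bar>) * entry_sum d R ^ k"
proof -
  define z where "z = matvec d (mm d R H) u"
  have uz: "u = matvec d R z" using matvec_inv_sqrt_surj[OF R u(1)] by (simp add: z_def)
  have "nrm d z = 1" using u(2) wnorm_matvec_inv_sqrt[OF H R, of z] uz by simp
  hence ui: "\<bar>u i\<bar> \<le> entry_sum d R" if "i < d" for i
    using abs_matvec_le[OF that, of R z] uz by simp
  have "\<bar>tinner d k K (tpow u)\<bar> \<le> (\<Sum>is\<in>multi_idx d k. \<bar>K is * tpow u is\<bar>)"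
    unfolding tinner_def by (rule sum_abs)
  also have "\<dots> \<le> (\<Sum>is\<in>multi_idx d k. \<bar>K is\<bar> * entry_sum d R ^ k)"
    by (intro sum_mono) (auto simp: abs_mult intro!: mult_left_mono abs_tpow_le[OF ui])
  finally show ?thesis by (simp add: sum_distrib_right)
qed

lemma abs_tinner_le_tnorm:
  assumes u: "u \<in> Rd d" "wnorm d H u = 1"
  shows "\<bar>tinner d k K (tpow u)\<bar> \<le> tnorm d H k K"
  unfolding tnorm_def
  by (rule cSUP_upper) (use u in \<open>auto intro!: bdd_aboveI2 abs_tinner_unit_le\<close>)

lemma tnorm_le:
  assumes "1 \<le> d"
  shows "tnorm d H k K \<le> (\<Sum>is\<in>multi_idx d k. \<bar>K is\<bar>) * entry_sum d R ^ k"
  unfolding tnorm_def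
proof (rule cSUP_least)
  have "nrm d (\<lambda>i. if i = 0 then 1 else 0) = 1"
    using assms by (simp add: nrm_def ip_def if_distrib[of "\<lambda>t. t * _"] cong: if_cong)
  hence "wnorm d H (matvec d R (\<lambda>i. if i = 0 then 1 else 0)) = 1" by (simp add: wnorm_matvec_inv_sqrt[OF H R])
  thus "{u \<in> Rd d. wnorm d H u = 1} \<noteq> {}" using matvec_Rd by blast
qed (auto intro: abs_tinner_unit_le)

lemma abs_tinner_matvec_le:
  assumes "1 \<le> k"
  shows "\<bar>tinner d k K (tpow (matvec d R z))\<bar> \<le> tnorm d H k K * nrm d z ^ k"
proof (cases "nrm d z = 0")
  \<comment> \<open>Normalising \<open>z\<close> is impossible here; both sides vanish since
    \<open>k\<close> is at least 1.\<close>
  case True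
  have "matvec d R z i = 0" if "i < d" for i using abs_matvec_le[OF that, of R z] True by simp
  hence "tpow (matvec d R z) is = tpow (\<lambda>i. 0) is" if "is \<in> multi_idx d k" for "is"
    using that by (intro tpow_cong) auto
  moreover have "tpow (\<lambda>i. 0) is = 0" if "is \<in> multi_idx d k" for "is"
    using tpow_scale[OF that, of 0 "\<lambda>_. 1"] assms by simp
  ultimately have "tinner d k K (tpow (matvec d R z)) = 0"
    unfolding tinner_def by (intro sum.neutral ballI) simp
  thus ?thesis using True assms by (simp add: power_0_left)
next
  case False
  hence pos: "nrm d z > 0" using nrm_nonneg[of d z] by linarith
  define u where "u = matvec d R (\<lambda>i. (1 / nrm d z) * z i)"
  have "wnorm d H u = 1" unfolding u_def wnorm_matvec_inv_sqrt[OF H R] nrm_scale using pos by simp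
  hence "\<bar>tinner d k K (tpow u)\<bar> \<le> tnorm d H k K" by (intro abs_tinner_le_tnorm) (auto simp: u_def)
  moreover have "tinner d k K (tpow (matvec d R z)) = nrm d z ^ k * tinner d k K (tpow u)"
    unfolding tinner_def sum_distrib_left
  proof (rule sum.cong[OF refl])
    fix "is" assume i: "is \<in> multi_idx d k"
    have "tpow (matvec d R z) is = tpow (\<lambda>i. nrm d z * u i) is"
      using pos by (intro tpow_cong[OF i]) (simp add: u_def matvec_def sum_distrib_left)
    thus "K is * tpow (matvec d R z) is = nrm d z ^ k * (K is * tpow u is)" by (simp add: tpow_scale[OF i])
  qed
  ultimately show ?thesis using pos by (simp add: abs_mult mult.commute)
qed

end

text \<open>The duality that turns the pulled-back derivative tensor applied to \<open>z\<close>
  into the original tensor applied to \<open>matvec d R z\<close>.\<close>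

lemma sum_rprod_tpow:
  assumes "js \<in> multi_idx d m"
  shows "(\<Sum>is\<in>multi_idx d m. rprod R js is * tpow z is) = tpow (matvec d R z) js"
  using assms
proof (induction m arbitrary: js)
  case 0
  thus ?case by (simp add: multi_idx_0 tpow_def)
next
  case (Suc m)
  then obtain j l where j: "js = j # l" "j < d" "l \<in> multi_idx d m" by (auto simp: multi_idx_Suc)
  have "(\<Sum>is\<in>multi_idx d (Suc m). rprod R js is * tpow z is) = (\<Sum>a<d. \<Sum>is\<in>multi_idx d m. (R j a * z a) * (rprod R l is * tpow z is))"
    unfolding sum_multi_idx_Suc j by (simp add: tpow_def mult_ac)
  also have "\<dots> = (\<Sum>a<d. R j a * z a) * tpow (matvec d R z) l"
    using Suc.IH[OF j(3)] by (simp add: sum_distrib_left[symmetric] sum_distrib_right[symmetric])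
  also have "(\<Sum>a<d. R j a * z a) = matvec d R z j" using j by (simp add: matvec_def)
  finally show ?case by (simp add: j tpow_def)
qed

lemma tinner3_cubic: "tinner d 3 K (tpow z) = cubic d (\<lambda>a b c. K [a, b, c]) z"
  unfolding tinner_def numeral_3_eq_3 sum_multi_idx_Suc multi_idx_0 cubic_def
  by (simp add: tpow_def mult.assoc)

lemma closed_quad_form_ball:
  "closed {x. sqrt (quad_form d H (\<lambda>i. x i - c i)) \<le> r}"
  unfolding quad_form_def
  by (intro closed_Collect_le continuous_intros continuous_on_product_coordinates)

section \<open>The Laplace approximation\<close>

locale laplace_setup =
  fixes d :: nat and n :: real and \<Theta> :: "(nat \<Rightarrow> real) set" and v :: "(nat \<Rightarrow> real) \<Rightarrow> real"
    and xh :: "nat \<Rightarrow> real" and s0 c0 s C :: real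
  assumes d1: "1 \<le> d" and n_pos: "0 < n" and \<Theta>: "openin (top_of_set (Rd d)) \<Theta>"
    and A1: "assumption_A1 d \<Theta> v xh" and C_pos: "0 < C" and A2: "assumption_A2 C d n \<Theta> v xh s0 c0"
    and s_ge: "s_star s0 c0 \<le> s" and loc: "loc_region d n v xh s \<subseteq> \<Theta>"
begin

abbreviation "V \<equiv> pot n v"
definition H where "H = HV n v xh"
definition R where "R = inv_sqrt d H"
definition T where "T z = vadd d xh (matvec d R z)"
definition Q where "Q a b c = dtensor (whitened d n v xh) (vzero d) [a, b, c]"
definition S where "S z = - (1 / 6) * cubic d Q z"
text \<open>The target density divided by its maximum, attained at \<open>xh\<close>, and by the
  Gaussian exponential; it equals 1 at the origin.\<close>

definition q where "q z = indicator \<Theta> (T z) * exp (- (V (T z) - V xh) + ip d z z / 2)"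

section \<open>The potential in whitened coordinates\<close>

lemma xh_in: "xh \<in> \<Theta>" and Ck_v: "Ck_on d 4 \<Theta> v" and pd_v: "pos_def d (hessian v xh)"
  and min_v: "x \<in> \<Theta> \<Longrightarrow> v xh \<le> v x"
  using A1 unfolding assumption_A1_def by (auto simp: less_imp_le)

lemma xh_Rd: "xh \<in> Rd d" using open_subset_Rd[OF \<Theta> xh_in] .

lemma Ck_V: "Ck_on d 4 \<Theta> V" by (rule Ck_on_pot[OF \<Theta> Ck_v])

lemma c0_pos: "0 < c0" and c0_le_1: "c0 \<le> 1" and s0_pos: "0 < s0"
proof -
  have "0 \<le> C / sqrt (real d)" using C_pos by simp
  thus "0 < c0" "c0 \<le> 1" "0 < s0" using A2 unfolding assumption_A2_def by auto
qed

lemma s0_le: "s0 \<le> s" and s_ge': "8 / c0 * ln (2 * exp 1 / c0) \<le> s"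
  using s_ge by (auto simp: s_star_def)

lemma H_eq: "i < d \<Longrightarrow> j < d \<Longrightarrow> H i j = n * hessian v xh i j"
  unfolding H_def HV_def hessian_def
  by (rule partials_pot[OF \<Theta> Ck_v, of _ 2]) (auto simp: multi_idx_def xh_in)

lemma quad_form_H: "quad_form d H u = n * quad_form d (hessian v xh) u"
  unfolding quad_form_def sum_distrib_left by (intro sum.cong refl) (simp add: H_eq)

lemma pd_H: "pos_def d H"
  using pd_v n_pos unfolding pos_def_def by (simp add: H_eq quad_form_H)

lemma R_inv: "is_inv_sqrt d H R" unfolding R_def by (rule is_inv_sqrt_inv_sqrt[OF pd_H])

lemma pd_R: "pos_def d R" using R_inv by (simp add: is_inv_sqrt_def)

lemma wnorm_v: "wnorm d (hessian v xh) (matvec d R z) = nrm d z / sqrt n"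
proof -
  have "nrm d z = sqrt n * wnorm d (hessian v xh) (matvec d R z)"
    unfolding wnorm_matvec_inv_sqrt[OF pd_H R_inv, symmetric] wnorm_def quad_form_H by (simp add: real_sqrt_mult)
  thus ?thesis using n_pos by simp
qed

lemma T_Rd [simp]: "T z \<in> Rd d" by (simp add: T_def vadd_def Rd_def)

lemma vsub_T: "vsub d (T z) xh = matvec d R z"
  by (auto simp: T_def vsub_def vadd_def matvec_def fun_eq_iff)

lemma T_loc_region: "T z \<in> loc_region d n v xh r \<longleftrightarrow> nrm d z \<le> r * sqrt (real d)"
proof -
  have "T z \<in> loc_region d n v xh r \<longleftrightarrow> nrm d z / sqrt n \<le> r * (sqrt (real d) / sqrt n)"
    by (simp add: loc_region_def vsub_T wnorm_v real_sqrt_divide)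
  also have "\<dots> \<longleftrightarrow> nrm d z \<le> r * sqrt (real d)"
    using n_pos by (simp add: divide_le_cancel)
  finally show ?thesis .
qed

lemma T_zero: "T (vzero d) = xh"
  using xh_Rd by (auto simp: T_def vadd_def matvec_def vzero_def Rd_def fun_eq_iff PiE_iff extensional_def)

lemma whitened_eq: "whitened d n v xh = (\<lambda>y. V (vadd d xh (matvec d R y)))"
  by (simp add: whitened_def R_def H_def fun_eq_iff)

lemma whitened_partials:
  assumes "is \<in> multi_idx d m" "m \<le> 4"
  shows "dtensor (whitened d n v xh) (vzero d) is = (\<Sum>js\<in>multi_idx d m. rprod R js is * partials js V xh)"
  unfolding dtensor_def whitened_eq
  using partials_affine[OF \<Theta> Ck_V assms, of "vzero d" xh R] xh_in T_zero
  by (simp add: T_def[symmetric] vzero_def Rd_def)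

lemma cubic_eq: "cubic d Q z = tinner d 3 (dtensor V xh) (tpow (matvec d R z))"
proof -
  have "cubic d Q z = tinner d 3 (dtensor (whitened d n v xh) (vzero d)) (tpow z)"
    by (simp add: tinner3_cubic Q_def[abs_def])
  also have "\<dots> = (\<Sum>is\<in>multi_idx d 3. \<Sum>js\<in>multi_idx d 3. partials js V xh * (rprod R js is * tpow z is))"
    unfolding tinner_def by (intro sum.cong refl) (simp add: whitened_partials sum_distrib_left mult_ac)
  also have "\<dots> = (\<Sum>js\<in>multi_idx d 3. partials js V xh * (\<Sum>is\<in>multi_idx d 3. rprod R js is * tpow z is))"
    by (subst sum.swap) (simp add: sum_distrib_left)
  also have "\<dots> = tinner d 3 (dtensor V xh) (tpow (matvec d R z))"
    unfolding tinner_def dtensor_def by (intro sum.cong refl) (simp add: sum_rprod_tpow)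
  finally show ?thesis .
qed

lemma S_eq_skew: "S z = skew d n v xh (T z)"
  by (simp add: S_def cubic_eq skew_def vsub_T)

lemma Q_expand: "a < d \<Longrightarrow> b < d \<Longrightarrow> c < d \<Longrightarrow>
   Q a b c = (\<Sum>i<d. \<Sum>j<d. \<Sum>k<d. R i a * R j b * R k c * partials [i, j, k] V xh)"
proof -
  assume "a < d" "b < d" "c < d"
  hence "Q a b c = (\<Sum>js\<in>multi_idx d 3. rprod R js [a, b, c] * partials js V xh)"
    unfolding Q_def by (intro whitened_partials) (auto simp: multi_idx_def)
  thus ?thesis unfolding numeral_3_eq_3 sum_multi_idx_Suc multi_idx_0 by (simp add: mult.assoc)
qed

lemma Q_sym1: "a < d \<Longrightarrow> b < d \<Longrightarrow> c < d \<Longrightarrow> Q a b c = Q b a c"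
  unfolding Q_expand
  by (subst sum.swap, intro sum.cong refl)
     (use partials3_symmetric(1)[OF \<Theta> Ck_V xh_in] in \<open>auto simp: mult_ac\<close>)

lemma Q_sym2: "a < d \<Longrightarrow> b < d \<Longrightarrow> c < d \<Longrightarrow> Q a b c = Q a c b"
  unfolding Q_expand
  by (rule sum.cong[OF refl], subst sum.swap, intro sum.cong refl)
     (use partials3_symmetric(2)[OF \<Theta> Ck_V xh_in] in \<open>auto simp: mult_ac\<close>)

text \<open>Explains the weights in \<open>eps3_bar\<close>: with the factor 1/36 from S, Wick's
  coefficients 6 and 9 become 1/6 and 1/4.\<close>

lemma eps3_bar_sq: "(eps3_bar d n v xh)\<^sup>2 = (\<integral>z. (S z)\<^sup>2 \<partial>stdg d)" and eps3_bar_nonneg: "0 \<le> eps3_bar d n v xh"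
proof -
  define N where "N = (\<Sum>a<d. \<Sum>b<d. \<Sum>c<d. (Q a b c)\<^sup>2)"
  define w where "w = (\<Sum>a<d. (\<Sum>b<d. Q a b b)\<^sup>2)"
  have N0: "0 \<le> N" and w0: "0 \<le> w" by (auto simp: N_def w_def intro!: sum_nonneg)
  have f: "(frob_norm d 3 (dtensor (whitened d n v xh) (vzero d)))\<^sup>2 = N"
  proof -
    have "tinner d 3 (dtensor (whitened d n v xh) (vzero d)) (dtensor (whitened d n v xh) (vzero d)) = N"
      unfolding tinner_def numeral_3_eq_3 sum_multi_idx_Suc multi_idx_0 N_def
      by (simp add: Q_def power2_eq_square)
    thus ?thesis using N0 by (simp add: frob_norm_def)
  qed
  have c: "(\<Sum>i<d. (contract d (dtensor (whitened d n v xh) (vzero d)) ident i)\<^sup>2) = w"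
    unfolding w_def contract_def by (intro sum.cong refl) (simp add: Q_def sum_ident mult.commute[of _ "ident _ _"] cong: sum.cong_simp)
  have e: "eps3_bar d n v xh = sqrt (1 / 6 * N + 1 / 4 * w)"
    unfolding eps3_bar_def Let_def f c ..
  thus "0 \<le> eps3_bar d n v xh" using N0 w0 by simp
  have "(\<integral>z. (S z)\<^sup>2 \<partial>stdg d) = 1 / 36 * (\<integral>z. (cubic d Q z)\<^sup>2 \<partial>stdg d)"
    by (simp add: S_def power_divide power_mult_distrib)
  also have "\<dots> = 1 / 36 * (6 * N + 9 * w)"
    unfolding N_def w_def by (subst integral_cubic_square_symmetric) (use Q_sym1 Q_sym2 in auto)
  finally show "(eps3_bar d n v xh)\<^sup>2 = (\<integral>z. (S z)\<^sup>2 \<partial>stdg d)"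
    using e N0 w0 by simp
qed

lemma cubic_bound: "\<bar>cubic d Q z\<bar> \<le> eps3 d n v xh / real d * nrm d z ^ 3"
  unfolding cubic_eq using abs_tinner_matvec_le[OF pd_H R_inv, of 3 "dtensor V xh" z] d1
  by (simp add: eps3_def H_def)

lemma eps3_nonneg: "0 \<le> eps3 d n v xh"
proof -
  have "nrm d (\<lambda>i. if i = 0 then 1 else 0) = 1"
    using d1 by (simp add: nrm_def ip_def if_distrib[of "\<lambda>t. t * _"] cong: if_cong)
  hence "0 \<le> eps3 d n v xh / real d"
    using order_trans[OF abs_ge_zero cubic_bound[of "\<lambda>i. if i = 0 then 1 else 0"]] by simp
  thus ?thesis using d1 by (simp add: zero_le_divide_iff)
qed

text \<open>A real supremum dominates its members only over a bounded set. Boundedness holds because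
  the local region is compact and the tensor norm lies below \<open>M\<close>, which is continuous
  there.\<close>

lemma fourth_order_bound:
  assumes x: "x \<in> loc_region d n v xh s"
  shows "\<bar>tinner d 4 (dtensor V x) (tpow (matvec d R z))\<bar> \<le> (eps4 d n v xh s / real d)\<^sup>2 * (ip d z z)\<^sup>2"
proof -
  define U where "U = loc_region d n v xh s"
  define M where "M x = (\<Sum>is\<in>multi_idx d 4. \<bar>dtensor V x is\<bar>) * entry_sum d R ^ 4" for x
  have cont: "continuous_on U M"
  proof -
    have "continuous_on \<Theta> (partials is V)" if "is \<in> multi_idx d 4" for "is"
      using Ck_V that unfolding Ck_on_def by blast
    hence "continuous_on \<Theta> M" unfolding M_def dtensor_def by (intro continuous_intros) auto
    thus ?thesis using loc continuous_on_subset by (auto simp: U_def)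
  qed
  have "compact U"
  proof (rule compact_subset_Rd)
    show "U \<subseteq> Rd d" by (auto simp: U_def loc_region_def)
    have "quad_form d (hessian v xh) (vsub d x xh) = quad_form d (hessian v xh) (\<lambda>i. x i - xh i)" for x
      by (simp add: quad_form_def vsub_def)
    hence "U = Rd d \<inter> {x. sqrt (quad_form d (hessian v xh) (\<lambda>i. x i - xh i)) \<le> s * sqrt (real d / n)}"
      by (auto simp: U_def loc_region_def wnorm_def)
    thus "closed U" using closed_Rd closed_quad_form_ball by auto
  next
    fix x i assume x: "x \<in> U" and i: "i < d"
    define y where "y = matvec d (mm d R H) (vsub d x xh)"
    have y: "matvec d R y = vsub d x xh"
      unfolding y_def by (rule matvec_inv_sqrt_surj[OF R_inv]) (simp add: vsub_def Rd_def)
    have "nrm d y / sqrt n \<le> s * sqrt (real d / n)"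
      using x unfolding wnorm_v[symmetric] y by (simp add: U_def loc_region_def)
    hence ny: "nrm d y \<le> s * sqrt (real d / n) * sqrt n" using n_pos by (simp add: pos_divide_le_eq)
    have "\<bar>x i - xh i\<bar> \<le> entry_sum d R * nrm d y"
      using abs_matvec_le[OF i, of R y] i by (simp add: y vsub_def)
    also have "\<dots> \<le> entry_sum d R * (s * sqrt (real d / n) * sqrt n)" by (intro mult_left_mono ny) auto
    finally have "\<bar>x i\<bar> \<le> \<bar>xh i\<bar> + entry_sum d R * (s * sqrt (real d / n) * sqrt n)" by linarith
    also have "\<bar>xh i\<bar> \<le> (\<Sum>i<d. \<bar>xh i\<bar>)" using i by (intro member_le_sum) auto
    finally show "\<bar>x i\<bar> \<le> (\<Sum>i<d. \<bar>xh i\<bar>) + entry_sum d R * (s * sqrt (real d / n) * sqrt n)" by simp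
  qed
  hence "compact (M ` U)" by (rule compact_continuous_image[OF cont])
  hence "bdd_above (M ` U)" by (intro bounded_imp_bdd_above compact_imp_bounded)
  then obtain B where B: "\<And>x. x \<in> U \<Longrightarrow> M x \<le> B" by (auto simp: bdd_above_def)
  have bdd: "bdd_above ((\<lambda>x. sqrt (tnorm d H 4 (dtensor V x))) ` U)"
  proof (rule bdd_aboveI2)
    fix x assume "x \<in> U"
    have "tnorm d H 4 (dtensor V x) \<le> B"
      using tnorm_le[OF pd_H R_inv d1, of 4 "dtensor V x"] B[OF \<open>x \<in> U\<close>] by (simp add: M_def)
    thus "sqrt (tnorm d H 4 (dtensor V x)) \<le> sqrt B" by simp
  qed
  have "sqrt (tnorm d H 4 (dtensor V x)) \<le> (SUP x\<in>U. sqrt (tnorm d H 4 (dtensor V x)))"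
    by (rule cSUP_upper[OF _ bdd]) (use x in \<open>simp add: U_def\<close>)
  also have "\<dots> = eps4 d n v xh s / real d" using d1 by (simp add: eps4_def U_def H_def)
  finally have le: "sqrt (tnorm d H 4 (dtensor V x)) \<le> eps4 d n v xh s / real d" .
  have t: "tnorm d H 4 (dtensor V x) \<le> (eps4 d n v xh s / real d)\<^sup>2"
  proof (cases "0 \<le> tnorm d H 4 (dtensor V x)")
    case True
    hence "(sqrt (tnorm d H 4 (dtensor V x)))\<^sup>2 \<le> (eps4 d n v xh s / real d)\<^sup>2" using le by (intro power_mono) auto
    thus ?thesis using True by simp
  next
    case False
    thus ?thesis using zero_le_power2[of "eps4 d n v xh s / real d"] by linarith
  qed
  have n4: "nrm d z ^ 4 = (ip d z z)\<^sup>2" by (simp flip: nrm_sq power_mult)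
  have "\<bar>tinner d 4 (dtensor V x) (tpow (matvec d R z))\<bar> \<le> tnorm d H 4 (dtensor V x) * nrm d z ^ 4"
    by (rule abs_tinner_matvec_le[OF pd_H R_inv]) simp
  also have "\<dots> \<le> (eps4 d n v xh s / real d)\<^sup>2 * nrm d z ^ 4" by (rule mult_right_mono[OF t]) simp
  finally show ?thesis unfolding n4 .
qed

lemma lin_T: "lin d xh (matvec d R z) t = T (\<lambda>i. t * z i)"
  by (auto simp: lin_def T_def vadd_def matvec_def fun_eq_iff sum_distrib_left mult_ac)

text \<open>Taylor's formula along the segment from \<open>xh\<close>, which stays in the local
  region since that is a ball about \<open>xh\<close>. The gradient vanishes, the Hessian term
  cancels the Gaussian exponent, the third-order term is -S, and the fourth-order one is
  \<open>r\<close>.\<close>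

lemma expansion:
  assumes z: "nrm d z \<le> s * sqrt (real d)"
  shows "\<exists>r. - (V (T z) - V xh) + ip d z z / 2 = S z - r \<and> \<bar>r\<bar> \<le> (eps4 d n v xh s / real d)\<^sup>2 * (ip d z z)\<^sup>2 / 24"
proof -
  let ?w = "matvec d R z"
  have seg: "lin d xh ?w t \<in> loc_region d n v xh s" if "0 \<le> t" "t \<le> 1" for t
  proof -
    have "nrm d (\<lambda>i. t * z i) \<le> 1 * nrm d z" unfolding nrm_scale using that by (intro mult_right_mono) auto
    thus ?thesis unfolding lin_T T_loc_region using z by linarith
  qed
  obtain \<theta> where \<theta>: "0 < \<theta>" "\<theta> < 1" and tay: "V (lin d xh ?w 1) = V xh + tinner d 1 (dtensor V xh) (tpow ?w)
    + tinner d 2 (dtensor V xh) (tpow ?w) / 2 + tinner d 3 (dtensor V xh) (tpow ?w) / 6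
    + tinner d 4 (dtensor V (lin d xh ?w \<theta>)) (tpow ?w) / 24"
    using taylor4[OF \<Theta> Ck_V xh_Rd, of ?w] seg loc by blast
  have C1V: "C1 d \<Theta> V" using Ck_on_C1[OF Ck_V, of "[]" 0] by (simp add: multi_idx_0)
  have "partial i V xh = 0" if "i < d" for i
    by (rule partial_zero_at_min[OF \<Theta> C1V xh_in that]) (use min_v n_pos in \<open>simp add: pot_def\<close>)
  hence t1: "tinner d 1 (dtensor V xh) (tpow ?w) = 0"
    unfolding tinner_def One_nat_def sum_multi_idx_Suc multi_idx_0 by (simp add: dtensor_def)
  have t2: "tinner d 2 (dtensor V xh) (tpow ?w) = ip d z z"
  proof -
    have "tinner d 2 (dtensor V xh) (tpow ?w) = quad_form d H ?w"
      unfolding tinner_def numeral_2_eq_2 sum_multi_idx_Suc multi_idx_0 quad_form_def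
      by (simp add: dtensor_def tpow_def H_def HV_def hessian_def mult_ac)
    thus ?thesis by (simp add: quad_form_matvec_inv_sqrt[OF pd_H R_inv])
  qed
  have T1: "lin d xh ?w 1 = T z" by (simp add: lin_T)
  define r where "r = tinner d 4 (dtensor V (lin d xh ?w \<theta>)) (tpow ?w) / 24"
  have "- (V (T z) - V xh) + ip d z z / 2 = S z - r"
    using tay unfolding T1 t1 t2 S_def cubic_eq r_def by simp
  moreover have "\<bar>r\<bar> \<le> (eps4 d n v xh s / real d)\<^sup>2 * (ip d z z)\<^sup>2 / 24"
    unfolding r_def using fourth_order_bound[OF seg, of \<theta> z] \<theta> by simp
  ultimately show ?thesis by blast
qed

section \<open>The target as a perturbation of the standard Gaussian\<close>

lemma T_meas [measurable]: "T \<in> measurable (leb d) (leb d)"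
  by (rule measurable_into_leb) (auto simp: T_def vadd_def matvec_def Rd_def space_leb)

lemma density_meas: "(\<lambda>x. indicator \<Theta> x * exp (- V x)) \<in> borel_measurable (leb d)"
proof -
  have "continuous_on \<Theta> (partials [] V)" using Ck_V unfolding Ck_on_def by (metis multi_idx_0 singletonI zero_le)
  hence "continuous_on \<Theta> (\<lambda>x. exp (- V x))" by (simp add: continuous_intros)
  thus ?thesis by (rule measurable_continuous_on_open[OF \<Theta>])
qed

lemma q_meas [measurable]: "q \<in> borel_measurable (leb d)"
proof -
  have "q = (\<lambda>z. exp (V xh + ip d z z / 2) * (indicator \<Theta> (T z) * exp (- V (T z))))"
    by (auto simp: q_def fun_eq_iff exp_add[symmetric] algebra_simps)
  thus ?thesis using measurable_compose[OF T_meas density_meas] by simp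
qed

lemma S_meas [measurable]: "S \<in> borel_measurable (leb d)"
  unfolding S_def[abs_def] cubic_def by measurable

text \<open>The absolute value supplies the sign required of \<open>e4\<close>; all bounds contain
  only its square.\<close>

sublocale pert: perturbed_gaussian d s c0 "eps3 d n v xh" "\<bar>eps4 d n v xh s\<bar>" S q
proof
  show "S (\<lambda>i\<in>{..<d}. - z i) = - S z" for z
    by (simp add: S_def cubic_def sum_negf)
  show "\<bar>S z\<bar> \<le> eps3 d n v xh / (6 * real d) * nrm d z ^ 3" for z
    using cubic_bound[of z] by (simp add: S_def abs_mult)
  show "\<bar>S x - S y\<bar> \<le> 2 / 3 * (eps3 d n v xh / real d) * \<rho>\<^sup>2 * nrm d (\<lambda>i. x i - y i)"
    if "nrm d x \<le> \<rho>" "nrm d y \<le> \<rho>" for \<rho> x y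
  proof -
    have "\<bar>cubic d Q x - cubic d Q y\<bar> \<le> 4 * (eps3 d n v xh / real d) * \<rho>\<^sup>2 * nrm d (\<lambda>i. x i - y i)"
      by (rule cubic_lipschitz[OF cubic_bound _ that]) (use eps3_nonneg in simp)
    moreover have "S x - S y = - (1 / 6) * (cubic d Q x - cubic d Q y)" by (simp add: S_def algebra_simps)
    hence "\<bar>S x - S y\<bar> = 1 / 6 * \<bar>cubic d Q x - cubic d Q y\<bar>" by (simp add: abs_mult)
    ultimately show ?thesis by simp
  qed
  show "\<exists>r. q z = exp (S z - r) \<and> \<bar>r\<bar> \<le> \<bar>eps4 d n v xh s\<bar>\<^sup>2 * (ip d z z)\<^sup>2 / (24 * (real d)\<^sup>2)"
    if z: "nrm d z \<le> s * sqrt (real d)" for z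
  proof -
    have "T z \<in> \<Theta>" using loc z T_loc_region by blast
    thus ?thesis using expansion[OF z] by (auto simp: q_def power_divide mult.commute)
  qed
  show "0 \<le> q z \<and> q z \<le> exp (- (c0 * sqrt (real d) * nrm d z) + ip d z z / 2)"
    if z: "\<not> nrm d z \<le> s * sqrt (real d)" for z
  proof (cases "T z \<in> \<Theta>")
    case True
    have "s0 * sqrt (real d) \<le> s * sqrt (real d)" using s0_le by (intro mult_right_mono) auto
    hence "T z \<notin> loc_region d n v xh s0" using z unfolding T_loc_region by linarith
    hence "c0 * sqrt (real d / n) * wnorm d (hessian v xh) (vsub d (T z) xh) \<le> v (T z) - v xh"
      using A2 True unfolding assumption_A2_def by blast
    hence "c0 * (sqrt (real d) / sqrt n) * (nrm d z / sqrt n) \<le> v (T z) - v xh"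
      by (simp add: vsub_T wnorm_v real_sqrt_divide)
    moreover have "c0 * (sqrt (real d) / sqrt n) * (nrm d z / sqrt n) = c0 * sqrt (real d) * nrm d z / n"
      using n_pos by (simp add: real_sqrt_mult_self)
    ultimately have "c0 * sqrt (real d) * nrm d z / n \<le> v (T z) - v xh" by (simp only:)
    hence "c0 * sqrt (real d) * nrm d z \<le> (v (T z) - v xh) * n" by (simp only: pos_divide_le_eq[OF n_pos])
    hence "c0 * sqrt (real d) * nrm d z \<le> V (T z) - V xh" by (simp add: pot_def algebra_simps)
    thus ?thesis using True by (simp add: q_def)
  qed (simp add: q_def)
qed (use d1 c0_pos c0_le_1 s_ge' eps3_nonneg in auto)

end

section \<open>Total variation\<close>

text \<open>\<open>B\<close> certifies that the real supremum in \<open>TV\<close> runs over a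
  bounded set.\<close>

lemma TV_upper:
  assumes "\<And>A. A \<in> sets (leb d) \<Longrightarrow> \<bar>\<mu> A - \<nu> A\<bar> \<le> B" "A \<in> sets (leb d)"
  shows "\<bar>\<mu> A - \<nu> A\<bar> \<le> TV d \<mu> \<nu>"
  unfolding TV_def by (rule cSUP_upper[OF assms(2) bdd_aboveI2]) (rule assms(1))

lemma TV_least:
  assumes "\<And>A. A \<in> sets (leb d) \<Longrightarrow> \<bar>\<mu> A - \<nu> A\<bar> \<le> B"
  shows "TV d \<mu> \<nu> \<le> B"
  unfolding TV_def by (rule cSUP_least) (use assms sets.empty_sets in auto)

lemma TV_triangle:
  assumes "\<And>A. A \<in> sets (leb d) \<Longrightarrow> \<bar>\<mu> A - \<nu> A\<bar> \<le> B1" "\<And>A. A \<in> sets (leb d) \<Longrightarrow> \<bar>\<nu> A - \<rho> A\<bar> \<le> B2"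
  shows "TV d \<mu> \<rho> \<le> TV d \<mu> \<nu> + TV d \<nu> \<rho>"
proof (rule TV_least)
  fix A assume A: "A \<in> sets (leb d)"
  show "\<bar>\<mu> A - \<rho> A\<bar> \<le> TV d \<mu> \<nu> + TV d \<nu> \<rho>"
    using TV_upper[of d \<mu> \<nu> B1 A, OF assms(1) A] TV_upper[of d \<nu> \<rho> B2 A, OF assms(2) A] by linarith
qed

lemma TV_commute: "TV d \<mu> \<nu> = TV d \<nu> \<mu>"
  by (simp add: TV_def abs_minus_commute)

lemma integral_stdg_neg:
  fixes f :: "_ \<Rightarrow> real"
  assumes "f \<in> borel_measurable (leb d)"
  shows "(\<integral>z. f (\<lambda>i\<in>{..<d}. - z i) \<partial>stdg d) = (\<integral>z. f z \<partial>stdg d)"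
proof -
  have "(\<lambda>z. \<lambda>i\<in>{..<d}. - z i) \<in> measurable (leb d) (leb d)"
    by (rule measurable_into_leb) (auto simp: Rd_def)
  hence "(\<lambda>z. \<lambda>i\<in>{..<d}. - z i) \<in> measurable (stdg d) (stdg d)"
    using sets_stdg[of d] by (simp add: measurable_stdg_eq cong: measurable_cong_sets)
  hence "(\<integral>z. f z \<partial>distr (stdg d) (stdg d) (\<lambda>z. \<lambda>i\<in>{..<d}. - z i)) = (\<integral>z. f (\<lambda>i\<in>{..<d}. - z i) \<partial>stdg d)"
    using assms by (intro integral_distr) (auto simp: measurable_stdg_eq)
  thus ?thesis by (simp add: distr_stdg_neg)
qed

context laplace_setup
begin

section \<open>Integrability and mass of the whitened density\<close>

lemma E_fac_eq: "E_fac d n v xh s = pert.E"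
  by (simp add: E_fac_def pert.E_def)

definition \<Delta> where "\<Delta> = 600 * (E_fac d n v xh s * ((eps3 d n v xh)\<^sup>2 + (eps4 d n v xh s)\<^sup>2) + tau d c0 s)"

lemma \<Delta>_nonneg: "0 \<le> \<Delta>"
  using pert.tau_nonneg pert.E_ge_1 by (simp add: \<Delta>_def E_fac_eq)

lemma S_sq_integrable: "integrable (stdg d) (\<lambda>z. (S z)\<^sup>2)"
  using integrable_cubic_square[of d Q] by (simp add: S_def power_mult_distrib power_divide)

lemma S_integrable: "integrable (stdg d) S"
proof -
  interpret prob_space "stdg d" by (rule prob_space_stdg)
  show ?thesis
    by (rule square_integrable_imp_integrable) (simp_all add: measurable_stdg_eq S_sq_integrable)
qed

lemma residual_integrable: "integrable (stdg d) (\<lambda>z. q z - 1 - S z)"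
  and residual_bound: "(\<integral>z. \<bar>q z - 1 - S z\<bar> \<partial>stdg d) \<le> \<Delta>"
proof -
  have le: "(\<integral>\<^sup>+z. ennreal \<bar>q z - 1 - S z\<bar> \<partial>stdg d) \<le> ennreal \<Delta>"
    using pert.perturbation_bound unfolding \<Delta>_def E_fac_eq power2_abs .
  show int: "integrable (stdg d) (\<lambda>z. q z - 1 - S z)"
    using le_less_trans[OF le ennreal_less_top] by (intro integrableI_bounded) (auto simp: measurable_stdg_eq)
  have "ennreal (\<integral>z. \<bar>q z - 1 - S z\<bar> \<partial>stdg d) = (\<integral>\<^sup>+z. ennreal \<bar>q z - 1 - S z\<bar> \<partial>stdg d)"
    using int by (intro nn_integral_eq_integral[symmetric]) auto
  hence "ennreal (\<integral>z. \<bar>q z - 1 - S z\<bar> \<partial>stdg d) \<le> ennreal \<Delta>" using le by (simp only:)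
  thus "(\<integral>z. \<bar>q z - 1 - S z\<bar> \<partial>stdg d) \<le> \<Delta>" by (simp only: ennreal_le_iff[OF \<Delta>_nonneg])
qed

text \<open>Finiteness of the mass of the target comes from the perturbation bound: \<open>q\<close>
  is the sum of the residual and the integrable function 1 + S.\<close>

lemma q_integrable: "integrable (stdg d) q"
proof -
  interpret prob_space "stdg d" by (rule prob_space_stdg)
  have "integrable (stdg d) (\<lambda>z. (q z - 1 - S z) + (1 + S z))"
    by (intro Bochner_Integration.integrable_add residual_integrable S_integrable integrable_const)
  thus ?thesis by simp
qed

lemma q_nonneg: "0 \<le> q z" by (simp add: q_def)

text \<open>\<open>q\<close> is positive on the ball, so a zero integral would place all Gaussian
  mass outside it. But already beyond radius 4 sqrt d the mass is at most exp (d/2 - 4d), less than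
  1.\<close>

lemma q_integral_pos: "0 < (\<integral>z. q z \<partial>stdg d)"
proof -
  interpret prob_space "stdg d" by (rule prob_space_stdg)
  have ms: "{z \<in> space (stdg d). z \<in> pert.U} \<in> sets (stdg d)"
    unfolding sets_stdg space_stdg space_leb[symmetric] by measurable
  have "(\<integral>z. q z \<partial>stdg d) \<noteq> 0"
  proof
    assume "(\<integral>z. q z \<partial>stdg d) = 0"
    hence "AE z in stdg d. q z = 0"
      using integral_nonneg_eq_0_iff_AE[OF q_integrable] q_nonneg by auto
    hence "AE z in stdg d. z \<notin> pert.U"
    proof (rule AE_mp, intro AE_I2 impI)
      fix z assume z: "z \<in> space (stdg d)" "q z = 0"
      show "z \<notin> pert.U"
        using pert.q_in[of z] z by (auto simp: pert.U_def space_stdg)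
    qed
    hence one: "emeasure (stdg d) {z \<in> space (stdg d). \<not> z \<in> pert.U} = 1"
      using ms by (intro emeasure_eq_1_AE) auto
    have "emeasure (stdg d) {z \<in> space (stdg d). \<not> z \<in> pert.U} \<le>
      (\<integral>\<^sup>+x. indicator {x. 16 * real d < ip d x x} x * ennreal (exp (0 * ip d x x)) \<partial>stdg d)"
    proof -
      have "emeasure (stdg d) {z \<in> space (stdg d). \<not> z \<in> pert.U} = (\<integral>\<^sup>+x. indicator {z \<in> space (stdg d). \<not> z \<in> pert.U} x \<partial>stdg d)"
        by (rule nn_integral_indicator[symmetric]) (rule sets.sets_Collect_neg[OF ms])
      also have "\<dots> \<le> (\<integral>\<^sup>+x. indicator {x. 16 * real d < ip d x x} x * ennreal (exp (0 * ip d x x)) \<partial>stdg d)"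
      proof (rule nn_integral_mono)
        fix x
        have "16 * real d < ip d x x" if "\<not> x \<in> pert.U"
        proof -
          have "4 * sqrt (real d) < s * sqrt (real d)" using pert.s_ge_8 d1 by (intro mult_strict_right_mono) auto
          hence "4 * sqrt (real d) < nrm d x" using that by (simp add: pert.U_def)
          hence "(4 * sqrt (real d))\<^sup>2 < (nrm d x)\<^sup>2" by (intro power_strict_mono) auto
          thus ?thesis by (simp add: nrm_sq power_mult_distrib)
        qed
        thus "indicator {z \<in> space (stdg d). \<not> z \<in> pert.U} x \<le> indicator {x. 16 * real d < ip d x x} x * ennreal (exp (0 * ip d x x))"
          by (auto simp: indicator_def)
      qed
      finally show ?thesis .
    qed
    also have "\<dots> \<le> ennreal (exp (real d / 2 - (1/4 - 0) * (16 * real d)))" by (rule stdg_exp_tail) simp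
    also have "\<dots> < 1" using d1 by simp
    finally show False using one by simp
  qed
  moreover have "0 \<le> (\<integral>z. q z \<partial>stdg d)" using q_nonneg by simp
  ultimately show ?thesis by simp
qed

lemma S_neg: "S (\<lambda>i\<in>{..<d}. - z i) = - S z"
  by (simp add: S_def cubic_def sum_negf)

text \<open>The reflection of \<open>z\<close> preserves the Gaussian measure and the preimage of
  \<open>A\<close>, and changes the sign of S.\<close>

lemma integral_odd_zero:
  assumes [measurable]: "A \<in> sets (leb d)" and sym: "\<And>z. z \<in> Rd d \<Longrightarrow> T (\<lambda>i\<in>{..<d}. - z i) \<in> A \<longleftrightarrow> T z \<in> A"
  shows "(\<integral>z. indicator A (T z) * S z \<partial>stdg d) = 0"
proof -
  have "(\<integral>z. indicator A (T z) * S z \<partial>stdg d) = (\<integral>z. indicator A (T (\<lambda>i\<in>{..<d}. - z i)) * S (\<lambda>i\<in>{..<d}. - z i) \<partial>stdg d)"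
    by (rule integral_stdg_neg[symmetric]) measurable
  also have "\<dots> = (\<integral>z. - (indicator A (T z) * S z) \<partial>stdg d)"
    by (intro Bochner_Integration.integral_cong) (auto simp: S_neg sym space_stdg indicator_def)
  finally show ?thesis by simp
qed

lemma S_integral_zero: "(\<integral>z. S z \<partial>stdg d) = 0"
proof -
  have "(\<integral>z. indicator (space (leb d)) (T z) * S z \<partial>stdg d) = 0"
    by (rule integral_odd_zero[OF sets.top]) (simp add: space_leb)
  thus ?thesis by (simp add: space_leb)
qed

section \<open>The three measures as integrals against the standard Gaussian\<close>

lemma laplace_eq: "laplace d n v xh = distr (stdg d) (leb d) T"
proof -
  have "laplace d n v xh = distr (stdg d) (leb d) (\<lambda>z. vadd d xh (matvec d R z))"
    unfolding laplace_def H_def[symmetric] by (rule gaussian_eq_distr[OF pd_H R_inv])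
  thus ?thesis by (simp add: T_def[abs_def])
qed

lemma T_meas_stdg [measurable]: "T \<in> measurable (stdg d) (leb d)"
  unfolding measurable_stdg_eq by (rule T_meas)

lemma integrable_restrict:
  assumes "A \<in> sets (leb d)" "integrable (stdg d) f"
  shows "integrable (stdg d) (\<lambda>z. indicator A (T z) * f z :: real)"
proof (rule Bochner_Integration.integrable_bound[OF assms(2)])
  have [measurable]: "f \<in> borel_measurable (stdg d)" using assms by simp
  show "(\<lambda>z. indicator A (T z) * f z) \<in> borel_measurable (stdg d)" using assms(1) by measurable
qed (auto simp: indicator_def)

lemma measure_target:
  assumes "A \<in> sets (leb d)"
  shows "measure (target d n \<Theta> v) A = (\<integral>z. indicator A (T z) * q z \<partial>stdg d) / (\<integral>z. q z \<partial>stdg d)"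
proof -
  obtain c where c: "c > 0" "leb_scaling d (\<lambda>z. vadd d xh (matvec d R z)) c" using leb_scaling_affine[OF pd_R] by auto
  show ?thesis unfolding target_def
    by (rule gibbs_measure_eq[OF _ c(1) density_meas q_integrable q_nonneg q_integral_pos, where b="exp (- V xh)"])
       (use c(2) assms in \<open>auto simp: T_def[abs_def] q_def exp_add[symmetric] indicator_def\<close>)
qed

lemma measure_laplace:
  assumes "A \<in> sets (leb d)"
  shows "measure (laplace d n v xh) A = (\<integral>z. indicator A (T z) \<partial>stdg d)"
proof -
  interpret prob_space "stdg d" by (rule prob_space_stdg)
  have "measure (laplace d n v xh) A = (\<integral>x. indicator A x \<partial>distr (stdg d) (leb d) T)"
    unfolding laplace_eq using assms sets.sets_into_space[OF assms] by (simp add: Int_absorb2)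
  also have "\<dots> = (\<integral>z. indicator A (T z) \<partial>stdg d)"
    by (rule integral_distr) (use assms in measurable)
  finally show ?thesis .
qed

lemma skew_meas [measurable]: "skew d n v xh \<in> borel_measurable (leb d)"
proof -
  have "skew d n v xh x = - (1/6) * cubic d (\<lambda>a b c. dtensor V xh [a, b, c]) (vsub d x xh)" for x
    by (simp add: skew_def tinner3_cubic)
  moreover have "(\<lambda>x. - (1/6) * cubic d (\<lambda>a b c. dtensor V xh [a, b, c]) (vsub d x xh)) \<in> borel_measurable (leb d)"
    unfolding cubic_def by (intro borel_measurable_times borel_measurable_const borel_measurable_sum measurable_compose[OF measurable_vsub measurable_coord])
  ultimately show ?thesis by (simp cong: measurable_cong)
qed

lemma laplace_skew_eq:
  assumes [measurable]: "A \<in> sets (leb d)"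
  shows "laplace_skew d n v xh A = measure (laplace d n v xh) A + (\<integral>z. indicator A (T z) * S z \<partial>stdg d)"
proof -
  interpret prob_space "stdg d" by (rule prob_space_stdg)
  have "laplace_skew d n v xh A = (\<integral>x. indicator A x * (1 + skew d n v xh x) \<partial>distr (stdg d) (leb d) T)"
    by (simp add: laplace_skew_def laplace_eq set_lebesgue_integral_def)
  also have "\<dots> = (\<integral>z. indicator A (T z) * (1 + skew d n v xh (T z)) \<partial>stdg d)"
    by (rule integral_distr) measurable
  also have "\<dots> = (\<integral>z. indicator A (T z) * 1 + indicator A (T z) * S z \<partial>stdg d)"
    by (simp add: S_eq_skew algebra_simps)
  also have "\<dots> = (\<integral>z. indicator A (T z) * 1 \<partial>stdg d) + (\<integral>z. indicator A (T z) * S z \<partial>stdg d)"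
    by (intro Bochner_Integration.integral_add integrable_restrict S_integrable) auto
  finally show ?thesis by (simp add: measure_laplace)
qed

lemma abs_integral_restrict_le:
  fixes f :: "_ \<Rightarrow> real"
  assumes "A \<in> sets (leb d)" "integrable (stdg d) f"
  shows "\<bar>\<integral>z. indicator A (T z) * f z \<partial>stdg d\<bar> \<le> (\<integral>z. \<bar>f z\<bar> \<partial>stdg d)"
proof -
  have "\<bar>\<integral>z. indicator A (T z) * f z \<partial>stdg d\<bar> \<le> (\<integral>z. \<bar>indicator A (T z) * f z\<bar> \<partial>stdg d)"
    by (rule integral_abs_bound)
  also have "\<dots> \<le> (\<integral>z. \<bar>f z\<bar> \<partial>stdg d)"
    by (intro integral_mono integrable_abs integrable_restrict assms) (auto simp: indicator_def)
  finally show ?thesis .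
qed

text \<open>Since \<open>1 + S\<close> integrates to \<open>1\<close>, the normalising constant of \<open>q\<close> is at distance at most
  \<open>\<integral>\<bar>q - 1 - S\<bar>\<close> from \<open>1\<close>, so no lower bound on it is needed.\<close>

lemma target_skew_le:
  assumes A: "A \<in> sets (leb d)"
  shows "\<bar>measure (target d n \<Theta> v) A - laplace_skew d n v xh A\<bar> \<le> 2 * \<Delta>"
proof -
  interpret prob_space "stdg d" by (rule prob_space_stdg)
  define Z where "Z = (\<integral>z. q z \<partial>stdg d)"
  define I where "I = (\<integral>z. indicator A (T z) * q z \<partial>stdg d)"
  have Z: "Z > 0" unfolding Z_def by (rule q_integral_pos)
  have I: "0 \<le> I" "I \<le> Z"
  proof -
    show "0 \<le> I" unfolding I_def using q_nonneg by simp
    show "I \<le> Z" unfolding I_def Z_def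
      by (intro integral_mono integrable_restrict A q_integrable) (auto simp: indicator_def q_nonneg)
  qed
  have a: "Z - 1 = (\<integral>z. q z - 1 - S z \<partial>stdg d)"
    using S_integral_zero by (simp add: Z_def q_integrable S_integrable prob_space)
  have Z1: "\<bar>Z - 1\<bar> \<le> \<Delta>"
    unfolding a by (rule order_trans[OF integral_abs_bound residual_bound])
  have "I - laplace_skew d n v xh A = (\<integral>z. indicator A (T z) * (q z - 1 - S z) \<partial>stdg d)"
  proof -
    have "(\<integral>z. indicator A (T z) * (q z - 1 - S z) \<partial>stdg d) = (\<integral>z. indicator A (T z) * q z - indicator A (T z) * 1 - indicator A (T z) * S z \<partial>stdg d)"
      by (simp add: algebra_simps)
    also have "\<dots> = I - (\<integral>z. indicator A (T z) * 1 \<partial>stdg d) - (\<integral>z. indicator A (T z) * S z \<partial>stdg d)"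
    proof -
      have i: "integrable (stdg d) (\<lambda>z. indicator A (T z) * q z)" "integrable (stdg d) (\<lambda>z. indicator A (T z) * 1 :: real)"
         "integrable (stdg d) (\<lambda>z. indicator A (T z) * S z)"
        by (rule integrable_restrict[OF A]; simp add: q_integrable S_integrable)+
      show ?thesis unfolding I_def using i
        by (subst Bochner_Integration.integral_diff) (auto simp del: mult_1_right intro!: Bochner_Integration.integral_diff arg_cong2[where f="(-)"])
    qed
    finally show ?thesis using laplace_skew_eq[OF A] measure_laplace[OF A] by simp
  qed
  hence 1: "\<bar>I - laplace_skew d n v xh A\<bar> \<le> \<Delta>"
    using abs_integral_restrict_le[OF A residual_integrable] residual_bound by linarith
  \<comment> \<open>Since \<open>I / Z\<close> lies in [0, 1], normalising costs at most |Z -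
    1|.\<close>
  have "I / Z - I = (I / Z) * (1 - Z)" using Z by (simp add: field_simps)
  hence "\<bar>I / Z - I\<bar> = (I / Z) * \<bar>Z - 1\<bar>" using I Z by (simp add: abs_mult abs_minus_commute)
  also have "\<dots> \<le> 1 * \<bar>Z - 1\<bar>" using I Z by (intro mult_right_mono) auto
  finally have 2: "\<bar>I / Z - I\<bar> \<le> \<Delta>" using Z1 by simp
  have "measure (target d n \<Theta> v) A = I / Z" using measure_target[OF A] by (simp add: I_def Z_def)
  thus ?thesis using 1 2 by linarith
qed

section \<open>The leading term\<close>

lemma LTV_eq: "LTV d n v xh = 1 / 2 * (\<integral>z. \<bar>S z\<bar> \<partial>stdg d)"
  unfolding LTV_def laplace_eq by (subst integral_distr) (simp_all add: S_eq_skew)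

lemma LTV_formula:
  "LTV d n v xh = 1 / 12 * (\<integral>z. \<bar>tinner d 3 (dtensor V xh) (tpow (matvec d (inv_sqrt d (HV n v xh)) z))\<bar> \<partial>gaussian d (vzero d) ident)"
  unfolding LTV_eq gaussian_ident S_def cubic_eq by (simp add: R_def H_def abs_mult)

lemma LTV_nonneg: "0 \<le> LTV d n v xh" by (simp add: LTV_eq)

lemma LTV_le: "LTV d n v xh \<le> eps3_bar d n v xh / 2"
proof -
  interpret prob_space "stdg d" by (rule prob_space_stdg)
  define m where "m = (\<integral>z. \<bar>S z\<bar> \<partial>stdg d)"
  \<comment> \<open>Jensen's inequality, read off from the nonnegative variance of |S|.\<close>
  have "0 \<le> (\<integral>z. (\<bar>S z\<bar> - m)\<^sup>2 \<partial>stdg d)" by simp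
  also have "\<dots> = (\<integral>z. (S z)\<^sup>2 - (2 * m * \<bar>S z\<bar> - m\<^sup>2) \<partial>stdg d)"
    by (intro Bochner_Integration.integral_cong) (auto simp: power2_eq_square algebra_simps)
  also have "\<dots> = (\<integral>z. (S z)\<^sup>2 \<partial>stdg d) - (2 * m * m - m\<^sup>2)"
    using S_integrable S_sq_integrable by (simp add: m_def prob_space)
  finally have "m\<^sup>2 \<le> (eps3_bar d n v xh)\<^sup>2" unfolding eps3_bar_sq by (simp add: power2_eq_square)
  hence "m \<le> eps3_bar d n v xh" by (rule power2_le_imp_le) (rule eps3_bar_nonneg)
  thus ?thesis unfolding LTV_eq m_def by simp
qed

text \<open>S has mean zero, so twice its integral over \<open>A\<close> is the integral of S times
  a function with values 1 and -1; hence the factor 1/2 in \<open>LTV\<close>.\<close>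

lemma abs_integral_restrict_S_le:
  assumes A: "A \<in> sets (leb d)"
  shows "\<bar>\<integral>z. indicator A (T z) * S z \<partial>stdg d\<bar> \<le> LTV d n v xh"
proof -
  define J where "J = (\<integral>z. indicator A (T z) * S z \<partial>stdg d)"
  have a: "2 * J = (\<integral>z. 2 * (indicator A (T z) * S z) - S z \<partial>stdg d)"
    using integrable_restrict[OF A S_integrable] S_integrable S_integral_zero by (simp add: J_def)
  have "\<bar>2 * J\<bar> \<le> (\<integral>z. \<bar>2 * (indicator A (T z) * S z) - S z\<bar> \<partial>stdg d)" unfolding a by (rule integral_abs_bound)
  also have "\<dots> = (\<integral>z. \<bar>S z\<bar> \<partial>stdg d)"
    by (intro Bochner_Integration.integral_cong) (auto simp: indicator_def)
  finally show ?thesis unfolding LTV_eq J_def by simp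
qed

lemma TV_laplace_skew: "TV d (measure (laplace d n v xh)) (laplace_skew d n v xh) = LTV d n v xh"
proof (rule antisym)
  show "TV d (measure (laplace d n v xh)) (laplace_skew d n v xh) \<le> LTV d n v xh"
    by (rule TV_least) (simp add: laplace_skew_eq abs_integral_restrict_S_le)
next
  \<comment> \<open>The set where the supremum is attained: the positive part of a function of mean
    zero carries half of its L1 norm.\<close>
  define A where "A = {x \<in> space (leb d). 0 < skew d n v xh x}"
  have A: "A \<in> sets (leb d)" unfolding A_def by measurable
  have "LTV d n v xh = (\<integral>z. 1/2 * \<bar>S z\<bar> + 1/2 * S z \<partial>stdg d)"
    using S_integrable S_integral_zero by (simp add: LTV_eq)
  also have "\<dots> = (\<integral>z. indicator A (T z) * S z \<partial>stdg d)"
    by (intro Bochner_Integration.integral_cong) (auto simp: A_def S_eq_skew space_leb indicator_def)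
  also have "\<dots> \<le> \<bar>measure (laplace d n v xh) A - laplace_skew d n v xh A\<bar>"
    by (simp add: laplace_skew_eq[OF A])
  also have "\<dots> \<le> TV d (measure (laplace d n v xh)) (laplace_skew d n v xh)"
    by (rule TV_upper[OF _ A, where B="LTV d n v xh"]) (simp add: laplace_skew_eq abs_integral_restrict_S_le)
  finally show "LTV d n v xh \<le> TV d (measure (laplace d n v xh)) (laplace_skew d n v xh)" .
qed

section \<open>Comparison of the total variation distances\<close>

lemma laplace_skew_bounded:
  "A \<in> sets (leb d) \<Longrightarrow> \<bar>measure (laplace d n v xh) A - laplace_skew d n v xh A\<bar> \<le> LTV d n v xh"
  by (simp add: laplace_skew_eq abs_integral_restrict_S_le)

lemma target_laplace_bounded:
  "A \<in> sets (leb d) \<Longrightarrow> \<bar>measure (target d n \<Theta> v) A - measure (laplace d n v xh) A\<bar> \<le> 2 * \<Delta> + LTV d n v xh"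
  using target_skew_le[of A] laplace_skew_bounded[of A] by linarith

text \<open>The reverse triangle inequality, as \<open>LTV\<close> is itself the distance between
  the Laplace approximation and its skew correction.\<close>

lemma RTV_le: "\<bar>RTV d n \<Theta> v xh\<bar> \<le> TV d (measure (target d n \<Theta> v)) (laplace_skew d n v xh)"
proof -
  let ?\<pi> = "measure (target d n \<Theta> v)" and ?\<gamma> = "measure (laplace d n v xh)" and ?\<sigma> = "laplace_skew d n v xh"
  have "TV d ?\<pi> ?\<gamma> \<le> TV d ?\<pi> ?\<sigma> + TV d ?\<sigma> ?\<gamma>"
    by (rule TV_triangle[OF target_skew_le]) (use laplace_skew_bounded in \<open>simp_all add: abs_minus_commute\<close>)
  moreover have "TV d ?\<gamma> ?\<sigma> \<le> TV d ?\<gamma> ?\<pi> + TV d ?\<pi> ?\<sigma>"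
    by (rule TV_triangle[OF _ target_skew_le]) (use target_laplace_bounded in \<open>simp_all add: abs_minus_commute\<close>)
  ultimately show ?thesis
    unfolding RTV_def using TV_laplace_skew TV_commute[of d ?\<sigma> ?\<gamma>] TV_commute[of d ?\<gamma> ?\<pi>] by linarith
qed

lemma TV_target_skew_le:
  "TV d (measure (target d n \<Theta> v)) (laplace_skew d n v xh)
     \<le> 1200 * (E_fac d n v xh s * ((eps3 d n v xh)\<^sup>2 + (eps4 d n v xh s)\<^sup>2) + tau d c0 s)"
  using TV_least[OF target_skew_le] by (simp add: \<Delta>_def)

text \<open>On a symmetric set the odd correction integrates to zero, so the Laplace approximation
  and its correction give the same value.\<close>

lemma symmetric_set_le:
  assumes A: "A \<in> sets (leb d)" and sym: "symmetric_about d xh A"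
  shows "\<bar>measure (target d n \<Theta> v) A - measure (laplace d n v xh) A\<bar>
    \<le> TV d (measure (target d n \<Theta> v)) (laplace_skew d n v xh)"
proof -
  have "T (\<lambda>i\<in>{..<d}. - z i) = vsub d xh (matvec d R z)" for z
    by (auto simp: T_def vadd_def vsub_def matvec_def fun_eq_iff sum_negf)
  hence "T (\<lambda>i\<in>{..<d}. - z i) \<in> A \<longleftrightarrow> T z \<in> A" for z
    using sym by (simp add: symmetric_about_def T_def)
  hence "laplace_skew d n v xh A = measure (laplace d n v xh) A"
    using integral_odd_zero[OF A] by (simp add: laplace_skew_eq[OF A])
  thus ?thesis
    using TV_upper[of d "measure (target d n \<Theta> v)" "laplace_skew d n v xh" "2 * \<Delta>" A, OF target_skew_le A] by simp
qed

end

theorem corollary2p23: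
  fixes B C :: real
  assumes "C > 0"
  shows "\<exists>K>0. \<forall>(d::nat) (n::real) (\<Theta> :: (nat \<Rightarrow> real) set) (v :: (nat \<Rightarrow> real) \<Rightarrow> real)
            (xh :: nat \<Rightarrow> real) (s0::real) (c0::real) (s::real).
     d \<ge> 1 \<longrightarrow> n > 0 \<longrightarrow> openin (top_of_set (Rd d)) \<Theta> \<longrightarrow>
     assumption_A1 d \<Theta> v xh \<longrightarrow> assumption_A2 C d n \<Theta> v xh s0 c0 \<longrightarrow>
     s \<ge> s_star s0 c0 \<longrightarrow> loc_region d n v xh s \<subseteq> \<Theta> \<longrightarrow>
     eps3 d n v xh \<le> B \<longrightarrow> eps4 d n v xh s \<le> B \<longrightarrow>
       LTV d n v xh = 1 / 12 *
         (\<integral>z. \<bar>tinner d 3 (dtensor (pot n v) xh) (tpow (matvec d (inv_sqrt d (HV n v xh)) z))\<bar>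
            \<partial>gaussian d (vzero d) ident) \<and>
       \<bar>RTV d n \<Theta> v xh\<bar> \<le> TV d (measure (target d n \<Theta> v)) (laplace_skew d n v xh) \<and>
       TV d (measure (target d n \<Theta> v)) (laplace_skew d n v xh)
         \<le> K * (E_fac d n v xh s * ((eps3 d n v xh)\<^sup>2 + (eps4 d n v xh s)\<^sup>2) + tau d c0 s) \<and>
       0 \<le> LTV d n v xh \<and> LTV d n v xh \<le> eps3_bar d n v xh / 2 \<and>
       TV d (measure (target d n \<Theta> v)) (measure (laplace d n v xh))
         \<le> eps3_bar d n v xh / 2 + \<bar>RTV d n \<Theta> v xh\<bar> \<and>
       (\<forall>A\<in>sets (leb d). symmetric_about d xh A \<longrightarrow>
          \<bar>measure (target d n \<Theta> v) A - measure (laplace d n v xh) A\<bar>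
            \<le> TV d (measure (target d n \<Theta> v)) (laplace_skew d n v xh))"
\<comment> \<open>1200 = 2 * 600: the perturbation bound enters once for the density and once for
  its normalising constant.\<close>
proof (intro exI[of _ 1200] conjI allI impI)
  fix d :: nat and n :: real and \<Theta> :: "(nat \<Rightarrow> real) set" and v :: "(nat \<Rightarrow> real) \<Rightarrow> real"
    and xh :: "nat \<Rightarrow> real" and s0 c0 s :: real
  assume "d \<ge> 1" "n > 0" "openin (top_of_set (Rd d)) \<Theta>" "assumption_A1 d \<Theta> v xh"
    "assumption_A2 C d n \<Theta> v xh s0 c0" "s \<ge> s_star s0 c0" "loc_region d n v xh s \<subseteq> \<Theta>"
  then interpret laplace_setup d n \<Theta> v xh s0 c0 s C
    using \<open>C > 0\<close> by unfold_locales
  show "LTV d n v xh = 1 / 12 *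
         (\<integral>z. \<bar>tinner d 3 (dtensor (pot n v) xh) (tpow (matvec d (inv_sqrt d (HV n v xh)) z))\<bar>
            \<partial>gaussian d (vzero d) ident)" by (rule LTV_formula)
  show "\<bar>RTV d n \<Theta> v xh\<bar> \<le> TV d (measure (target d n \<Theta> v)) (laplace_skew d n v xh)" by (rule RTV_le)
  show "TV d (measure (target d n \<Theta> v)) (laplace_skew d n v xh)
     \<le> 1200 * (E_fac d n v xh s * ((eps3 d n v xh)\<^sup>2 + (eps4 d n v xh s)\<^sup>2) + tau d c0 s)" by (rule TV_target_skew_le)
  show "0 \<le> LTV d n v xh" by (rule LTV_nonneg)
  show "LTV d n v xh \<le> eps3_bar d n v xh / 2" by (rule LTV_le)
  then show "TV d (measure (target d n \<Theta> v)) (measure (laplace d n v xh)) \<le> eps3_bar d n v xh / 2 + \<bar>RTV d n \<Theta> v xh\<bar>"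
    by (simp add: RTV_def)
  show "\<forall>A\<in>sets (leb d). symmetric_about d xh A \<longrightarrow>
      \<bar>measure (target d n \<Theta> v) A - measure (laplace d n v xh) A\<bar>
        \<le> TV d (measure (target d n \<Theta> v)) (laplace_skew d n v xh)"
    using symmetric_set_le by blast
qed simp

end
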